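(* Let $\underline R$ be a commutative square ring, let $(M,A)$ and $(N,B)$ be two $\underline R$-CP-modules and $f:M\to N$ a map. Write $\overline M=M/A$ (an $\overline R$-module) and $i_B:B\hookrightarrow N$ for the inclusion. Then $f:(M,A)\to(N,B)$ is $\underline R$-CP-quadratic if and only if it satisfies the following properties: (1) $f(A)\subset B$; (2) the map $d_f:M\times M\to N$ factors through a morphism of $\overline R$-modules $\overline{d_f}:\overline M\otimes_{\overline R}\overline M\to B$, i.e. $d_f(m,m')=i_B\,\overline{d_f}(\overline m\otimes\overline{m'})$ for all $m,m'\in M$; (3) for every $r\in R_e$, the map $f_{(r)}:M\to N$ factors through a morphism of $\overline R$-modules $\overline{f_{(r)}}:\Gamma^2_{\overline R}(\overline M)\to B$, i.e. $f_{(r)}(m)=i_B\,\overline{f_{(r)}}(\gamma_2(\overline m))$ for all $m\in M$.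
   Context: A square ring $\underline R=(R_e\xrightarrow{H}R_{ee}\xrightarrow{P}R_e)$ consists of: a set $R_e$ with a group structure $+$ (not necessarily commutative) and an associative unital multiplication satisfying $r(s+t)=rs+rt$ (the law $(r+s)t=rt+st$ is not required); an abelian group $R_{ee}$; a map $R_e\times R_e\times R_{ee}\times R_e\to R_{ee}$, $(r,s,x,t)\mapsto(r,s)\cdot x\cdot t$, additive in each of its four variables and defining commuting actions on $R_{ee}$ of the multiplicative monoids $R_e\times R_e$ (on the left) and $R_e$ (on the right) (write $(r,s)\cdot x$ if $t=1$ and $x\cdot t$ if $r=s=1$); a group homomorphism $T:R_{ee}\to R_{ee}$ with $T^2=\mathrm{Id}$; a map $H:R_e\to R_{ee}$ and a group homomorphism $P:R_{ee}\to R_e$; such that for all $r,s,t\in R_e$, $x,y\in R_{ee}$: $PHP=P+P$; $P((r,r)\cdot x\cdot s)=rP(x)s$; $T=HP-\mathrm{Id}$; $PT=P$; $(P(x),r)\cdot y=(r,P(x))\cdot y=0=y\cdot P(x)$; $H(r+s)=H(r)+H(s)+(s,r)\cdot H(2)$ where $2=1+1$; $H(rs)=(r,r)\cdot H(s)+H(r)\cdot s$; $(r+s)t=rt+st+P((r,s)\cdot H(t))$; $T((r,s)\cdot x\cdot t)=(s,r)\cdot T(x)\cdot t$. The quotient $\overline R=R_e/\operatorname{Im}P$ is a ring. $\underline R$ is commutative if $\overline R$ is commutative and $(r,1)\cdot x=(1,r)\cdot x=x\cdot r$ for all $r\in R_e$, $x\in R_{ee}$. A (right) $\underline R$-BHP-module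 is a group $M$ (written additively, not necessarily commutative) with operations $M\times R_e\to M$, $(m,r)\mapsto m\cdot r$ and $M\times M\times R_{ee}\to M$, $(m,n,x)\mapsto[m,n]\cdot x$ such that: $m\cdot1=m$, $(m\cdot r)\cdot s=m\cdot(rs)$, $m\cdot(r+s)=m\cdot r+m\cdot s$; $(m+n)\cdot r=m\cdot r+n\cdot r+[m,n]\cdot H(r)$; $m\cdot P(x)=[m,m]\cdot x$; $[m,n]\cdot T(x)=[n,m]\cdot x$; $[m,n]\cdot x$ is additive in each of $m,n,x$; $([m\cdot r,n\cdot s]\cdot x)\cdot t=[m,n]\cdot((r,s)\cdot x\cdot t)$; $[[m,m']\cdot x,n]\cdot y=0$. An $\underline R$-CP-module is a pair $(M,A)$ where $M$ is an $\underline R$-BHP-module and $A$ is a subgroup of $M$, stable under the action of $R_e$, such that $[m,n]\cdot x=0$ whenever $m\in A$, and $[m,n]\cdot x\in A$ for all $m,n\in M$, $x\in R_{ee}$. Then $A$ and $M/A$ are $\overline R$-modules under the operations induced from $M$; $\overline m$ denotes the class of $m$ in $M/A$. A map between BHP-modules is $\underline R$-linear if it is additive and commutes with the operations $\cdot r$ ($r\in R_e$) and $[-,-]\cdot x$ ($x\in R_{ee}$); a map $M\times M\to N$ is $\underline R$-bilinear if it is $\underline R$-linear in each variable separately. For a map $f:M\to N$ of BHP-modules put $d_f(m,m')=f(m+m')-f(m')-f(m)$; $f_{(r)}(m)=f(m\cdot r)-f(m)\cdot r$ for $r\in R_e$; $f_{[x]}(m,m')=f([m,m']\cdot x)-[f(m),f(m')]\cdot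 x$ for $x\in R_{ee}$. For a map $g$ from a set to a BHP-module $N$, $\operatorname{Im}_{\underline R}g$ is the smallest subgroup of $N$ containing the image of $g$ and stable under the operations of $R_e$ and $R_{ee}$. For $\underline R$ commutative, a map $f:(M,A)\to(N,B)$ of $\underline R$-CP-modules (i.e. a map $f:M\to N$) is $\underline R$-CP-quadratic if: (i) $f(A)$, $\operatorname{Im}_{\underline R}d_f$, $\operatorname{Im}_{\underline R}f_{(r)}$, $\operatorname{Im}_{\underline R}f_{[x]}$ are contained in $B$ for all $r\in R_e,x\in R_{ee}$; (ii) $d_f$ and all $f_{[x]}$ are $\underline R$-bilinear; (iii) $f_{(r)}(m\cdot s)=f_{(r)}(m)\cdot s^2$ for all $m\in M$, $r,s\in R_e$; (iv) $d_f(M,A)=d_f(A,M)=0$, $f_{(r)}(A)=0$, $f_{[x]}(M,A)=f_{[x]}(A,M)=0$ for all $r,x$. For a module $X$ over a commutative ring $S$, $\Gamma^2_S(X)$ is the homogeneous component of degree $2$ of the divided power algebra on $X$ and $\gamma_2:X\to\Gamma^2_S(X)$ is the canonical map (the universal map to $S$-modules that satisfies $\gamma_2(us)=\gamma_2(u)s^2$ and whose cross-effect $\gamma_2(u+v)-\gamma_2(u)-\gamma_2(v)$ is $S$-bilinear). *)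

theory Defs
  imports "HOL-Library.Multiset" "HOL-Algebra.QuotRing" "HOL-Algebra.Module"
begin

section \<open>Modules over a commutative ring: quotients, tensor products, divided powers\<close>

text \<open>As for the library's \<^locale>\<open>module\<close>, the fields \<^const>\<open>mult\<close> and \<^const>\<open>one\<close> of a record used
  only as a module carry no meaning. Right modules over a commutative ring are written with
  the library's left action \<^const>\<open>smult\<close>.\<close>

definition mod_hom ::
  "('s, 'p) ring_scheme \<Rightarrow> ('s, 'a, 'q) module_scheme \<Rightarrow> ('s, 'b, 'u) module_scheme \<Rightarrow> ('a \<Rightarrow> 'b) set"
  where "mod_hom S X Y =
    {h \<in> hom (add_monoid X) (add_monoid Y).
       \<forall>s \<in> carrier S. \<forall>x \<in> carrier X. h (s \<odot>\<^bsub>X\<^esub> x) = s \<odot>\<^bsub>Y\<^esub> h x}"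

definition module_span ::
  "('s, 'p) ring_scheme \<Rightarrow> ('s, 'a, 'q) module_scheme \<Rightarrow> 'a set \<Rightarrow> 'a set"
  where "module_span S X G = \<Inter> {K. submodule K S X \<and> G \<subseteq> K}"

definition quotient_module ::
  "('s, 'a, 'q) module_scheme \<Rightarrow> 'a set \<Rightarrow> ('s, 'a set) module"
  where "quotient_module X K =
    \<lparr>carrier = carrier (X Quot K), mult = mult (X Quot K), one = one (X Quot K),
     zero = zero (X Quot K), add = add (X Quot K),
     smult = (\<lambda>s C. \<Union>c \<in> C. K +>\<^bsub>X\<^esub> (s \<odot>\<^bsub>X\<^esub> c))\<rparr>"

definition fin_supp_fun :: "('s, 'p) ring_scheme \<Rightarrow> 'i set \<Rightarrow> ('i \<Rightarrow> 's) set"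
  where "fin_supp_fun S I =
    {p. (\<forall>i \<in> I. p i \<in> carrier S) \<and> (\<forall>i. i \<notin> I \<longrightarrow> p i = \<zero>\<^bsub>S\<^esub>) \<and> finite {i. p i \<noteq> \<zero>\<^bsub>S\<^esub>}}"

definition basis_fun :: "('s, 'p) ring_scheme \<Rightarrow> 'i \<Rightarrow> 'i \<Rightarrow> 's"
  where "basis_fun S i = (\<lambda>j. if j = i then \<one>\<^bsub>S\<^esub> else \<zero>\<^bsub>S\<^esub>)"

definition free_module :: "('s, 'p) ring_scheme \<Rightarrow> 'i set \<Rightarrow> ('s, 'i \<Rightarrow> 's) module"
  where "free_module S I =
    \<lparr>carrier = fin_supp_fun S I, mult = (\<lambda>_ _ _. \<zero>\<^bsub>S\<^esub>), one = (\<lambda>_. \<zero>\<^bsub>S\<^esub>), zero = (\<lambda>_. \<zero>\<^bsub>S\<^esub>),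
     add = (\<lambda>p q i. p i \<oplus>\<^bsub>S\<^esub> q i), smult = (\<lambda>s p i. s \<otimes>\<^bsub>S\<^esub> p i)\<rparr>"

definition tensor_relations ::
  "('s, 'p) ring_scheme \<Rightarrow> ('s, 'a, 'q) module_scheme \<Rightarrow> ('s, 'b, 'u) module_scheme \<Rightarrow> ('a \<times> 'b \<Rightarrow> 's) set"
  where "tensor_relations S X Y =
    (let F = free_module S (carrier X \<times> carrier Y); d = (\<lambda>x y. basis_fun S (x, y)) in
      {d (x \<oplus>\<^bsub>X\<^esub> x') y \<ominus>\<^bsub>F\<^esub> (d x y \<oplus>\<^bsub>F\<^esub> d x' y) |x x' y.
         x \<in> carrier X \<and> x' \<in> carrier X \<and> y \<in> carrier Y} \<union>
      {d x (y \<oplus>\<^bsub>Y\<^esub> y') \<ominus>\<^bsub>F\<^esub> (d x y \<oplus>\<^bsub>F\<^esub> d x y') |x y y'.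
         x \<in> carrier X \<and> y \<in> carrier Y \<and> y' \<in> carrier Y} \<union>
      {d (s \<odot>\<^bsub>X\<^esub> x) y \<ominus>\<^bsub>F\<^esub> (s \<odot>\<^bsub>F\<^esub> d x y) |s x y.
         s \<in> carrier S \<and> x \<in> carrier X \<and> y \<in> carrier Y} \<union>
      {d x (s \<odot>\<^bsub>Y\<^esub> y) \<ominus>\<^bsub>F\<^esub> (s \<odot>\<^bsub>F\<^esub> d x y) |s x y.
         s \<in> carrier S \<and> x \<in> carrier X \<and> y \<in> carrier Y})"

definition tensor_kernel ::
  "('s, 'p) ring_scheme \<Rightarrow> ('s, 'a, 'q) module_scheme \<Rightarrow> ('s, 'b, 'u) module_scheme \<Rightarrow> ('a \<times> 'b \<Rightarrow> 's) set"
  where "tensor_kernel S X Y =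
    module_span S (free_module S (carrier X \<times> carrier Y)) (tensor_relations S X Y)"

definition tensor_module ::
  "('s, 'p) ring_scheme \<Rightarrow> ('s, 'a, 'q) module_scheme \<Rightarrow> ('s, 'b, 'u) module_scheme \<Rightarrow>
   ('s, ('a \<times> 'b \<Rightarrow> 's) set) module"
  where "tensor_module S X Y =
    quotient_module (free_module S (carrier X \<times> carrier Y)) (tensor_kernel S X Y)"

definition pure_tensor ::
  "('s, 'p) ring_scheme \<Rightarrow> ('s, 'a, 'q) module_scheme \<Rightarrow> ('s, 'b, 'u) module_scheme \<Rightarrow>
   'a \<Rightarrow> 'b \<Rightarrow> ('a \<times> 'b \<Rightarrow> 's) set"
  where "pure_tensor S X Y x y =
    tensor_kernel S X Y +>\<^bsub>free_module S (carrier X \<times> carrier Y)\<^esub> basis_fun S (x, y)"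

text \<open>The polynomial algebra over \<open>S\<close> on a set \<open>I\<close> of variables: monomials are multisets over
  \<open>I\<close>, and a polynomial maps each monomial to its coefficient.\<close>

definition poly_algebra :: "('s, 'p) ring_scheme \<Rightarrow> 'i set \<Rightarrow> ('s, 'i multiset \<Rightarrow> 's) module"
  where "poly_algebra S I =
    \<lparr>carrier = fin_supp_fun S {m. set_mset m \<subseteq> I},
     mult = (\<lambda>p q m. finsum S (\<lambda>(k, l). p k \<otimes>\<^bsub>S\<^esub> q l) {(k, l). k + l = m}),
     one = basis_fun S {#}, zero = (\<lambda>_. \<zero>\<^bsub>S\<^esub>),
     add = (\<lambda>p q m. p m \<oplus>\<^bsub>S\<^esub> q m), smult = (\<lambda>s p m. s \<otimes>\<^bsub>S\<^esub> p m)\<rparr>"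

text \<open>The divided power algebra of \<open>X\<close>: generated by symbols \<open>\<gamma>\<^sub>n(x)\<close>, encoded as the variables
  \<open>(n, x)\<close>, subject to Roby's relations.\<close>

definition dp_poly :: "('s, 'p) ring_scheme \<Rightarrow> ('s, 'a, 'q) module_scheme \<Rightarrow>
    ('s, (nat \<times> 'a) multiset \<Rightarrow> 's) module"
  where "dp_poly S X = poly_algebra S (UNIV \<times> carrier X)"

definition dp_relations :: "('s, 'p) ring_scheme \<Rightarrow> ('s, 'a, 'q) module_scheme \<Rightarrow>
    ((nat \<times> 'a) multiset \<Rightarrow> 's) set"
  where "dp_relations S X =
    (let P = dp_poly S X; g = (\<lambda>n x. basis_fun S {#(n, x)#}) in
      {g 0 x \<ominus>\<^bsub>P\<^esub> \<one>\<^bsub>P\<^esub> |x. x \<in> carrier X} \<union>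
      {g n (s \<odot>\<^bsub>X\<^esub> x) \<ominus>\<^bsub>P\<^esub> ((s [^]\<^bsub>S\<^esub> n) \<odot>\<^bsub>P\<^esub> g n x) |n s x. s \<in> carrier S \<and> x \<in> carrier X} \<union>
      {g n (x \<oplus>\<^bsub>X\<^esub> y) \<ominus>\<^bsub>P\<^esub> (finsum P (\<lambda>k. g k x \<otimes>\<^bsub>P\<^esub> g (n - k) y) {..n}) |n x y.
         x \<in> carrier X \<and> y \<in> carrier X} \<union>
      {(g k x \<otimes>\<^bsub>P\<^esub> g l x) \<ominus>\<^bsub>P\<^esub> ([((k + l) choose k)] \<cdot>\<^bsub>P\<^esub> (g (k + l) x)) |k l x. x \<in> carrier X})"

definition dp_ideal :: "('s, 'p) ring_scheme \<Rightarrow> ('s, 'a, 'q) module_scheme \<Rightarrow>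
    ((nat \<times> 'a) multiset \<Rightarrow> 's) set"
  where "dp_ideal S X = Idl\<^bsub>dp_poly S X\<^esub> (dp_relations S X)"

definition dp_algebra :: "('s, 'p) ring_scheme \<Rightarrow> ('s, 'a, 'q) module_scheme \<Rightarrow>
    ('s, ((nat \<times> 'a) multiset \<Rightarrow> 's) set) module"
  where "dp_algebra S X = quotient_module (dp_poly S X) (dp_ideal S X)"

definition dp_homogeneous :: "('s, 'p) ring_scheme \<Rightarrow> ('s, 'a, 'q) module_scheme \<Rightarrow> nat \<Rightarrow>
    ((nat \<times> 'a) multiset \<Rightarrow> 's) set"
  where "dp_homogeneous S X n =
    {p \<in> carrier (dp_poly S X). \<forall>m. p m \<noteq> \<zero>\<^bsub>S\<^esub> \<longrightarrow> sum_mset (image_mset fst m) = n}"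

text \<open>\<open>\<Gamma>\<^sup>n\<^sub>S(X)\<close> and \<open>\<gamma>\<^sub>n : X \<rightarrow> \<Gamma>\<^sup>n\<^sub>S(X)\<close>.\<close>

definition dp_component :: "('s, 'p) ring_scheme \<Rightarrow> ('s, 'a, 'q) module_scheme \<Rightarrow> nat \<Rightarrow>
    ('s, ((nat \<times> 'a) multiset \<Rightarrow> 's) set) module"
  where "dp_component S X n =
    (dp_algebra S X)\<lparr>carrier := {dp_ideal S X +>\<^bsub>dp_poly S X\<^esub> p |p. p \<in> dp_homogeneous S X n}\<rparr>"

definition dp_gamma :: "('s, 'p) ring_scheme \<Rightarrow> ('s, 'a, 'q) module_scheme \<Rightarrow> nat \<Rightarrow> 'a \<Rightarrow>
    ((nat \<times> 'a) multiset \<Rightarrow> 's) set"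
  where "dp_gamma S X n x = dp_ideal S X +>\<^bsub>dp_poly S X\<^esub> basis_fun S {#(n, x)#}"


section \<open>Square rings\<close>

text \<open>The ring fields of the record are those of \<open>R\<^sub>e\<close> (whose addition need not be commutative);
  \<open>sq_ee\<close> is \<open>R\<^sub>e\<^sub>e\<close>, of which only the additive group is used, and \<open>sq_act R r s x t\<close> is
  \<open>(r, s) \<cdot> x \<cdot> t\<close>.\<close>

record ('r, 'x) square_ring = "'r ring" +
  sq_ee :: "'x ring"
  sq_act :: "'r \<Rightarrow> 'r \<Rightarrow> 'x \<Rightarrow> 'r \<Rightarrow> 'x"
  sq_T :: "'x \<Rightarrow> 'x"
  sq_H :: "'r \<Rightarrow> 'x"
  sq_P :: "'x \<Rightarrow> 'r"

locale square_ring =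
  fixes R :: "('r, 'x, 'p) square_ring_scheme" (structure)
    and E :: "'x ring" and act T H P
  defines "E \<equiv> sq_ee R" and "act \<equiv> sq_act R" and "T \<equiv> sq_T R" and "H \<equiv> sq_H R" and "P \<equiv> sq_P R"
  assumes add_group: "group (add_monoid R)"
    and mult_monoid: "monoid R"
    and r_distr: "\<lbrakk>r \<in> carrier R; s \<in> carrier R; t \<in> carrier R\<rbrakk> \<Longrightarrow>
      r \<otimes> (s \<oplus> t) = r \<otimes> s \<oplus> r \<otimes> t"
    and ee_abelian_group: "abelian_group E"
    and act_closed: "\<lbrakk>r \<in> carrier R; s \<in> carrier R; x \<in> carrier E; t \<in> carrier R\<rbrakk> \<Longrightarrow>
      act r s x t \<in> carrier E"
    and act_add1: "\<lbrakk>r \<in> carrier R; r' \<in> carrier R; s \<in> carrier R; x \<in> carrier E; t \<in> carrier R\<rbrakk> \<Longrightarrow>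
      act (r \<oplus> r') s x t = act r s x t \<oplus>\<^bsub>E\<^esub> act r' s x t"
    and act_add2: "\<lbrakk>r \<in> carrier R; s \<in> carrier R; s' \<in> carrier R; x \<in> carrier E; t \<in> carrier R\<rbrakk> \<Longrightarrow>
      act r (s \<oplus> s') x t = act r s x t \<oplus>\<^bsub>E\<^esub> act r s' x t"
    and act_add3: "\<lbrakk>r \<in> carrier R; s \<in> carrier R; x \<in> carrier E; x' \<in> carrier E; t \<in> carrier R\<rbrakk> \<Longrightarrow>
      act r s (x \<oplus>\<^bsub>E\<^esub> x') t = act r s x t \<oplus>\<^bsub>E\<^esub> act r s x' t"
    and act_add4: "\<lbrakk>r \<in> carrier R; s \<in> carrier R; x \<in> carrier E; t \<in> carrier R; t' \<in> carrier R\<rbrakk> \<Longrightarrow>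
      act r s x (t \<oplus> t') = act r s x t \<oplus>\<^bsub>E\<^esub> act r s x t'"
    and act_one: "x \<in> carrier E \<Longrightarrow> act \<one> \<one> x \<one> = x"
    and act_act: "\<lbrakk>r \<in> carrier R; r' \<in> carrier R; s \<in> carrier R; s' \<in> carrier R; x \<in> carrier E;
        t \<in> carrier R; t' \<in> carrier R\<rbrakk> \<Longrightarrow>
      act r s (act r' s' x t) t' = act (r \<otimes> r') (s \<otimes> s') x (t \<otimes> t')"
    and T_hom: "T \<in> hom (add_monoid E) (add_monoid E)"
    and T_T: "x \<in> carrier E \<Longrightarrow> T (T x) = x"
    and H_closed: "r \<in> carrier R \<Longrightarrow> H r \<in> carrier E"
    and P_hom: "P \<in> hom (add_monoid E) (add_monoid R)"
    and P_H_P: "x \<in> carrier E \<Longrightarrow> P (H (P x)) = P x \<oplus> P x"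
    and P_act: "\<lbrakk>r \<in> carrier R; x \<in> carrier E; s \<in> carrier R\<rbrakk> \<Longrightarrow>
      P (act r r x s) = r \<otimes> P x \<otimes> s"
    and T_eq: "x \<in> carrier E \<Longrightarrow> T x = H (P x) \<ominus>\<^bsub>E\<^esub> x"
    and P_T: "x \<in> carrier E \<Longrightarrow> P (T x) = P x"
    and P_act_left: "\<lbrakk>x \<in> carrier E; r \<in> carrier R; y \<in> carrier E\<rbrakk> \<Longrightarrow>
      act (P x) r y \<one> = \<zero>\<^bsub>E\<^esub> \<and> act r (P x) y \<one> = \<zero>\<^bsub>E\<^esub>"
    and P_act_right: "\<lbrakk>x \<in> carrier E; y \<in> carrier E\<rbrakk> \<Longrightarrow> act \<one> \<one> y (P x) = \<zero>\<^bsub>E\<^esub>"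
    and H_add: "\<lbrakk>r \<in> carrier R; s \<in> carrier R\<rbrakk> \<Longrightarrow>
      H (r \<oplus> s) = H r \<oplus>\<^bsub>E\<^esub> H s \<oplus>\<^bsub>E\<^esub> act s r (H (\<one> \<oplus> \<one>)) \<one>"
    and H_mult: "\<lbrakk>r \<in> carrier R; s \<in> carrier R\<rbrakk> \<Longrightarrow>
      H (r \<otimes> s) = act r r (H s) \<one> \<oplus>\<^bsub>E\<^esub> act \<one> \<one> (H r) s"
    and l_quad_distr: "\<lbrakk>r \<in> carrier R; s \<in> carrier R; t \<in> carrier R\<rbrakk> \<Longrightarrow>
      (r \<oplus> s) \<otimes> t = r \<otimes> t \<oplus> s \<otimes> t \<oplus> P (act r s (H t) \<one>)"
    and T_act: "\<lbrakk>r \<in> carrier R; s \<in> carrier R; x \<in> carrier E; t \<in> carrier R\<rbrakk> \<Longrightarrow>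
      T (act r s x t) = act s r (T x) t"

definition sq_bar :: "('r, 'x, 'p) square_ring_scheme \<Rightarrow> 'r set ring"
  where "sq_bar R = R Quot (sq_P R ` carrier (sq_ee R))"

locale comm_square_ring = square_ring +
  assumes bar_comm: "\<lbrakk>\<rho> \<in> carrier (sq_bar R); \<sigma> \<in> carrier (sq_bar R)\<rbrakk> \<Longrightarrow>
      \<rho> \<otimes>\<^bsub>sq_bar R\<^esub> \<sigma> = \<sigma> \<otimes>\<^bsub>sq_bar R\<^esub> \<rho>"
    and act_eq: "\<lbrakk>r \<in> carrier R; x \<in> carrier E\<rbrakk> \<Longrightarrow>
      act r \<one> x \<one> = act \<one> r x \<one> \<and> act \<one> r x \<one> = act \<one> \<one> x r"


section \<open>Modules over square rings\<close>

text \<open>Only the additive part of the ring fields is used (as in \<^typ>\<open>('a, 'b) module\<close>);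
  \<open>ract M m r\<close> is \<open>m \<cdot> r\<close> and \<open>brk M m n x\<close> is \<open>[m, n] \<cdot> x\<close>.\<close>

record ('r, 'x, 'm) bhp_module = "'m ring" +
  ract :: "'m \<Rightarrow> 'r \<Rightarrow> 'm"
  brk :: "'m \<Rightarrow> 'm \<Rightarrow> 'x \<Rightarrow> 'm"

locale bhp_module = square_ring +
  fixes M :: "('b, 'c, 'm, 'n) bhp_module_scheme"
  assumes M_group: "group (add_monoid M)"
    and ract_closed: "\<lbrakk>m \<in> carrier M; r \<in> carrier R\<rbrakk> \<Longrightarrow> ract M m r \<in> carrier M"
    and brk_closed: "\<lbrakk>m \<in> carrier M; n \<in> carrier M; x \<in> carrier E\<rbrakk> \<Longrightarrow> brk M m n x \<in> carrier M"
    and ract_one: "m \<in> carrier M \<Longrightarrow> ract M m \<one> = m"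
    and ract_ract: "\<lbrakk>m \<in> carrier M; r \<in> carrier R; s \<in> carrier R\<rbrakk> \<Longrightarrow>
      ract M (ract M m r) s = ract M m (r \<otimes> s)"
    and ract_add: "\<lbrakk>m \<in> carrier M; r \<in> carrier R; s \<in> carrier R\<rbrakk> \<Longrightarrow>
      ract M m (r \<oplus> s) = ract M m r \<oplus>\<^bsub>M\<^esub> ract M m s"
    and add_ract: "\<lbrakk>m \<in> carrier M; n \<in> carrier M; r \<in> carrier R\<rbrakk> \<Longrightarrow>
      ract M (m \<oplus>\<^bsub>M\<^esub> n) r = ract M m r \<oplus>\<^bsub>M\<^esub> ract M n r \<oplus>\<^bsub>M\<^esub> brk M m n (H r)"
    and ract_P: "\<lbrakk>m \<in> carrier M; x \<in> carrier E\<rbrakk> \<Longrightarrow> ract M m (P x) = brk M m m x"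
    and brk_T: "\<lbrakk>m \<in> carrier M; n \<in> carrier M; x \<in> carrier E\<rbrakk> \<Longrightarrow> brk M m n (T x) = brk M n m x"
    and brk_add1: "\<lbrakk>m \<in> carrier M; m' \<in> carrier M; n \<in> carrier M; x \<in> carrier E\<rbrakk> \<Longrightarrow>
      brk M (m \<oplus>\<^bsub>M\<^esub> m') n x = brk M m n x \<oplus>\<^bsub>M\<^esub> brk M m' n x"
    and brk_add2: "\<lbrakk>m \<in> carrier M; n \<in> carrier M; n' \<in> carrier M; x \<in> carrier E\<rbrakk> \<Longrightarrow>
      brk M m (n \<oplus>\<^bsub>M\<^esub> n') x = brk M m n x \<oplus>\<^bsub>M\<^esub> brk M m n' x"
    and brk_add3: "\<lbrakk>m \<in> carrier M; n \<in> carrier M; x \<in> carrier E; x' \<in> carrier E\<rbrakk> \<Longrightarrow>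
      brk M m n (x \<oplus>\<^bsub>E\<^esub> x') = brk M m n x \<oplus>\<^bsub>M\<^esub> brk M m n x'"
    and brk_act: "\<lbrakk>m \<in> carrier M; n \<in> carrier M; r \<in> carrier R; s \<in> carrier R; x \<in> carrier E;
        t \<in> carrier R\<rbrakk> \<Longrightarrow>
      ract M (brk M (ract M m r) (ract M n s) x) t = brk M m n (act r s x t)"
    and brk_brk: "\<lbrakk>m \<in> carrier M; m' \<in> carrier M; n \<in> carrier M; x \<in> carrier E; y \<in> carrier E\<rbrakk> \<Longrightarrow>
      brk M (brk M m m' x) n y = \<zero>\<^bsub>M\<^esub>"

locale cp_module = bhp_module +
  fixes A
  assumes A_subgroup: "subgroup A (add_monoid M)"
    and A_ract: "\<lbrakk>a \<in> A; r \<in> carrier R\<rbrakk> \<Longrightarrow> ract M a r \<in> A"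
    and brk_A: "\<lbrakk>a \<in> A; n \<in> carrier M; x \<in> carrier E\<rbrakk> \<Longrightarrow> brk M a n x = \<zero>\<^bsub>M\<^esub>"
    and brk_in_A: "\<lbrakk>m \<in> carrier M; n \<in> carrier M; x \<in> carrier E\<rbrakk> \<Longrightarrow> brk M m n x \<in> A"

text \<open>\<open>M/A\<close> and \<open>A\<close> as modules over \<open>sq_bar R\<close>; the class of \<open>m\<close> in \<open>M/A\<close> is \<open>A +>\<^bsub>M\<^esub> m\<close>.\<close>

definition cp_quotient :: "('r, 'x, 'm, 'n) bhp_module_scheme \<Rightarrow> 'm set \<Rightarrow> ('r set, 'm set) module"
  where "cp_quotient M A =
    \<lparr>carrier = carrier (M Quot A), mult = mult (M Quot A), one = one (M Quot A),
     zero = zero (M Quot A), add = add (M Quot A),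
     smult = (\<lambda>\<rho> C. \<Union>r \<in> \<rho>. \<Union>m \<in> C. A +>\<^bsub>M\<^esub> ract M m r)\<rparr>"

definition cp_sub :: "('r, 'x, 'm, 'n) bhp_module_scheme \<Rightarrow> 'm set \<Rightarrow> ('r set, 'm) module"
  where "cp_sub M A =
    \<lparr>carrier = A, mult = mult M, one = one M, zero = zero M, add = add M,
     smult = (\<lambda>\<rho> a. the_elem (ract M a ` \<rho>))\<rparr>"


section \<open>Linear, bilinear and quadratic maps\<close>

definition sq_linear :: "('r, 'x, 'p) square_ring_scheme \<Rightarrow> ('r, 'x, 'm, 'q) bhp_module_scheme \<Rightarrow>
    ('r, 'x, 'n, 'u) bhp_module_scheme \<Rightarrow> ('m \<Rightarrow> 'n) \<Rightarrow> bool"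
  where "sq_linear R M N h \<longleftrightarrow>
    h \<in> hom (add_monoid M) (add_monoid N) \<and>
    (\<forall>m \<in> carrier M. \<forall>r \<in> carrier R. h (ract M m r) = ract N (h m) r) \<and>
    (\<forall>m \<in> carrier M. \<forall>m' \<in> carrier M. \<forall>x \<in> carrier (sq_ee R).
       h (brk M m m' x) = brk N (h m) (h m') x)"

definition sq_bilinear :: "('r, 'x, 'p) square_ring_scheme \<Rightarrow> ('r, 'x, 'm, 'q) bhp_module_scheme \<Rightarrow>
    ('r, 'x, 'n, 'u) bhp_module_scheme \<Rightarrow> ('m \<Rightarrow> 'm \<Rightarrow> 'n) \<Rightarrow> bool"
  where "sq_bilinear R M N b \<longleftrightarrow>
    (\<forall>m' \<in> carrier M. sq_linear R M N (\<lambda>m. b m m')) \<and>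
    (\<forall>m \<in> carrier M. sq_linear R M N (\<lambda>m'. b m m'))"

definition sq_span :: "('r, 'x, 'p) square_ring_scheme \<Rightarrow> ('r, 'x, 'n, 'u) bhp_module_scheme \<Rightarrow>
    'n set \<Rightarrow> 'n set"
  where "sq_span R N G = \<Inter> {K. subgroup K (add_monoid N) \<and> G \<subseteq> K \<and>
      (\<forall>k \<in> K. \<forall>r \<in> carrier R. ract N k r \<in> K) \<and>
      (\<forall>k \<in> K. \<forall>l \<in> K. \<forall>x \<in> carrier (sq_ee R). brk N k l x \<in> K)}"

definition dev_add :: "('r, 'x, 'm, 'q) bhp_module_scheme \<Rightarrow> ('r, 'x, 'n, 'u) bhp_module_scheme \<Rightarrow>
    ('m \<Rightarrow> 'n) \<Rightarrow> 'm \<Rightarrow> 'm \<Rightarrow> 'n"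
  where "dev_add M N f m m' = f (m \<oplus>\<^bsub>M\<^esub> m') \<ominus>\<^bsub>N\<^esub> f m' \<ominus>\<^bsub>N\<^esub> f m"

definition dev_ract :: "('r, 'x, 'm, 'q) bhp_module_scheme \<Rightarrow> ('r, 'x, 'n, 'u) bhp_module_scheme \<Rightarrow>
    ('m \<Rightarrow> 'n) \<Rightarrow> 'r \<Rightarrow> 'm \<Rightarrow> 'n"
  where "dev_ract M N f r m = f (ract M m r) \<ominus>\<^bsub>N\<^esub> ract N (f m) r"

definition dev_brk :: "('r, 'x, 'm, 'q) bhp_module_scheme \<Rightarrow> ('r, 'x, 'n, 'u) bhp_module_scheme \<Rightarrow>
    ('m \<Rightarrow> 'n) \<Rightarrow> 'x \<Rightarrow> 'm \<Rightarrow> 'm \<Rightarrow> 'n"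
  where "dev_brk M N f x m m' = f (brk M m m' x) \<ominus>\<^bsub>N\<^esub> brk N (f m) (f m') x"

definition cp_quadratic :: "('r, 'x, 'p) square_ring_scheme \<Rightarrow>
    ('r, 'x, 'm, 'q) bhp_module_scheme \<Rightarrow> 'm set \<Rightarrow>
    ('r, 'x, 'n, 'u) bhp_module_scheme \<Rightarrow> 'n set \<Rightarrow> ('m \<Rightarrow> 'n) \<Rightarrow> bool"
  where "cp_quadratic R M A N B f \<longleftrightarrow>
    f \<in> carrier M \<rightarrow> carrier N \<and>
    f ` A \<subseteq> B \<and>
    sq_span R N {dev_add M N f m m' |m m'. m \<in> carrier M \<and> m' \<in> carrier M} \<subseteq> B \<and>
    (\<forall>r \<in> carrier R. sq_span R N (dev_ract M N f r ` carrier M) \<subseteq> B) \<and>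
    (\<forall>x \<in> carrier (sq_ee R).
       sq_span R N {dev_brk M N f x m m' |m m'. m \<in> carrier M \<and> m' \<in> carrier M} \<subseteq> B) \<and>
    sq_bilinear R M N (dev_add M N f) \<and>
    (\<forall>x \<in> carrier (sq_ee R). sq_bilinear R M N (dev_brk M N f x)) \<and>
    (\<forall>m \<in> carrier M. \<forall>r \<in> carrier R. \<forall>s \<in> carrier R.
       dev_ract M N f r (ract M m s) = ract N (dev_ract M N f r m) (s [^]\<^bsub>R\<^esub> (2::nat))) \<and>
    (\<forall>m \<in> carrier M. \<forall>a \<in> A. dev_add M N f m a = \<zero>\<^bsub>N\<^esub> \<and> dev_add M N f a m = \<zero>\<^bsub>N\<^esub>) \<and>
    (\<forall>r \<in> carrier R. \<forall>a \<in> A. dev_ract M N f r a = \<zero>\<^bsub>N\<^esub>) \<and>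
    (\<forall>x \<in> carrier (sq_ee R). \<forall>m \<in> carrier M. \<forall>a \<in> A.
       dev_brk M N f x m a = \<zero>\<^bsub>N\<^esub> \<and> dev_brk M N f x a m = \<zero>\<^bsub>N\<^esub>)"

end

theory Submission
  imports Defs
begin

text \<open>Computing \<open>(x + y) \<cdot> 2\<close> in two ways shows that \<open>Im P\<close> and \<open>A\<close> are central and contain all
  commutators, which makes the quotients modules. For a quadratic \<open>f\<close>, the deviation
  \<open>f(m \<cdot> r) - f(m) \<cdot> r\<close> has the cross effect \<open>d\<^sub>f \<cdot> r\<^sup>2 - d\<^sub>f \<cdot> r + f\<^sub>[\<^sub>x\<^sub>]\<close> with \<open>x = H(r)\<close>, hence it is a quadratic map on
  \<open>M/A\<close> and factors through \<open>\<Gamma>\<^sup>2\<close>. Conversely, given the factorizations, bilinearity of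
  \<open>f\<^sub>[\<^sub>x\<^sub>]\<close> follows because \<open>f\<close> restricted to \<open>A\<close>, where all brackets lie, is linear.

  The universal property of \<open>\<Gamma>\<^sup>2\<close> is obtained by extending a quadratic map to a linear form on
  polynomials in the symbols \<open>\<gamma>\<^sub>n(x)\<close>; the polynomials all of whose multiples are killed by this
  form make up an ideal, and it contains Roby's relations.\<close>

section \<open>Quotients and presentations of modules\<close>

text \<open>Addition need not commute in \<open>R\<close>, \<open>M\<close> or \<open>N\<close>, so
  sums of deviations cannot be sorted freely. The computations work because every correction term is
  a bracket, a value of \<open>P\<close> or a deviation: these lie in \<open>A\<close>,
  \<open>B\<close> or Im P, and brackets vanish on \<open>A\<close> and \<open>B\<close>. Each
  identity thus splits into a part in \<open>B\<close>, which may be sorted, and a remainder that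
  keeps its order. The term with H(r) in the cross effect comes from (m + n) r = m r + n r + [m, n]
  H(r), the factor r^2 from d_f at the pair (m r, n r). For the converse, d_f and f_(r) depend only
  on classes modulo \<open>A\<close> and vanish at the class of zero, which is why \<open>f\<close>
  is linear on \<open>A\<close>. Roby's relations generate an ideal and not merely a submodule, so a
  linear form has to be tested on each relation times each monomial. Hence values are prescribed for
  all multisets of symbols, not only for the symbols \<gamma>_2(x); they are zero outside weight 2,
  where the relations then hold trivially.\<close>

lemma mod_homI:
  assumes "\<And>x. x \<in> carrier X \<Longrightarrow> h x \<in> carrier Y"
    and "\<And>x y. \<lbrakk>x \<in> carrier X; y \<in> carrier X\<rbrakk> \<Longrightarrow> h (x \<oplus>\<^bsub>X\<^esub> y) = h x \<oplus>\<^bsub>Y\<^esub> h y"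
    and "\<And>s x. \<lbrakk>s \<in> carrier S; x \<in> carrier X\<rbrakk> \<Longrightarrow> h (s \<odot>\<^bsub>X\<^esub> x) = s \<odot>\<^bsub>Y\<^esub> h x"
  shows "h \<in> mod_hom S X Y"
  using assms by (auto simp: mod_hom_def hom_def)

lemma mod_homD:
  assumes "h \<in> mod_hom S X Y"
  shows "x \<in> carrier X \<Longrightarrow> h x \<in> carrier Y"
    and "\<lbrakk>x \<in> carrier X; y \<in> carrier X\<rbrakk> \<Longrightarrow> h (x \<oplus>\<^bsub>X\<^esub> y) = h x \<oplus>\<^bsub>Y\<^esub> h y"
    and "\<lbrakk>s \<in> carrier S; x \<in> carrier X\<rbrakk> \<Longrightarrow> h (s \<odot>\<^bsub>X\<^esub> x) = s \<odot>\<^bsub>Y\<^esub> h x"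
  using assms by (auto simp: mod_hom_def hom_def)

lemma mod_hom_group_hom:
  assumes "h \<in> mod_hom S X Y" "module S X" "module S Y"
  shows "abelian_group_hom X Y h"
proof -
  interpret X: module S X by fact
  interpret Y: module S Y by fact
  show ?thesis
    using mod_homD[OF assms(1)]
    by (intro abelian_group_homI X.abelian_group_axioms Y.abelian_group_axioms group_hom.intro
        group_hom_axioms.intro X.add.is_group Y.add.is_group) (auto simp: hom_def)
qed

lemma mod_hom_zero:
  assumes "h \<in> mod_hom S X Y" "module S X" "module S Y"
  shows "h \<zero>\<^bsub>X\<^esub> = \<zero>\<^bsub>Y\<^esub>"
  using abelian_group_hom.hom_zero[OF mod_hom_group_hom[OF assms]] .

lemma mod_hom_minus:
  assumes "h \<in> mod_hom S X Y" "module S X" "module S Y" "x \<in> carrier X" "y \<in> carrier X"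
  shows "h (x \<ominus>\<^bsub>X\<^esub> y) = h x \<ominus>\<^bsub>Y\<^esub> h y"
proof -
  interpret abelian_group_hom X Y h using mod_hom_group_hom[OF assms(1-3)] .
  show ?thesis using assms(4,5) by (simp add: a_minus_def)
qed

lemma mod_hom_finsum:
  assumes h: "h \<in> mod_hom S X Y" and "module S X" "module S Y" "f \<in> A \<rightarrow> carrier X"
  shows "h (finsum X f A) = finsum Y (\<lambda>i. h (f i)) A"
proof -
  interpret X: module S X by fact
  interpret Y: module S Y by fact
  note h0 = mod_hom_zero[OF assms(1-3)]
  show ?thesis using assms(4)
  proof (induction A rule: infinite_finite_induct)
    case (insert a A)
    then have f: "f \<in> A \<rightarrow> carrier X" "f a \<in> carrier X" by auto
    then have "(\<lambda>i. h (f i)) \<in> A \<rightarrow> carrier Y" by (auto intro: mod_homD(1)[OF h])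
    with insert f show ?case
      by (simp add: X.finsum_insert Y.finsum_insert X.finsum_closed mod_homD[OF h])
  qed (simp_all add: h0)
qed

lemma (in abelian_group) minus_self: "x \<in> carrier G \<Longrightarrow> x \<ominus> x = \<zero>"
  by (simp add: a_minus_def r_neg)

lemma (in module) submodule_abelian_subgroup:
  assumes "submodule K R M"
  shows "abelian_subgroup K M"
  using assms by (intro abelian_subgroupI3 additive_subgroupI submodule.axioms M.abelian_group_axioms)

lemma (in module) submodule_coset_eq:
  assumes K: "submodule K R M" and "x \<in> carrier M" "y \<in> carrier M" "x \<ominus>\<^bsub>M\<^esub> y \<in> K"
  shows "K +>\<^bsub>M\<^esub> x = K +>\<^bsub>M\<^esub> y"
proof -
  interpret K: abelian_subgroup K M using submodule_abelian_subgroup[OF K] .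
  have "x \<in> K +>\<^bsub>M\<^esub> y"
    using assms K.a_rcos_module_rev[of y x] by (simp add: a_minus_def)
  then show ?thesis using K.a_repr_independence'[of x y] assms(3) by simp
qed

lemma (in module) quotient_module_add:
  assumes K: "submodule K R M" and "x \<in> carrier M" "y \<in> carrier M"
  shows "(K +>\<^bsub>M\<^esub> x) \<oplus>\<^bsub>quotient_module M K\<^esub> (K +>\<^bsub>M\<^esub> y) = K +>\<^bsub>M\<^esub> (x \<oplus>\<^bsub>M\<^esub> y)"
proof -
  interpret K: abelian_subgroup K M using submodule_abelian_subgroup[OF K] .
  show ?thesis using assms by (simp add: quotient_module_def FactRing_def K.a_rcos_sum)
qed

lemma (in module) quotient_module_smult:
  assumes K: "submodule K R M" and s: "s \<in> carrier R" and x: "x \<in> carrier M"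
  shows "s \<odot>\<^bsub>quotient_module M K\<^esub> (K +>\<^bsub>M\<^esub> x) = K +>\<^bsub>M\<^esub> (s \<odot>\<^bsub>M\<^esub> x)"
proof -
  interpret K: abelian_subgroup K M using submodule_abelian_subgroup[OF K] .
  \<comment> \<open>The scalar action unites cosets over all members \<open>c\<close> of the class.
    The union is a single coset because two such multiples differ by \<open>s\<close> times an
    element of \<open>K\<close>.\<close>
  have "K +>\<^bsub>M\<^esub> (s \<odot>\<^bsub>M\<^esub> c) = K +>\<^bsub>M\<^esub> (s \<odot>\<^bsub>M\<^esub> x)" if "c \<in> K +>\<^bsub>M\<^esub> x" for c
  proof -
    obtain k where k: "k \<in> K" "c = k \<oplus>\<^bsub>M\<^esub> x" using \<open>c \<in> K +>\<^bsub>M\<^esub> x\<close> by (auto simp: a_r_coset_def')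
    have kc: "k \<in> carrier M" using k by simp
    have "s \<odot>\<^bsub>M\<^esub> c \<ominus>\<^bsub>M\<^esub> s \<odot>\<^bsub>M\<^esub> x = s \<odot>\<^bsub>M\<^esub> k"
      using k kc s x by (simp add: smult_r_distr a_minus_def a_assoc M.r_neg)
    also have "\<dots> \<in> K" using submodule.smult_closed[OF K s k(1)] .
    finally show ?thesis using k kc s x by (intro submodule_coset_eq[OF K]) auto
  qed
  then have "(\<Union>c \<in> K +>\<^bsub>M\<^esub> x. K +>\<^bsub>M\<^esub> (s \<odot>\<^bsub>M\<^esub> c)) = K +>\<^bsub>M\<^esub> (s \<odot>\<^bsub>M\<^esub> x)"
    using K.a_rcos_self[OF x] by (intro SUP_eq_const) blast+
  then show ?thesis by (simp add: quotient_module_def)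
qed

lemma quotient_module_carrier:
  "carrier (quotient_module X K) = {K +>\<^bsub>X\<^esub> x | x. x \<in> carrier X}"
  by (auto simp: quotient_module_def FactRing_def A_RCOSETS_def')

lemma quotient_module_lift:
  assumes "module S X" "module S Y" "submodule K S X" "\<phi> \<in> mod_hom S X Y"
    and ker: "\<And>k. k \<in> K \<Longrightarrow> \<phi> k = \<zero>\<^bsub>Y\<^esub>"
  obtains h where "h \<in> mod_hom S (quotient_module X K) Y"
    and "\<And>x. x \<in> carrier X \<Longrightarrow> h (K +>\<^bsub>X\<^esub> x) = \<phi> x"
proof
  interpret X: module S X by fact
  interpret Y: module S Y by fact
  interpret K: abelian_subgroup K X using X.submodule_abelian_subgroup[OF assms(3)] .
  note phi = mod_homD[OF assms(4)]
  \<comment> \<open>As \<open>\<phi>\<close> kills \<open>K\<close>, its image of a coset is a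
    singleton; \<open>the_elem\<close> then defines the induced map without choosing
    representatives.\<close>
  have "\<phi> c = \<phi> x" if "c \<in> K +>\<^bsub>X\<^esub> x" "x \<in> carrier X" for c x
    using that ker phi by (auto simp: a_r_coset_def')
  then have "\<phi> ` (K +>\<^bsub>X\<^esub> x) = {\<phi> x}" if "x \<in> carrier X" for x
    using that K.a_rcos_self[OF that] by blast
  then show *: "the_elem (\<phi> ` (K +>\<^bsub>X\<^esub> x)) = \<phi> x" if "x \<in> carrier X" for x
    using that by simp
  show "(\<lambda>C. the_elem (\<phi> ` C)) \<in> mod_hom S (quotient_module X K) Y"
    by (rule mod_homI) (auto simp: quotient_module_carrier * phi X.quotient_module_add[OF assms(3)]
        X.quotient_module_smult[OF assms(3)])
qed

lemma subset_module_span: "G \<subseteq> module_span S X G"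
  by (auto simp: module_span_def)

lemma module_span_minimal: "\<lbrakk>submodule K S X; G \<subseteq> K\<rbrakk> \<Longrightarrow> module_span S X G \<subseteq> K"
  by (auto simp: module_span_def)

lemma (in module) module_span_submodule:
  assumes "G \<subseteq> carrier M"
  shows "submodule (module_span R M G) R M"
proof (rule submoduleI)
  show "module_span R M G \<subseteq> carrier M"
    using assms carrier_is_submodule by (rule module_span_minimal[rotated])
  have "K \<in> {K. submodule K R M \<and> G \<subseteq> K} \<Longrightarrow> \<zero>\<^bsub>M\<^esub> \<in> K" for K
    using subgroup.one_closed[OF submodule.axioms(1)] by fastforce
  then show "\<zero>\<^bsub>M\<^esub> \<in> module_span R M G" unfolding module_span_def by blast
  show "\<ominus>\<^bsub>M\<^esub> a \<in> module_span R M G" if "a \<in> module_span R M G" for a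
    using that submoduleE(3) unfolding module_span_def by blast
  show "a \<oplus>\<^bsub>M\<^esub> b \<in> module_span R M G"
    if "a \<in> module_span R M G" "b \<in> module_span R M G" for a b
    using that submoduleE(5) unfolding module_span_def by blast
  show "a \<odot>\<^bsub>M\<^esub> x \<in> module_span R M G"
    if "a \<in> carrier R" "x \<in> module_span R M G" for a x
    using that submoduleE(4) unfolding module_span_def by blast
qed

lemma mod_hom_kernel_submodule:
  assumes "module S X" "module S Y" "h \<in> mod_hom S X Y"
  shows "submodule {x \<in> carrier X. h x = \<zero>\<^bsub>Y\<^esub>} S X"
proof -
  interpret X: module S X by fact
  interpret Y: module S Y by fact
  interpret abelian_group_hom X Y h using mod_hom_group_hom[OF assms(3,1,2)] .
  show ?thesis by (rule X.submoduleI) (auto simp: mod_homD[OF assms(3)])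
qed

section \<open>Free modules\<close>

lemma free_module_simps:
  "carrier (free_module S I) = fin_supp_fun S I"
  "p \<oplus>\<^bsub>free_module S I\<^esub> q = (\<lambda>i. p i \<oplus>\<^bsub>S\<^esub> q i)"
  "\<zero>\<^bsub>free_module S I\<^esub> = (\<lambda>_. \<zero>\<^bsub>S\<^esub>)"
  "s \<odot>\<^bsub>free_module S I\<^esub> p = (\<lambda>i. s \<otimes>\<^bsub>S\<^esub> p i)"
  by (simp_all add: free_module_def)

context cring
begin

lemma fin_supp_fun_closed: "p \<in> fin_supp_fun R I \<Longrightarrow> p i \<in> carrier R"
  by (cases "i \<in> I") (auto simp: fin_supp_fun_def)

lemma fin_supp_fun_subset: "p \<in> fin_supp_fun R I \<Longrightarrow> {i. p i \<noteq> \<zero>} \<subseteq> I"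
  by (auto simp: fin_supp_fun_def)

lemma fin_supp_fun_add:
  assumes "p \<in> fin_supp_fun R I" "q \<in> fin_supp_fun R I"
  shows "(\<lambda>i. p i \<oplus> q i) \<in> fin_supp_fun R I"
proof -
  have "{i. p i \<oplus> q i \<noteq> \<zero>} \<subseteq> {i. p i \<noteq> \<zero>} \<union> {i. q i \<noteq> \<zero>}" by auto
  then show ?thesis using assms by (auto simp: fin_supp_fun_def dest: finite_subset)
qed

lemma fin_supp_fun_smult:
  assumes "s \<in> carrier R" "p \<in> fin_supp_fun R I"
  shows "(\<lambda>i. s \<otimes> p i) \<in> fin_supp_fun R I"
proof -
  have "{i. s \<otimes> p i \<noteq> \<zero>} \<subseteq> {i. p i \<noteq> \<zero>}" using assms by auto
  then show ?thesis using assms by (auto simp: fin_supp_fun_def dest: finite_subset)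
qed

lemma fin_supp_fun_zero: "(\<lambda>_. \<zero>) \<in> fin_supp_fun R I"
  by (simp add: fin_supp_fun_def)

lemma basis_fun_closed: "i \<in> I \<Longrightarrow> basis_fun R i \<in> fin_supp_fun R I"
  by (auto simp: fin_supp_fun_def basis_fun_def)

lemma free_module_is_module: "module R (free_module R I)"
proof -
  have c: "p i \<in> carrier R" if "p \<in> fin_supp_fun R I" for p i
    using that by (rule fin_supp_fun_closed)
  have neg: "\<exists>q \<in> fin_supp_fun R I. (\<lambda>i. q i \<oplus> p i) = (\<lambda>_. \<zero>)" if "p \<in> fin_supp_fun R I" for p
  proof
    show "(\<lambda>i. (\<ominus> \<one>) \<otimes> p i) \<in> fin_supp_fun R I" using that by (intro fin_supp_fun_smult) simp_all
    show "(\<lambda>i. (\<ominus> \<one>) \<otimes> p i \<oplus> p i) = (\<lambda>_. \<zero>)" using c[OF that] by (simp add: l_minus l_neg)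
  qed
  have "abelian_group (free_module R I)"
  proof (rule abelian_groupI, unfold free_module_simps)
    fix p q assume p: "p \<in> fin_supp_fun R I" and q: "q \<in> fin_supp_fun R I"
    show "(\<lambda>i. p i \<oplus> q i) \<in> fin_supp_fun R I" using p q by (rule fin_supp_fun_add)
    show "(\<lambda>i. p i \<oplus> q i) = (\<lambda>i. q i \<oplus> p i)" using c[OF p] c[OF q] by (simp add: a_comm[of "p _"])
    fix r assume r: "r \<in> fin_supp_fun R I"
    show "(\<lambda>i. p i \<oplus> q i \<oplus> r i) = (\<lambda>i. p i \<oplus> (q i \<oplus> r i))"
      using c[OF p] c[OF q] c[OF r] by (simp add: a_assoc)
  next
    fix p assume p: "p \<in> fin_supp_fun R I"
    show "(\<lambda>i. \<zero> \<oplus> p i) = p" using c[OF p] by simp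
  qed (simp_all add: fin_supp_fun_zero neg)
  then show ?thesis
  proof (rule moduleI[OF cring_axioms], unfold free_module_simps)
    fix s p assume s: "s \<in> carrier R" and p: "p \<in> fin_supp_fun R I"
    show "(\<lambda>i. s \<otimes> p i) \<in> fin_supp_fun R I" using s p by (rule fin_supp_fun_smult)
    show "(\<lambda>i. (s \<oplus> t) \<otimes> p i) = (\<lambda>i. s \<otimes> p i \<oplus> t \<otimes> p i)" if "t \<in> carrier R" for t
      using s that c[OF p] by (simp add: l_distr)
    show "(\<lambda>i. s \<otimes> t \<otimes> p i) = (\<lambda>i. s \<otimes> (t \<otimes> p i))" if "t \<in> carrier R" for t
      using s that c[OF p] by (simp add: m_assoc)
    show "(\<lambda>i. s \<otimes> (p i \<oplus> q i)) = (\<lambda>i. s \<otimes> p i \<oplus> s \<otimes> q i)" if "q \<in> fin_supp_fun R I" for q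
      using s c[OF p] c[OF that] by (simp add: r_distr)
  next
    fix p assume p: "p \<in> fin_supp_fun R I"
    show "(\<lambda>i. \<one> \<otimes> p i) = p" using c[OF p] by simp
  qed
qed

text \<open>The induction runs over a finite set containing the support, not over the support
  itself: splitting off the coefficient at \<open>k\<close> leaves a function supported in the
  smaller set.\<close>

lemma fin_supp_fun_induct [consumes 1, case_names zero add smult_basis]:
  assumes "p \<in> fin_supp_fun R I"
    and zero: "Q (\<lambda>_. \<zero>)"
    and add: "\<And>p q. \<lbrakk>p \<in> fin_supp_fun R I; q \<in> fin_supp_fun R I; Q p; Q q\<rbrakk> \<Longrightarrow> Q (\<lambda>i. p i \<oplus> q i)"
    and smult_basis: "\<And>s i. \<lbrakk>s \<in> carrier R; i \<in> I\<rbrakk> \<Longrightarrow> Q (\<lambda>j. s \<otimes> basis_fun R i j)"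
  shows "Q p"
proof -
  have "Q p" if "finite F" "p \<in> fin_supp_fun R I" "{i. p i \<noteq> \<zero>} \<subseteq> F" for F p
    using that
  proof (induction F arbitrary: p)
    case empty
    then have "p = (\<lambda>_. \<zero>)" by auto
    then show ?case using zero by simp
  next
    case (insert k F)
    show ?case
    proof (cases "p k = \<zero>")
      case True
      then have "{i. p i \<noteq> \<zero>} \<subseteq> F" using insert.prems(2) by auto
      with insert.prems(1) show ?thesis by (rule insert.IH)
    next
      case False
      then have k: "k \<in> I" using insert.prems(1) by (auto simp: fin_supp_fun_def)
      define r where "r = p(k := \<zero>)"
      have supp: "{i. r i \<noteq> \<zero>} \<subseteq> {i. p i \<noteq> \<zero>}" by (auto simp: r_def)
      then have r: "r \<in> fin_supp_fun R I"
        using insert.prems(1) k finite_subset[OF supp] by (auto simp: fin_supp_fun_def r_def)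
      have "{i. r i \<noteq> \<zero>} \<subseteq> F" using insert.prems(2) by (auto simp: r_def)
      with r have "Q r" by (rule insert.IH)
      have pk: "p k \<in> carrier R" using fin_supp_fun_closed[OF insert.prems(1)] .
      have "p i = r i \<oplus> p k \<otimes> basis_fun R k i" for i
        using pk fin_supp_fun_closed[OF insert.prems(1), of i] by (simp add: r_def basis_fun_def)
      then have p: "(\<lambda>i. r i \<oplus> p k \<otimes> basis_fun R k i) = p" by (intro ext) (rule sym)
      have "Q (\<lambda>i. r i \<oplus> p k \<otimes> basis_fun R k i)"
        by (rule add[OF r fin_supp_fun_smult[OF pk basis_fun_closed[OF k]] \<open>Q r\<close> smult_basis[OF pk k]])
      then show ?thesis unfolding p .
    qed
  qed
  moreover have "finite {i. p i \<noteq> \<zero>}" using assms(1) by (simp add: fin_supp_fun_def)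
  ultimately show ?thesis using assms(1) subset_refl by this
qed

end

text \<open>Summing over the support keeps the sum finite; over an infinite index set
  \<open>finsum\<close> would return its default zero.\<close>

definition free_lift where
  "free_lift S Y g p = finsum Y (\<lambda>i. p i \<odot>\<^bsub>Y\<^esub> g i) {i. p i \<noteq> \<zero>\<^bsub>S\<^esub>}"

text \<open>Cancellation can shrink the support of a sum or of a multiple, so linearity of the lift
  is proved by summing over a common finite set.\<close>

lemma (in module) free_lift_superset:
  assumes p: "p \<in> fin_supp_fun R I" and g: "g \<in> I \<rightarrow> carrier M"
    and "finite F" "{i. p i \<noteq> \<zero>} \<subseteq> F" "F \<subseteq> I"
  shows "free_lift R M g p = finsum M (\<lambda>i. p i \<odot>\<^bsub>M\<^esub> g i) F"
  unfolding free_lift_def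
proof (rule M.add.finprod_mono_neutral_cong_left)
  show "(\<lambda>i. p i \<odot>\<^bsub>M\<^esub> g i) \<in> F \<rightarrow> carrier M"
    using assms by (auto simp: Pi_def R.fin_supp_fun_closed[OF p])
next
  fix i assume "i \<in> F - {i. p i \<noteq> \<zero>}"
  then show "p i \<odot>\<^bsub>M\<^esub> g i = \<zero>\<^bsub>M\<^esub>" using assms by (auto simp: Pi_def)
qed (use assms in auto)

lemma (in module) free_lift_hom:
  assumes g: "g \<in> I \<rightarrow> carrier M"
  shows "free_lift R M g \<in> mod_hom R (free_module R I) M"
proof (rule mod_homI)
  have c: "(\<lambda>i. p i \<odot>\<^bsub>M\<^esub> g i) \<in> F \<rightarrow> carrier M" if "p \<in> fin_supp_fun R I" "F \<subseteq> I" for p F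
    using that g by (auto simp: Pi_def R.fin_supp_fun_closed)
  show "free_lift R M g p \<in> carrier M" if "p \<in> carrier (free_module R I)" for p
    using that c R.fin_supp_fun_subset unfolding free_lift_def free_module_simps
    by (intro M.finsum_closed) blast
  show "free_lift R M g (p \<oplus>\<^bsub>free_module R I\<^esub> q) = free_lift R M g p \<oplus>\<^bsub>M\<^esub> free_lift R M g q"
    if "p \<in> carrier (free_module R I)" "q \<in> carrier (free_module R I)" for p q
  proof -
    from that have p: "p \<in> fin_supp_fun R I" and q: "q \<in> fin_supp_fun R I"
      by (simp_all add: free_module_simps)
    let ?F = "{i. p i \<noteq> \<zero>} \<union> {i. q i \<noteq> \<zero>}"
    have F: "finite ?F" "?F \<subseteq> I" using p q by (auto simp: fin_supp_fun_def)
    have pq: "(\<lambda>i. p i \<oplus> q i) \<in> fin_supp_fun R I" using p q by (rule R.fin_supp_fun_add)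
    have "free_lift R M g (\<lambda>i. p i \<oplus> q i) = finsum M (\<lambda>i. (p i \<oplus> q i) \<odot>\<^bsub>M\<^esub> g i) ?F"
      by (rule free_lift_superset[OF pq g F(1) _ F(2)]) auto
    also have "\<dots> = finsum M (\<lambda>i. p i \<odot>\<^bsub>M\<^esub> g i \<oplus>\<^bsub>M\<^esub> q i \<odot>\<^bsub>M\<^esub> g i) ?F"
      using c p q g F
      by (intro M.finsum_cong')
        (auto simp: Pi_def R.fin_supp_fun_closed[OF p] R.fin_supp_fun_closed[OF q] smult_l_distr)
    also have "\<dots> = finsum M (\<lambda>i. p i \<odot>\<^bsub>M\<^esub> g i) ?F \<oplus>\<^bsub>M\<^esub> finsum M (\<lambda>i. q i \<odot>\<^bsub>M\<^esub> g i) ?F"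
      using c[OF p F(2)] c[OF q F(2)] by (rule M.finsum_addf)
    also have "\<dots> = free_lift R M g p \<oplus>\<^bsub>M\<^esub> free_lift R M g q"
      using free_lift_superset[OF p g F(1) _ F(2)] free_lift_superset[OF q g F(1) _ F(2)] by simp
    finally show ?thesis by (simp add: free_module_simps)
  qed
  show "free_lift R M g (s \<odot>\<^bsub>free_module R I\<^esub> p) = s \<odot>\<^bsub>M\<^esub> free_lift R M g p"
    if "s \<in> carrier R" "p \<in> carrier (free_module R I)" for s p
  proof -
    from that have p: "p \<in> fin_supp_fun R I" by (simp add: free_module_simps)
    let ?F = "{i. p i \<noteq> \<zero>}"
    have F: "finite ?F" "?F \<subseteq> I" using p by (auto simp: fin_supp_fun_def)
    have sp: "(\<lambda>i. s \<otimes> p i) \<in> fin_supp_fun R I" using that(1) p by (rule R.fin_supp_fun_smult)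
    have "free_lift R M g (\<lambda>i. s \<otimes> p i) = finsum M (\<lambda>i. (s \<otimes> p i) \<odot>\<^bsub>M\<^esub> g i) ?F"
      using that(1) by (intro free_lift_superset[OF sp g F(1) _ F(2)]) auto
    also have "\<dots> = finsum M (\<lambda>i. s \<odot>\<^bsub>M\<^esub> (p i \<odot>\<^bsub>M\<^esub> g i)) ?F"
      using c p g F that(1)
      by (intro M.finsum_cong') (auto simp: Pi_def R.fin_supp_fun_closed[OF p] smult_assoc1)
    also have "\<dots> = s \<odot>\<^bsub>M\<^esub> free_lift R M g p"
      unfolding free_lift_def using finsum_smult_ldistr[OF F(1) that(1) c[OF p F(2)]] by simp
    finally show ?thesis by (simp add: free_module_simps)
  qed
qed

lemma (in module) free_lift_basis:
  assumes "g \<in> I \<rightarrow> carrier M" "i \<in> I"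
  shows "free_lift R M g (basis_fun R i) = g i"
proof -
  have gi: "g i \<in> carrier M" using assms by auto
  have "free_lift R M g (basis_fun R i) = finsum M (\<lambda>j. basis_fun R i j \<odot>\<^bsub>M\<^esub> g j) {i}"
    using assms
    by (intro free_lift_superset[of _ I] R.basis_fun_closed) (auto simp: basis_fun_def)
  also have "\<dots> = g i" using gi by (subst M.finsum_insert) (auto simp: basis_fun_def)
  finally show ?thesis .
qed

lemma free_module_hom_eqI:
  assumes "cring S" "module S Y"
    and h: "h \<in> mod_hom S (free_module S I) Y" and k: "k \<in> mod_hom S (free_module S I) Y"
    and eq: "\<And>i. i \<in> I \<Longrightarrow> h (basis_fun S i) = k (basis_fun S i)"
    and p: "p \<in> fin_supp_fun S I"
  shows "h p = k p"
proof -
  interpret S: cring S by fact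
  interpret F: module S "free_module S I" by (rule S.free_module_is_module)
  show ?thesis using p
  proof (induction rule: S.fin_supp_fun_induct)
    case zero
    show ?case
      using mod_hom_zero[OF h] mod_hom_zero[OF k] F.module_axioms assms(2)
      by (simp add: free_module_simps)
  next
    case (add p q)
    then show ?case using mod_homD(2)[OF h, of p q] mod_homD(2)[OF k, of p q]
      by (simp add: free_module_simps)
  next
    case (smult_basis s i)
    then show ?case
      using mod_homD(3)[OF h, of s "basis_fun S i"] mod_homD(3)[OF k, of s "basis_fun S i"] eq
        S.basis_fun_closed[OF smult_basis(2)]
      by (simp add: free_module_simps)
  qed
qed

section \<open>The universal property of the tensor product\<close>

locale tensor_modules = X: module S X + Y: module S Y
  for S (structure) and X :: "('s, 'a, 'q) module_scheme" and Y :: "('s, 'b, 'u) module_scheme"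
begin

abbreviation "F \<equiv> free_module S (carrier X \<times> carrier Y)"

sublocale F: module S F
  by (rule X.R.free_module_is_module)

lemma basis_closed: "\<lbrakk>x \<in> carrier X; y \<in> carrier Y\<rbrakk> \<Longrightarrow> basis_fun S (x, y) \<in> carrier F"
  by (simp add: free_module_simps X.R.basis_fun_closed)

lemma relations_closed: "tensor_relations S X Y \<subseteq> carrier F"
  by (auto simp: tensor_relations_def Let_def basis_closed)

lemma kernel_submodule: "submodule (tensor_kernel S X Y) S F"
  unfolding tensor_kernel_def using relations_closed by (rule F.module_span_submodule)

text \<open>Each family of \<open>tensor_relations\<close> turns through this into one linearity law
  of \<open>pure_tensor\<close>.\<close>

lemma relation_cosets:
  assumes "a \<ominus>\<^bsub>F\<^esub> b \<in> tensor_relations S X Y" "a \<in> carrier F" "b \<in> carrier F"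
  shows "tensor_kernel S X Y +>\<^bsub>F\<^esub> a = tensor_kernel S X Y +>\<^bsub>F\<^esub> b"
proof (rule F.submodule_coset_eq[OF kernel_submodule assms(2,3)])
  show "a \<ominus>\<^bsub>F\<^esub> b \<in> tensor_kernel S X Y"
    unfolding tensor_kernel_def using assms(1) by (rule subsetD[OF subset_module_span])
qed

lemma pure_tensor_closed:
  "\<lbrakk>x \<in> carrier X; y \<in> carrier Y\<rbrakk> \<Longrightarrow> pure_tensor S X Y x y \<in> carrier (tensor_module S X Y)"
  by (auto simp: tensor_module_def pure_tensor_def quotient_module_carrier intro: basis_closed)

lemma pure_tensor_add_left:
  assumes "x \<in> carrier X" "x' \<in> carrier X" "y \<in> carrier Y"
  shows "pure_tensor S X Y (x \<oplus>\<^bsub>X\<^esub> x') y =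
    pure_tensor S X Y x y \<oplus>\<^bsub>tensor_module S X Y\<^esub> pure_tensor S X Y x' y"
  unfolding tensor_module_def pure_tensor_def using assms
  by (subst F.quotient_module_add[OF kernel_submodule])
    (simp_all add: basis_closed, rule relation_cosets,
      auto simp: basis_closed tensor_relations_def Let_def)

lemma pure_tensor_add_right:
  assumes "x \<in> carrier X" "y \<in> carrier Y" "y' \<in> carrier Y"
  shows "pure_tensor S X Y x (y \<oplus>\<^bsub>Y\<^esub> y') =
    pure_tensor S X Y x y \<oplus>\<^bsub>tensor_module S X Y\<^esub> pure_tensor S X Y x y'"
  unfolding tensor_module_def pure_tensor_def using assms
  by (subst F.quotient_module_add[OF kernel_submodule])
    (simp_all add: basis_closed, rule relation_cosets,
      auto simp: basis_closed tensor_relations_def Let_def)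

lemma pure_tensor_smult_left:
  assumes "s \<in> carrier S" "x \<in> carrier X" "y \<in> carrier Y"
  shows "pure_tensor S X Y (s \<odot>\<^bsub>X\<^esub> x) y = s \<odot>\<^bsub>tensor_module S X Y\<^esub> pure_tensor S X Y x y"
  unfolding tensor_module_def pure_tensor_def using assms
  by (subst F.quotient_module_smult[OF kernel_submodule])
    (simp_all add: basis_closed, rule relation_cosets,
      auto simp: basis_closed tensor_relations_def Let_def)

lemma pure_tensor_smult_right:
  assumes "s \<in> carrier S" "x \<in> carrier X" "y \<in> carrier Y"
  shows "pure_tensor S X Y x (s \<odot>\<^bsub>Y\<^esub> y) = s \<odot>\<^bsub>tensor_module S X Y\<^esub> pure_tensor S X Y x y"
  unfolding tensor_module_def pure_tensor_def using assms
  by (subst F.quotient_module_smult[OF kernel_submodule])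
    (simp_all add: basis_closed, rule relation_cosets,
      auto simp: basis_closed tensor_relations_def Let_def)

lemma tensor_lift:
  assumes Z: "module S Z"
    and b: "\<And>x y. \<lbrakk>x \<in> carrier X; y \<in> carrier Y\<rbrakk> \<Longrightarrow> b x y \<in> carrier Z"
      "\<And>x x' y. \<lbrakk>x \<in> carrier X; x' \<in> carrier X; y \<in> carrier Y\<rbrakk> \<Longrightarrow>
        b (x \<oplus>\<^bsub>X\<^esub> x') y = b x y \<oplus>\<^bsub>Z\<^esub> b x' y"
      "\<And>x y y'. \<lbrakk>x \<in> carrier X; y \<in> carrier Y; y' \<in> carrier Y\<rbrakk> \<Longrightarrow>
        b x (y \<oplus>\<^bsub>Y\<^esub> y') = b x y \<oplus>\<^bsub>Z\<^esub> b x y'"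
      "\<And>s x y. \<lbrakk>s \<in> carrier S; x \<in> carrier X; y \<in> carrier Y\<rbrakk> \<Longrightarrow>
        b (s \<odot>\<^bsub>X\<^esub> x) y = s \<odot>\<^bsub>Z\<^esub> b x y"
      "\<And>s x y. \<lbrakk>s \<in> carrier S; x \<in> carrier X; y \<in> carrier Y\<rbrakk> \<Longrightarrow>
        b x (s \<odot>\<^bsub>Y\<^esub> y) = s \<odot>\<^bsub>Z\<^esub> b x y"
  obtains h where "h \<in> mod_hom S (tensor_module S X Y) Z"
    and "\<And>x y. \<lbrakk>x \<in> carrier X; y \<in> carrier Y\<rbrakk> \<Longrightarrow> h (pure_tensor S X Y x y) = b x y"
proof -
  interpret Z: module S Z by fact
  define \<phi> where "\<phi> = free_lift S Z (\<lambda>(x, y). b x y)"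
  have g: "(\<lambda>(x, y). b x y) \<in> carrier X \<times> carrier Y \<rightarrow> carrier Z" using b(1) by auto
  have \<phi>: "\<phi> \<in> mod_hom S F Z" unfolding \<phi>_def using g by (rule Z.free_lift_hom)
  have basis: "\<phi> (basis_fun S (x, y)) = b x y" if "x \<in> carrier X" "y \<in> carrier Y" for x y
    unfolding \<phi>_def using Z.free_lift_basis[OF g] that by simp
  note hom = mod_homD[OF \<phi>] mod_hom_minus[OF \<phi> F.module_axioms Z]
  \<comment> \<open>The four families of relations are the four laws assumed of \<open>b\<close>.
    The kernel of \<open>\<phi>\<close> is a submodule, so it then contains their span.\<close>
  have "\<phi> r = \<zero>\<^bsub>Z\<^esub>" if "r \<in> tensor_relations S X Y" for r
    using that
    by (auto simp: tensor_relations_def Let_def hom basis b basis_closed Z.M.minus_self)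
  then have "tensor_relations S X Y \<subseteq> {p \<in> carrier F. \<phi> p = \<zero>\<^bsub>Z\<^esub>}"
    using relations_closed by blast
  then have "tensor_kernel S X Y \<subseteq> {p \<in> carrier F. \<phi> p = \<zero>\<^bsub>Z\<^esub>}"
    unfolding tensor_kernel_def
    by (intro module_span_minimal mod_hom_kernel_submodule F.module_axioms Z \<phi>)
  then obtain h where "h \<in> mod_hom S (quotient_module F (tensor_kernel S X Y)) Z"
    "\<And>p. p \<in> carrier F \<Longrightarrow> h (tensor_kernel S X Y +>\<^bsub>F\<^esub> p) = \<phi> p"
    using quotient_module_lift[OF F.module_axioms Z kernel_submodule \<phi>] by blast
  then show thesis
    using basis basis_closed by (intro that) (auto simp: tensor_module_def pure_tensor_def)
qed

end

section \<open>Polynomial algebras\<close>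

lemma finite_submultisets: "finite {k. k \<subseteq># m}"
proof (induction m)
  case (add x m)
  have "k \<subseteq># m \<or> k \<in> add_mset x ` {k. k \<subseteq># m}" if "k \<subseteq># add_mset x m" for k
  proof (cases "x \<in># k")
    case True
    then obtain k' where "k = add_mset x k'" by (blast dest: multi_member_split)
    with that show ?thesis by simp
  next
    case False
    with that show ?thesis using subset_eq_diff_conv[of k "{#x#}" m] by simp
  qed
  then have "{k. k \<subseteq># add_mset x m} \<subseteq> {k. k \<subseteq># m} \<union> add_mset x ` {k. k \<subseteq># m}" by blast
  then show ?case using add finite_subset by blast
qed simp

text \<open>Coefficients of a product are sums over these splittings; an infinite index set would
  make \<open>finsum\<close> return zero.\<close>

lemma finite_mset_splits: "finite {(k, l). k + l = m}" for m :: "'a multiset"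
proof (rule finite_subset)
  show "{(k, l). k + l = m} \<subseteq> (\<lambda>k. (k, m - k)) ` {k. k \<subseteq># m}" by auto
qed (simp add: finite_submultisets)

lemma poly_algebra_simps:
  "carrier (poly_algebra S I) = fin_supp_fun S {m. set_mset m \<subseteq> I}"
  "p \<oplus>\<^bsub>poly_algebra S I\<^esub> q = (\<lambda>m. p m \<oplus>\<^bsub>S\<^esub> q m)"
  "\<zero>\<^bsub>poly_algebra S I\<^esub> = (\<lambda>_. \<zero>\<^bsub>S\<^esub>)"
  "\<one>\<^bsub>poly_algebra S I\<^esub> = basis_fun S {#}"
  "s \<odot>\<^bsub>poly_algebra S I\<^esub> p = (\<lambda>m. s \<otimes>\<^bsub>S\<^esub> p m)"
  "p \<otimes>\<^bsub>poly_algebra S I\<^esub> q = (\<lambda>m. finsum S (\<lambda>(k, l). p k \<otimes>\<^bsub>S\<^esub> q l) {(k, l). k + l = m})"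
  by (simp_all add: poly_algebra_def)

text \<open>Polynomials are the free module on the monomials: the two records differ only in
  \<open>mult\<close> and \<open>one\<close>, which module homomorphisms ignore, so facts about free
  modules carry over.\<close>

lemma poly_algebra_add_monoid:
  "add_monoid (poly_algebra S I) = add_monoid (free_module S {m. set_mset m \<subseteq> I})"
  by (simp add: poly_algebra_def free_module_def)

lemma mod_hom_poly_algebra:
  "mod_hom S (poly_algebra S I) Y = mod_hom S (free_module S {m. set_mset m \<subseteq> I}) Y"
  unfolding mod_hom_def poly_algebra_add_monoid by (simp add: poly_algebra_simps free_module_simps)

context cring
begin

lemma poly_algebra_module: "module R (poly_algebra R I)"
proof -
  interpret F: module R "free_module R {m. set_mset m \<subseteq> I}" by (rule free_module_is_module)
  have "abelian_group (poly_algebra R I)"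
    using F.M.a_comm_group unfolding poly_algebra_add_monoid[symmetric]
    by (intro abelian_group.intro abelian_monoid.intro abelian_group_axioms.intro)
      (auto simp: comm_group_def)
  moreover have "carrier (poly_algebra R I) = carrier (free_module R {m. set_mset m \<subseteq> I})"
    "add (poly_algebra R I) = add (free_module R {m. set_mset m \<subseteq> I})"
    "smult (poly_algebra R I) = smult (free_module R {m. set_mset m \<subseteq> I})"
    by (simp_all add: poly_algebra_def free_module_def)
  ultimately show ?thesis
    by (intro moduleI cring_axioms)
      (simp_all add: F.smult_l_distr F.smult_r_distr F.smult_assoc1)
qed

end

locale polynomials = cring S for S (structure) and I :: "'i set"
begin

abbreviation "P \<equiv> poly_algebra S I"

sublocale P: module S P
  by (rule poly_algebra_module)

abbreviation monomial :: "'i multiset \<Rightarrow> 'i multiset \<Rightarrow> 'a"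
  where "monomial \<equiv> basis_fun S"

lemma coeff_closed: "p \<in> carrier P \<Longrightarrow> p m \<in> carrier S"
  unfolding poly_algebra_simps by (rule fin_supp_fun_closed)

lemma monomial_closed: "set_mset m \<subseteq> I \<Longrightarrow> monomial m \<in> carrier P"
  unfolding poly_algebra_simps by (rule basis_fun_closed) simp

lemma poly_induct [consumes 1, case_names zero add smult_monomial]:
  assumes "p \<in> carrier P" "Q \<zero>\<^bsub>P\<^esub>"
    and "\<And>p q. \<lbrakk>p \<in> carrier P; q \<in> carrier P; Q p; Q q\<rbrakk> \<Longrightarrow> Q (p \<oplus>\<^bsub>P\<^esub> q)"
    and "\<And>s m. \<lbrakk>s \<in> carrier S; set_mset m \<subseteq> I\<rbrakk> \<Longrightarrow> Q (s \<odot>\<^bsub>P\<^esub> monomial m)"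
  shows "Q p"
  using assms(1) unfolding poly_algebra_simps
proof (induction rule: fin_supp_fun_induct)
  case zero
  then show ?case using assms(2) by (simp add: poly_algebra_simps)
next
  case (add p q)
  then show ?case using assms(3)[of p q] by (simp add: poly_algebra_simps)
next
  case (smult_basis s i)
  then show ?case using assms(4)[of s i] by (simp add: poly_algebra_simps)
qed

lemma coeff_mult:
  "(p \<otimes>\<^bsub>P\<^esub> q) m = finsum S (\<lambda>(k, l). p k \<otimes> q l) {(k, l). k + l = m}"
  by (simp add: poly_algebra_simps)

lemma coeff_mult_nonzeroD:
  assumes "p \<in> carrier P" "q \<in> carrier P" "(p \<otimes>\<^bsub>P\<^esub> q) m \<noteq> \<zero>"
  shows "\<exists>k l. k + l = m \<and> p k \<noteq> \<zero> \<and> q l \<noteq> \<zero>"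
proof (rule ccontr)
  assume none: "\<not> ?thesis"
  have "p k \<otimes> q l = \<zero>" if "k + l = m" for k l
    using that none coeff_closed[OF assms(1), of k] coeff_closed[OF assms(2), of l] by fastforce
  then have "(p \<otimes>\<^bsub>P\<^esub> q) m = \<zero>"
    unfolding coeff_mult by (intro add.finprod_one_eqI) auto
  with assms(3) show False ..
qed

lemma mult_closed:
  assumes p: "p \<in> carrier P" and q: "q \<in> carrier P"
  shows "p \<otimes>\<^bsub>P\<^esub> q \<in> carrier P"
proof -
  have pq: "p k \<otimes> q l \<in> carrier S" for k l using coeff_closed[OF p] coeff_closed[OF q] by simp
  have "{m. (p \<otimes>\<^bsub>P\<^esub> q) m \<noteq> \<zero>} \<subseteq> (\<lambda>(k, l). k + l) ` ({k. p k \<noteq> \<zero>} \<times> {l. q l \<noteq> \<zero>})"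
    using coeff_mult_nonzeroD[OF p q] by force
  moreover have "finite {k. p k \<noteq> \<zero>}" "finite {l. q l \<noteq> \<zero>}"
    using p q by (simp_all add: poly_algebra_simps fin_supp_fun_def)
  ultimately have "finite {m. (p \<otimes>\<^bsub>P\<^esub> q) m \<noteq> \<zero>}" by (meson finite_SigmaI finite_imageI finite_subset)
  moreover have "(p \<otimes>\<^bsub>P\<^esub> q) m \<in> carrier S" for m
    unfolding coeff_mult by (rule finsum_closed) (auto simp: pq)
  moreover have "(p \<otimes>\<^bsub>P\<^esub> q) m = \<zero>" if "\<not> set_mset m \<subseteq> I" for m
  proof (rule ccontr)
    assume "(p \<otimes>\<^bsub>P\<^esub> q) m \<noteq> \<zero>"
    then obtain k l where kl: "k + l = m" "p k \<noteq> \<zero>" "q l \<noteq> \<zero>"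
      using coeff_mult_nonzeroD[OF p q] by blast
    then have "set_mset k \<subseteq> I" "set_mset l \<subseteq> I"
      using p q by (auto simp: poly_algebra_simps(1) fin_supp_fun_def)
    with kl that show False by auto
  qed
  ultimately show ?thesis by (simp add: poly_algebra_simps(1) fin_supp_fun_def)
qed

lemma poly_l_distr:
  assumes p: "p \<in> carrier P" and p': "p' \<in> carrier P" and q: "q \<in> carrier P"
  shows "(p \<oplus>\<^bsub>P\<^esub> p') \<otimes>\<^bsub>P\<^esub> q = p \<otimes>\<^bsub>P\<^esub> q \<oplus>\<^bsub>P\<^esub> p' \<otimes>\<^bsub>P\<^esub> q"
proof
  fix m :: "'i multiset"
  note c = coeff_closed[OF p] coeff_closed[OF p'] coeff_closed[OF q]
  have "((p \<oplus>\<^bsub>P\<^esub> p') \<otimes>\<^bsub>P\<^esub> q) m =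
      finsum S (\<lambda>(k, l). p k \<otimes> q l \<oplus> p' k \<otimes> q l) {(k, l). k + l = m}"
    unfolding coeff_mult by (rule finsum_cong') (auto simp: c l_distr poly_algebra_simps(2))
  also have "\<dots> = (p \<otimes>\<^bsub>P\<^esub> q) m \<oplus> (p' \<otimes>\<^bsub>P\<^esub> q) m"
    unfolding coeff_mult
    by (subst finsum_addf[symmetric]) (auto simp: c intro!: finsum_cong')
  finally show "((p \<oplus>\<^bsub>P\<^esub> p') \<otimes>\<^bsub>P\<^esub> q) m = (p \<otimes>\<^bsub>P\<^esub> q \<oplus>\<^bsub>P\<^esub> p' \<otimes>\<^bsub>P\<^esub> q) m"
    by (simp add: poly_algebra_simps(2))
qed

lemma poly_m_comm:
  assumes p: "p \<in> carrier P" and q: "q \<in> carrier P"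
  shows "p \<otimes>\<^bsub>P\<^esub> q = q \<otimes>\<^bsub>P\<^esub> p"
proof
  fix m :: "'i multiset"
  note c = coeff_closed[OF p] coeff_closed[OF q]
  have swap: "{(k, l). k + l = m} = prod.swap ` {(k, l). k + l = m}"
    by (auto simp: image_iff add.commute)
  have "(p \<otimes>\<^bsub>P\<^esub> q) m = finsum S (\<lambda>(k, l). p k \<otimes> q l) (prod.swap ` {(k, l). k + l = m})"
    unfolding coeff_mult using swap by simp
  also have "\<dots> = finsum S (\<lambda>x. (\<lambda>(k, l). p k \<otimes> q l) (prod.swap x)) {(k, l). k + l = m}"
    by (rule finsum_reindex) (auto simp: c)
  also have "\<dots> = (q \<otimes>\<^bsub>P\<^esub> p) m"
    unfolding coeff_mult by (rule finsum_cong') (auto simp: c m_comm)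
  finally show "(p \<otimes>\<^bsub>P\<^esub> q) m = (q \<otimes>\<^bsub>P\<^esub> p) m" .
qed

lemma poly_smult_mult:
  assumes s: "s \<in> carrier S" and p: "p \<in> carrier P" and q: "q \<in> carrier P"
  shows "(s \<odot>\<^bsub>P\<^esub> p) \<otimes>\<^bsub>P\<^esub> q = s \<odot>\<^bsub>P\<^esub> (p \<otimes>\<^bsub>P\<^esub> q)"
proof
  fix m :: "'i multiset"
  note c = coeff_closed[OF p] coeff_closed[OF q] s
  have "((s \<odot>\<^bsub>P\<^esub> p) \<otimes>\<^bsub>P\<^esub> q) m = finsum S (\<lambda>x. s \<otimes> (\<lambda>(k, l). p k \<otimes> q l) x) {(k, l). k + l = m}"
    unfolding coeff_mult by (rule finsum_cong') (auto simp: c m_assoc poly_algebra_simps(5))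
  also have "\<dots> = s \<otimes> (p \<otimes>\<^bsub>P\<^esub> q) m"
    unfolding coeff_mult by (rule finsum_rdistr[symmetric]) (auto simp: c finite_mset_splits)
  finally show "((s \<odot>\<^bsub>P\<^esub> p) \<otimes>\<^bsub>P\<^esub> q) m = (s \<odot>\<^bsub>P\<^esub> (p \<otimes>\<^bsub>P\<^esub> q)) m"
    by (simp add: poly_algebra_simps(5))
qed

lemma monomial_mult: "monomial k \<otimes>\<^bsub>P\<^esub> monomial l = monomial (k + l)"
proof
  fix m :: "'i multiset"
  \<comment> \<open>Among all splittings only the pair \<open>(k, l)\<close> contributes to the
    convolution.\<close>
  have d: "(\<lambda>(i, j). monomial k i \<otimes> monomial l j) = (\<lambda>x. if x = (k, l) then \<one> else \<zero>)"
    by (auto simp: basis_fun_def fun_eq_iff)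
  show "(monomial k \<otimes>\<^bsub>P\<^esub> monomial l) m = monomial (k + l) m"
  proof (cases "k + l = m")
    case True
    then have "(k, l) \<in> {(k, l). k + l = m}" by simp
    from add.finprod_singleton_swap[OF this finite_mset_splits, of "\<lambda>_. \<one>"] show ?thesis
      unfolding coeff_mult d using True by (simp add: basis_fun_def)
  next
    case False
    have "finsum S (\<lambda>x. if x = (k, l) then \<one> else \<zero>) {(k, l). k + l = m} = \<zero>"
      using False by (intro add.finprod_one_eqI) auto
    then show ?thesis unfolding coeff_mult d using False by (simp add: basis_fun_def)
  qed
qed

lemma poly_zero_mult:
  assumes "q \<in> carrier P"
  shows "\<zero>\<^bsub>P\<^esub> \<otimes>\<^bsub>P\<^esub> q = \<zero>\<^bsub>P\<^esub>"
  using poly_smult_mult[of \<zero> "\<zero>\<^bsub>P\<^esub>" q] assms mult_closed[of "\<zero>\<^bsub>P\<^esub>" q] by simp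

lemma poly_mult_zero:
  "p \<in> carrier P \<Longrightarrow> p \<otimes>\<^bsub>P\<^esub> \<zero>\<^bsub>P\<^esub> = \<zero>\<^bsub>P\<^esub>"
  by (simp add: poly_m_comm[of p] poly_zero_mult)

lemma poly_r_distr:
  assumes "p \<in> carrier P" "q \<in> carrier P" "q' \<in> carrier P"
  shows "p \<otimes>\<^bsub>P\<^esub> (q \<oplus>\<^bsub>P\<^esub> q') = p \<otimes>\<^bsub>P\<^esub> q \<oplus>\<^bsub>P\<^esub> p \<otimes>\<^bsub>P\<^esub> q'"
  using assms poly_l_distr[of q q' p] by (simp add: poly_m_comm[of p])

lemma poly_mult_smult:
  assumes "s \<in> carrier S" "p \<in> carrier P" "q \<in> carrier P"
  shows "p \<otimes>\<^bsub>P\<^esub> (s \<odot>\<^bsub>P\<^esub> q) = s \<odot>\<^bsub>P\<^esub> (p \<otimes>\<^bsub>P\<^esub> q)"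
  using assms poly_smult_mult[of s q p] by (simp add: poly_m_comm[of p])

lemma poly_one_closed: "\<one>\<^bsub>P\<^esub> \<in> carrier P"
  by (simp add: poly_algebra_simps(4) monomial_closed)

lemma poly_one_mult:
  assumes "q \<in> carrier P"
  shows "\<one>\<^bsub>P\<^esub> \<otimes>\<^bsub>P\<^esub> q = q"
  using assms
proof (induction rule: poly_induct)
  case zero
  show ?case by (rule poly_mult_zero[OF poly_one_closed])
next
  case (add p q)
  then show ?case by (simp add: poly_r_distr poly_one_closed)
next
  case (smult_monomial s m)
  then have "\<one>\<^bsub>P\<^esub> \<otimes>\<^bsub>P\<^esub> (s \<odot>\<^bsub>P\<^esub> monomial m) = s \<odot>\<^bsub>P\<^esub> (\<one>\<^bsub>P\<^esub> \<otimes>\<^bsub>P\<^esub> monomial m)"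
    by (simp add: poly_mult_smult poly_one_closed monomial_closed)
  then show ?case unfolding poly_algebra_simps(4) monomial_mult by simp
qed

text \<open>Associativity is reduced by linearity, one factor after another, to monomials, where it
  is associativity of multiset union; no double sum is reindexed.\<close>

lemma poly_m_assoc_monomial:
  assumes "p \<in> carrier P" "q \<in> carrier P"
    and n: "set_mset n \<subseteq> I"
  shows "(p \<otimes>\<^bsub>P\<^esub> q) \<otimes>\<^bsub>P\<^esub> monomial n = p \<otimes>\<^bsub>P\<^esub> (q \<otimes>\<^bsub>P\<^esub> monomial n)"
  using assms(1)
proof (induction rule: poly_induct)
  note mn = monomial_closed[OF n]
  case zero
  then show ?case using assms(2) mn by (simp add: poly_zero_mult mult_closed)
next
  note mn = monomial_closed[OF n]
  case (add p p')
  then show ?case using assms(2) mn by (simp add: poly_l_distr mult_closed)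
next
  note mn = monomial_closed[OF n]
  case (smult_monomial s k)
  note k = smult_monomial(2)
  note mk = monomial_closed[OF k]
  have "monomial k \<otimes>\<^bsub>P\<^esub> q \<otimes>\<^bsub>P\<^esub> monomial n = monomial k \<otimes>\<^bsub>P\<^esub> (q \<otimes>\<^bsub>P\<^esub> monomial n)"
    using assms(2)
  proof (induction rule: poly_induct)
    case zero
    then show ?case using mk mn
      by (simp add: poly_zero_mult mult_closed poly_mult_zero)
  next
    case (add q q')
    then show ?case using mk mn
      by (simp add: poly_l_distr poly_r_distr mult_closed)
  next
    case (smult_monomial t l)
    then show ?case using k n
      by (simp add: monomial_closed poly_smult_mult poly_mult_smult mult_closed monomial_mult add_ac)
  qed
  then show ?case using assms(2) mn mk smult_monomial(1) by (simp add: poly_smult_mult mult_closed)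
qed

lemma poly_m_assoc:
  assumes "p \<in> carrier P" "q \<in> carrier P" "r \<in> carrier P"
  shows "(p \<otimes>\<^bsub>P\<^esub> q) \<otimes>\<^bsub>P\<^esub> r = p \<otimes>\<^bsub>P\<^esub> (q \<otimes>\<^bsub>P\<^esub> r)"
  using assms(3)
proof (induction rule: poly_induct)
  case zero
  then show ?case using assms by (simp add: poly_mult_zero mult_closed)
next
  case (add r r')
  then show ?case using assms by (simp add: poly_r_distr mult_closed)
next
  case (smult_monomial s m)
  then show ?case using assms monomial_closed[OF smult_monomial(2)]
    by (simp add: poly_mult_smult mult_closed poly_m_assoc_monomial)
qed

lemma poly_algebra_algebra: "algebra S P"
proof -
  have "cring P"
    by (intro cringI comm_monoidI P.M.abelian_group_axioms)
      (simp_all add: poly_one_closed mult_closed poly_m_assoc poly_one_mult poly_l_distr, rule poly_m_comm)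
  then show ?thesis
    by (intro algebra.intro P.module_axioms algebra_axioms.intro) (simp_all add: poly_smult_mult)
qed

sublocale P: algebra S P
  by (rule poly_algebra_algebra)

end

section \<open>Quadratic maps and the divided power algebra\<close>

lemma mod_hom_add_pow:
  assumes h: "h \<in> mod_hom S X Y" and X: "module S X" and Y: "module S Y" and x: "x \<in> carrier X"
  shows "h ([(n :: nat)] \<cdot>\<^bsub>X\<^esub> x) = [n] \<cdot>\<^bsub>Y\<^esub> (h x)"
proof -
  interpret X: module S X by fact
  interpret Y: module S Y by fact
  show ?thesis
    by (induction n) (simp_all add: mod_hom_zero[OF h X Y] mod_homD[OF h] x)
qed

section \<open>Monomials in the divided power symbols, sorted by weight\<close>

definition weight :: "(nat \<times> 'a) multiset \<Rightarrow> nat"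
  where "weight m = sum_mset (image_mset fst m)"

text \<open>A symbol of index 0 becomes 1 in the divided power algebra, so a linear form that
  descends to it can depend on the remaining factors only.\<close>

definition positive_part :: "(nat \<times> 'a) multiset \<Rightarrow> (nat \<times> 'a) multiset"
  where "positive_part m = filter_mset (\<lambda>i. fst i \<noteq> 0) m"

lemma weight_add_mset [simp]: "weight (add_mset i m) = fst i + weight m"
  by (simp add: weight_def)

lemma weight_empty [simp]: "weight {#} = 0"
  by (simp add: weight_def)

lemma positive_part_add_mset [simp]:
  "positive_part (add_mset (k, x) m) = (if k = 0 then positive_part m else add_mset (k, x) (positive_part m))"
  by (simp add: positive_part_def)

lemma positive_part_empty [simp]: "positive_part {#} = {#}"
  by (simp add: positive_part_def)

lemma weight_positive_part: "weight (positive_part m) = weight m"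
  by (induction m) auto

lemma positive_part_weight_0: "weight m = 0 \<Longrightarrow> positive_part m = {#}"
  by (induction m) auto

lemma positive_part_weight_1:
  "weight m = 1 \<Longrightarrow> \<exists>y \<in> snd ` set_mset m. positive_part m = {#(1, y)#}"
proof (induction m)
  case (add i m)
  obtain k x where i: "i = (k, x)" by force
  show ?case
  proof (cases "k = 0")
    case True
    then show ?thesis using add i by auto
  next
    case False
    then have "k = 1" "weight m = 0" using add.prems i by auto
    then show ?thesis using positive_part_weight_0[of m] i by auto
  qed
qed simp

text \<open>The remaining indices are at least 1, so weight 2 is either a single 2 or 1 + 1. The
  symbols are located in \<open>m\<close> so that they lie in the carrier when those of
  \<open>m\<close> do.\<close>

lemma positive_part_weight_2:
  assumes "weight m = 2"
  shows "(\<exists>x \<in> snd ` set_mset m. positive_part m = {#(2, x)#}) \<or>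
    (\<exists>x \<in> snd ` set_mset m. \<exists>y \<in> snd ` set_mset m. positive_part m = {#(1, x), (1, y)#})"
  using assms
proof (induction m)
  case (add i m)
  obtain k x where i: "i = (k, x)" by force
  consider "k = 0" "weight m = 2" | "k = 1" "weight m = 1" | "k = 2" "weight m = 0"
    using add.prems i by force
  then show ?case
  proof cases
    case 1
    then show ?thesis using add.IH i by auto
  next
    case 2
    then show ?thesis using positive_part_weight_1[of m] i by auto
  next
    case 3
    then show ?thesis using positive_part_weight_0[of m] i by auto
  qed
qed simp

text \<open>The linear form of weight 2 on polynomials in the \<open>\<gamma>\<^sub>n(x)\<close> determined by a quadratic map
  \<open>q\<close> with cross effect \<open>b\<close>: \<open>\<gamma>\<^sub>2(x) \<mapsto> q x\<close>, \<open>\<gamma>\<^sub>1(x)\<gamma>\<^sub>1(y) \<mapsto> b x y\<close>, factors \<open>\<gamma>\<^sub>0(x)\<close> being ignored.\<close>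

definition quad_value ::
  "('s, 'b, 'u) module_scheme \<Rightarrow> ('a \<Rightarrow> 'b) \<Rightarrow> ('a \<Rightarrow> 'a \<Rightarrow> 'b) \<Rightarrow> (nat \<times> 'a) multiset \<Rightarrow> 'b"
  where "quad_value Y q b m =
    (if \<exists>x. positive_part m = {#(2, x)#} then q (THE x. positive_part m = {#(2, x)#})
     else if weight m = 2
     then THE z. \<exists>x y. positive_part m = {#(1, x), (1, y)#} \<and> z = b x y
     else \<zero>\<^bsub>Y\<^esub>)"

locale divided_powers = X: module S X
  for S (structure) and X :: "('s, 'a, 'q) module_scheme"
begin

sublocale D: polynomials S "(UNIV :: nat set) \<times> carrier X"
  by unfold_locales

abbreviation "W \<equiv> dp_poly S X"

sublocale W: algebra S W
  unfolding dp_poly_def by (rule D.poly_algebra_algebra)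

abbreviation gen :: "nat \<Rightarrow> 'a \<Rightarrow> (nat \<times> 'a) multiset \<Rightarrow> 's"
  where "gen n x \<equiv> basis_fun S {#(n, x)#}"

lemma monomial_in_W: "snd ` set_mset m \<subseteq> carrier X \<Longrightarrow> basis_fun S m \<in> carrier W"
  unfolding dp_poly_def by (rule D.monomial_closed) auto

lemma gen_closed: "x \<in> carrier X \<Longrightarrow> gen n x \<in> carrier W"
  by (rule monomial_in_W) simp

lemma W_monomial_mult: "basis_fun S k \<otimes>\<^bsub>W\<^esub> basis_fun S l = basis_fun S (k + l)"
  unfolding dp_poly_def by (rule D.monomial_mult)

lemma W_one: "\<one>\<^bsub>W\<^esub> = basis_fun S {#}"
  by (simp add: dp_poly_def poly_algebra_simps)

lemma relations_closed: "dp_relations S X \<subseteq> carrier W"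
proof -
  have "(\<lambda>k. gen k x \<otimes>\<^bsub>W\<^esub> gen (n - k) y) \<in> {..n} \<rightarrow> carrier W" if "x \<in> carrier X" "y \<in> carrier X" for n x y
    using that by (simp add: gen_closed)
  then show ?thesis
    by (auto simp: dp_relations_def Let_def gen_closed intro!: W.minus_closed W.finsum_closed
        W.add.nat_pow_closed)
qed

lemma ideal_dp_ideal: "ideal (dp_ideal S X) W"
  unfolding dp_ideal_def using relations_closed by (rule W.genideal_ideal)

text \<open>Scalars act as multiplication by multiples of the unit, so quotients by ideals fall
  under the lemmas on quotients by submodules.\<close>

lemma ideal_submodule:
  assumes "ideal J W"
  shows "submodule J S W"
proof -
  interpret J: ideal J W by fact
  have "s \<odot>\<^bsub>W\<^esub> p \<in> J" if s: "s \<in> carrier S" and p: "p \<in> J" for s p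
  proof -
    have "s \<odot>\<^bsub>W\<^esub> p = (s \<odot>\<^bsub>W\<^esub> \<one>\<^bsub>W\<^esub>) \<otimes>\<^bsub>W\<^esub> p"
      using s p by (simp add: W.smult_assoc2)
    also have "\<dots> \<in> J" using s p by (intro J.I_l_closed) auto
    finally show ?thesis .
  qed
  then show ?thesis
    by (intro submodule.intro submodule_axioms.intro J.a_subgroup)
qed

text \<open>The relation for scalars in degree 2, read in the quotient; the converse direction
  derives from it how \<open>ract_dev\<close> behaves under \<open>ract M m s\<close>.\<close>

lemma dp_gamma_2_smult:
  assumes s: "s \<in> carrier S" and x: "x \<in> carrier X"
  shows "dp_gamma S X 2 (s \<odot>\<^bsub>X\<^esub> x) = (s \<otimes> s) \<odot>\<^bsub>dp_component S X 2\<^esub> dp_gamma S X 2 x"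
proof -
  have s2: "s [^] (2::nat) = s \<otimes> s" using s by (simp add: numeral_2_eq_2)
  have "gen 2 (s \<odot>\<^bsub>X\<^esub> x) \<ominus>\<^bsub>W\<^esub> ((s \<otimes> s) \<odot>\<^bsub>W\<^esub> gen 2 x) \<in> dp_relations S X"
    using s x unfolding s2[symmetric] dp_relations_def Let_def by blast
  then have "gen 2 (s \<odot>\<^bsub>X\<^esub> x) \<ominus>\<^bsub>W\<^esub> ((s \<otimes> s) \<odot>\<^bsub>W\<^esub> gen 2 x) \<in> dp_ideal S X"
    unfolding dp_ideal_def using W.genideal_self[OF relations_closed] by blast
  then have "dp_gamma S X 2 (s \<odot>\<^bsub>X\<^esub> x) = dp_ideal S X +>\<^bsub>W\<^esub> ((s \<otimes> s) \<odot>\<^bsub>W\<^esub> gen 2 x)"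
    unfolding dp_gamma_def using s x
    by (intro W.submodule_coset_eq ideal_submodule ideal_dp_ideal) (simp_all add: gen_closed)
  also have "\<dots> = (s \<otimes> s) \<odot>\<^bsub>dp_component S X 2\<^esub> dp_gamma S X 2 x"
    using s x W.quotient_module_smult[OF ideal_submodule[OF ideal_dp_ideal], of "s \<otimes> s" "gen 2 x"]
    by (simp add: dp_component_def dp_algebra_def dp_gamma_def gen_closed)
  finally show ?thesis .
qed

lemma dp_gamma_closed:
  assumes "x \<in> carrier X"
  shows "dp_gamma S X n x \<in> carrier (dp_component S X n)"
proof -
  have "gen n x \<in> dp_homogeneous S X n"
    using gen_closed[OF assms] by (auto simp: dp_homogeneous_def basis_fun_def split: if_splits)
  then show ?thesis by (auto simp: dp_component_def dp_gamma_def)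
qed

end

section \<open>The linear form on polynomials determined by a quadratic map\<close>

locale quadratic_map = divided_powers S X + Y: module S Y
  for S (structure) and X :: "('s, 'a, 'q) module_scheme" and Y :: "('s, 'b, 'u) module_scheme" +
  fixes q :: "'a \<Rightarrow> 'b" and b :: "'a \<Rightarrow> 'a \<Rightarrow> 'b"
  assumes q_closed: "x \<in> carrier X \<Longrightarrow> q x \<in> carrier Y"
    and q_smult: "\<lbrakk>s \<in> carrier S; x \<in> carrier X\<rbrakk> \<Longrightarrow> q (s \<odot>\<^bsub>X\<^esub> x) = (s \<otimes> s) \<odot>\<^bsub>Y\<^esub> q x"
    and q_add: "\<lbrakk>x \<in> carrier X; y \<in> carrier X\<rbrakk> \<Longrightarrow> q (x \<oplus>\<^bsub>X\<^esub> y) = q x \<oplus>\<^bsub>Y\<^esub> q y \<oplus>\<^bsub>Y\<^esub> b x y"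
    and b_closed: "\<lbrakk>x \<in> carrier X; y \<in> carrier X\<rbrakk> \<Longrightarrow> b x y \<in> carrier Y"
    and b_add: "\<lbrakk>x \<in> carrier X; y \<in> carrier X; z \<in> carrier X\<rbrakk> \<Longrightarrow>
      b (x \<oplus>\<^bsub>X\<^esub> y) z = b x z \<oplus>\<^bsub>Y\<^esub> b y z"
    and b_smult: "\<lbrakk>s \<in> carrier S; x \<in> carrier X; y \<in> carrier X\<rbrakk> \<Longrightarrow>
      b (s \<odot>\<^bsub>X\<^esub> x) y = s \<odot>\<^bsub>Y\<^esub> b x y"
begin

text \<open>Swapping \<open>x\<close> and \<open>y\<close> in \<open>q_add\<close> leaves the other
  terms unchanged. Symmetry makes the value on an unordered pair of symbols of index 1 well
  defined.\<close>

lemma b_sym: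
  assumes "x \<in> carrier X" "y \<in> carrier X"
  shows "b x y = b y x"
proof -
  have "q x \<oplus>\<^bsub>Y\<^esub> q y \<oplus>\<^bsub>Y\<^esub> b x y = q x \<oplus>\<^bsub>Y\<^esub> q y \<oplus>\<^bsub>Y\<^esub> b y x"
    using q_add[of x y] q_add[of y x] assms
    by (simp add: X.M.a_comm[of y x] Y.M.a_comm[of "q y" "q x"] q_closed)
  then show ?thesis using assms by (simp add: q_closed b_closed)
qed

text \<open>Compare q(2x) = 4 q(x) with q(x) + q(x) + b(x, x). This is what the relation
  \<gamma>_1(x)^2 = 2 \<gamma>_2(x) demands.\<close>

lemma b_self:
  assumes x: "x \<in> carrier X"
  shows "b x x = q x \<oplus>\<^bsub>Y\<^esub> q x"
proof -
  have "x \<oplus>\<^bsub>X\<^esub> x = (\<one> \<oplus> \<one>) \<odot>\<^bsub>X\<^esub> x" using x by (simp add: X.smult_l_distr)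
  then have "q (x \<oplus>\<^bsub>X\<^esub> x) = ((\<one> \<oplus> \<one>) \<otimes> (\<one> \<oplus> \<one>)) \<odot>\<^bsub>Y\<^esub> q x" using x q_smult by simp
  also have "\<dots> = (q x \<oplus>\<^bsub>Y\<^esub> q x) \<oplus>\<^bsub>Y\<^esub> (q x \<oplus>\<^bsub>Y\<^esub> q x)"
    using x q_closed by (simp add: Y.smult_assoc1 Y.smult_l_distr)
  finally have "(q x \<oplus>\<^bsub>Y\<^esub> q x) \<oplus>\<^bsub>Y\<^esub> b x x = (q x \<oplus>\<^bsub>Y\<^esub> q x) \<oplus>\<^bsub>Y\<^esub> (q x \<oplus>\<^bsub>Y\<^esub> q x)"
    using q_add[OF x x] by simp
  then show ?thesis using x by (simp add: q_closed b_closed)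
qed

abbreviation "V \<equiv> quad_value Y q b"

lemma value_gamma_2: "positive_part m = {#(2, x)#} \<Longrightarrow> V m = q x"
  by (simp add: quad_value_def)

lemma value_gamma_1_1:
  assumes pos: "positive_part m = {#(1, x), (1, y)#}" and "x \<in> carrier X" "y \<in> carrier X"
  shows "V m = b x y"
proof -
  have "weight m = 2" using weight_positive_part[of m] pos by simp
  \<comment> \<open>The multiset fixes \<open>x\<close> and \<open>y\<close> only up to order; by
    \<open>b_sym\<close> either order describes the same value.\<close>
  moreover have "(THE z. \<exists>x y. positive_part m = {#(1, x), (1, y)#} \<and> z = b x y) = b x y"
    using b_sym[OF assms(2,3)] unfolding pos
    by (intro the_equality) (auto simp: add_eq_conv_ex)
  ultimately show ?thesis using pos by (simp add: quad_value_def)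
qed

lemma value_weight: "weight m \<noteq> 2 \<Longrightarrow> V m = \<zero>\<^bsub>Y\<^esub>"
  using weight_positive_part[of m] by (auto simp: quad_value_def)

lemma value_closed:
  assumes m: "snd ` set_mset m \<subseteq> carrier X"
  shows "V m \<in> carrier Y"
proof (cases "weight m = 2")
  case True
  from positive_part_weight_2[OF this] show ?thesis
  proof (elim disjE bexE)
    fix x assume "x \<in> snd ` set_mset m" "positive_part m = {#(2, x)#}"
    with m show ?thesis using value_gamma_2[of m x] q_closed[of x] by auto
  next
    fix x y assume xy: "x \<in> snd ` set_mset m" "y \<in> snd ` set_mset m"
      "positive_part m = {#(1, x), (1, y)#}"
    with m have "x \<in> carrier X" "y \<in> carrier X" by auto
    with xy(3) show ?thesis using value_gamma_1_1[of m x y] b_closed[of x y] by simp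
  qed
qed (simp add: value_weight)

lemma value_gamma_0: "V (add_mset (0, x) m) = V m"
  by (simp add: quad_value_def)

text \<open>The partner \<open>y\<close> does not depend on \<open>x\<close>, so the value inherits
  the linearity of \<open>b\<close> in its first argument.\<close>

lemma value_gamma_1:
  assumes "weight m = 1" "snd ` set_mset m \<subseteq> carrier X"
  obtains y where "y \<in> carrier X" "\<And>x. x \<in> carrier X \<Longrightarrow> V (add_mset (1, x) m) = b x y"
proof -
  obtain y where y: "y \<in> carrier X" "positive_part m = {#(1, y)#}"
    using positive_part_weight_1[OF assms(1)] assms(2) by blast
  then have "V (add_mset (1, x) m) = b x y" if "x \<in> carrier X" for x
    using that by (intro value_gamma_1_1) auto
  with y(1) show thesis by (rule that)
qed

lemma value_closed': "V \<in> {m. set_mset m \<subseteq> UNIV \<times> carrier X} \<rightarrow> carrier Y"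
  by (auto intro!: value_closed)

definition linear_form where "linear_form = free_lift S Y V"

lemma mod_hom_W: "mod_hom S W = mod_hom S (free_module S {m. set_mset m \<subseteq> UNIV \<times> carrier X})"
  by (rule ext) (simp add: dp_poly_def mod_hom_poly_algebra)

lemma linear_form_hom: "linear_form \<in> mod_hom S W Y"
  unfolding linear_form_def mod_hom_W using value_closed' by (rule Y.free_lift_hom)

lemma linear_form_monomial:
  assumes "snd ` set_mset m \<subseteq> carrier X"
  shows "linear_form (basis_fun S m) = V m"
  unfolding linear_form_def using value_closed'
  by (rule Y.free_lift_basis) (use assms in auto)

text \<open>The kernel of \<open>linear_form\<close> is only known to be a submodule, whereas
  \<open>dp_ideal\<close> is generated as an ideal; this is the largest ideal inside that
  kernel.\<close>

definition null_ideal where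
  "null_ideal = {p \<in> carrier W. \<forall>r \<in> carrier W. linear_form (r \<otimes>\<^bsub>W\<^esub> p) = \<zero>\<^bsub>Y\<^esub>}"

lemma ideal_null_ideal: "ideal null_ideal W"
proof (rule idealI)
  note hom = mod_homD[OF linear_form_hom]
  note hom0 = mod_hom_zero[OF linear_form_hom W.module_axioms Y.module_axioms]
  interpret L: abelian_group_hom W Y linear_form
    by (rule mod_hom_group_hom[OF linear_form_hom W.module_axioms Y.module_axioms])
  show "ring W" by (rule W.ring_axioms)
  show "subgroup null_ideal (add_monoid W)"
    by (rule W.add.subgroupI)
      (auto simp: null_ideal_def hom hom0 W.r_distr W.r_minus a_inv_def[symmetric])
  show "x \<otimes>\<^bsub>W\<^esub> a \<in> null_ideal" if "a \<in> null_ideal" "x \<in> carrier W" for a x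
    using that by (auto simp: null_ideal_def W.m_assoc[symmetric])
  then show "a \<otimes>\<^bsub>W\<^esub> x \<in> null_ideal" if "a \<in> null_ideal" "x \<in> carrier W" for a x
    using that by (auto simp: null_ideal_def W.m_comm[of a x])
qed

text \<open>For fixed \<open>p\<close> the form is linear in the multiplier \<open>r\<close>, and
  the monomials form a basis.\<close>

lemma null_idealI:
  assumes p: "p \<in> carrier W"
    and mon: "\<And>m. snd ` set_mset m \<subseteq> carrier X \<Longrightarrow> linear_form (basis_fun S m \<otimes>\<^bsub>W\<^esub> p) = \<zero>\<^bsub>Y\<^esub>"
  shows "p \<in> null_ideal"
proof -
  have h: "(\<lambda>r. linear_form (r \<otimes>\<^bsub>W\<^esub> p)) \<in> mod_hom S W Y"
    using p by (intro mod_homI) (simp_all add: mod_homD[OF linear_form_hom] W.l_distr W.smult_assoc2)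
  have z: "(\<lambda>r. \<zero>\<^bsub>Y\<^esub>) \<in> mod_hom S W Y"
    by (rule mod_homI) simp_all
  have "linear_form (r \<otimes>\<^bsub>W\<^esub> p) = \<zero>\<^bsub>Y\<^esub>" if "r \<in> carrier W" for r
  proof (rule free_module_hom_eqI[OF X.R.is_cring Y.module_axioms h[unfolded mod_hom_W] z[unfolded mod_hom_W]])
    show "r \<in> fin_supp_fun S {m. set_mset m \<subseteq> UNIV \<times> carrier X}"
      using that by (simp add: dp_poly_def poly_algebra_simps(1))
    show "linear_form (basis_fun S m \<otimes>\<^bsub>W\<^esub> p) = \<zero>\<^bsub>Y\<^esub>"
      if "m \<in> {m. set_mset m \<subseteq> UNIV \<times> carrier X}" for m
      using that by (intro mon) auto
  qed
  with p show ?thesis by (simp add: null_ideal_def)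
qed

lemma linear_form_mult_hom:
  assumes "r \<in> carrier W"
  shows "(\<lambda>p. linear_form (r \<otimes>\<^bsub>W\<^esub> p)) \<in> mod_hom S W Y"
proof (rule mod_homI)
  fix s p assume "s \<in> carrier S" "p \<in> carrier W"
  then show "linear_form (r \<otimes>\<^bsub>W\<^esub> (s \<odot>\<^bsub>W\<^esub> p)) = s \<odot>\<^bsub>Y\<^esub> linear_form (r \<otimes>\<^bsub>W\<^esub> p)"
    using assms by (simp add: mod_homD[OF linear_form_hom] W.m_comm[of r] W.smult_assoc2)
qed (use assms in \<open>simp_all add: mod_homD[OF linear_form_hom] W.r_distr\<close>)

text \<open>Roby's relation for scalars, multiplied by the monomial \<open>m\<close>. Outside total
  weight 2 both sides vanish; the cases n = 0, 1, 2 are triviality, linearity of \<open>b\<close>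
  and \<open>q_smult\<close>.\<close>

lemma value_smult:
  assumes s: "s \<in> carrier S" and x: "x \<in> carrier X" and m: "snd ` set_mset m \<subseteq> carrier X"
  shows "V (add_mset (n, s \<odot>\<^bsub>X\<^esub> x) m) = (s [^] n) \<odot>\<^bsub>Y\<^esub> V (add_mset (n, x) m)"
proof -
  consider "n + weight m \<noteq> 2" | "n = 0" "weight m = 2" | "n = 1" "weight m = 1" | "n = 2" "weight m = 0"
    by force
  then show ?thesis
  proof cases
    case 1
    then show ?thesis using s by (simp add: value_weight)
  next
    case 2
    then show ?thesis using value_closed[OF m] by (simp add: value_gamma_0)
  next
    case 3
    obtain y where "y \<in> carrier X" "\<And>x. x \<in> carrier X \<Longrightarrow> V (add_mset (1, x) m) = b x y"
      using value_gamma_1[OF 3(2) m] by blast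
    then show ?thesis using 3 s x by (simp add: b_smult)
  next
    case 4
    then have "positive_part m = {#}" by (intro positive_part_weight_0)
    then have "V (add_mset (2, z) m) = q z" for z by (intro value_gamma_2) simp
    then show ?thesis using 4 s x by (simp add: q_smult numeral_2_eq_2)
  qed
qed

text \<open>The addition formula times \<open>m\<close>: for n = 1 it is additivity of
  \<open>b\<close>, for n = 2 it is \<open>q_add\<close>, with \<open>b x y\<close> as the summand
  at k = 1.\<close>

lemma value_add:
  assumes x: "x \<in> carrier X" and y: "y \<in> carrier X" and m: "snd ` set_mset m \<subseteq> carrier X"
  shows "V (add_mset (n, x \<oplus>\<^bsub>X\<^esub> y) m) =
    finsum Y (\<lambda>k. V (add_mset (k, x) (add_mset (n - k, y) m))) {..n}"
proof -
  have c: "V (add_mset (k, u) (add_mset (l, v) m)) \<in> carrier Y" "V (add_mset (k, u) m) \<in> carrier Y"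
    if "u \<in> carrier X" "v \<in> carrier X" for k l u v
    using that m by (intro value_closed; simp)+
  consider "n + weight m \<noteq> 2" | "n = 0" "weight m = 2" | "n = 1" "weight m = 1" | "n = 2" "weight m = 0"
    by force
  then show ?thesis
  proof cases
    case 1
    have "finsum Y (\<lambda>k. V (add_mset (k, x) (add_mset (n - k, y) m))) {..n} = \<zero>\<^bsub>Y\<^esub>"
      using 1 by (intro Y.M.add.finprod_one_eqI value_weight) simp
    then show ?thesis using 1 by (simp add: value_weight)
  next
    case 2
    then show ?thesis using value_closed[OF m] by (simp add: value_gamma_0)
  next
    case 3
    obtain z where "z \<in> carrier X" "\<And>x. x \<in> carrier X \<Longrightarrow> V (add_mset (1, x) m) = b x z"
      using value_gamma_1[OF 3(2) m] by blast
    then show ?thesis using 3 x y c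
      by (simp add: b_add b_closed value_gamma_0 add_mset_commute[of "(Suc 0, x)"] Pi_def)
  next
    case 4
    then have pos: "positive_part m = {#}" by (intro positive_part_weight_0)
    then have "V (add_mset (2, z) m) = q z" for z by (intro value_gamma_2) simp
    moreover have "V (add_mset (1, x) (add_mset (1, y) m)) = b x y"
      using pos x y by (intro value_gamma_1_1) simp_all
    moreover have "{..2::nat} = {0, 1, 2}" by auto
    ultimately show ?thesis using 4 x y c
      by (simp add: value_gamma_0 add_mset_commute[of "(2, x)"] q_add q_closed b_closed
          Y.M.a_ac Pi_def)
  qed
qed

text \<open>The product formula times \<open>m\<close>: if an index is 0, the binomial coefficient
  is 1; otherwise weight 2 forces k = l = 1, which is \<open>b_self\<close>.\<close>

lemma value_mult:
  assumes x: "x \<in> carrier X" and m: "snd ` set_mset m \<subseteq> carrier X"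
  shows "V (add_mset (k, x) (add_mset (l, x) m)) =
    [((k + l) choose k)] \<cdot>\<^bsub>Y\<^esub> (V (add_mset (k + l, x) m))"
proof -
  have c: "V (add_mset (n, x) m) \<in> carrier Y" for n
    using x m by (intro value_closed) simp
  consider "k + l + weight m \<noteq> 2" | "k = 0" | "l = 0" | "k = 1" "l = 1" "weight m = 0"
    by force
  then show ?thesis
  proof cases
    case 1
    then show ?thesis by (simp add: value_weight)
  next
    case 2
    then show ?thesis using c by (simp add: value_gamma_0)
  next
    case 3
    then show ?thesis using c by (simp add: value_gamma_0 add_mset_commute[of "(k, x)"])
  next
    case 4
    then have pos: "positive_part m = {#}" by (intro positive_part_weight_0)
    then have "V (add_mset (2, x) m) = q x" by (intro value_gamma_2) simp
    moreover have "V (add_mset (1, x) (add_mset (1, x) m)) = b x x"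
      using pos x by (intro value_gamma_1_1) simp_all
    moreover have "[(2::nat)] \<cdot>\<^bsub>Y\<^esub> (q x) = q x \<oplus>\<^bsub>Y\<^esub> q x"
      using x by (simp add: numeral_2_eq_2 q_closed)
    ultimately show ?thesis using 4 x by (simp add: b_self numeral_2_eq_2)
  qed
qed

lemma relations_null: "dp_relations S X \<subseteq> null_ideal"
proof
  fix r assume r: "r \<in> dp_relations S X"
  show "r \<in> null_ideal"
  proof (rule null_idealI)
    show "r \<in> carrier W" using r relations_closed by blast
    fix m :: "(nat \<times> 'a) multiset" assume m: "snd ` set_mset m \<subseteq> carrier X"
    \<comment> \<open>A relation is a difference, so it is killed once the linear map
      \<open>e\<close> agrees on its two sides; on symbols, \<open>e\<close> returns values of
      \<open>V\<close> at monomials containing \<open>m\<close>.\<close>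
    define e where "e p = linear_form (basis_fun S m \<otimes>\<^bsub>W\<^esub> p)" for p
    have e: "e \<in> mod_hom S W Y"
      unfolding e_def using monomial_in_W[OF m] by (rule linear_form_mult_hom)
    have e_closed: "e p \<in> carrier Y" if "p \<in> carrier W" for p
      using mod_homD(1)[OF e that] .
    have e_diff: "e (p \<ominus>\<^bsub>W\<^esub> p') = \<zero>\<^bsub>Y\<^esub>" if "e p = e p'" "p \<in> carrier W" "p' \<in> carrier W" for p p'
      using mod_hom_minus[OF e W.module_axioms Y.module_axioms that(2,3)] that(1)
        Y.M.minus_self[OF e_closed[OF that(3)]] by simp
    have e_gen: "e (gen n x) = V (add_mset (n, x) m)" if "x \<in> carrier X" for n x
      using that m unfolding e_def W_monomial_mult by (subst linear_form_monomial) auto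
    have e_gen2: "e (gen n x \<otimes>\<^bsub>W\<^esub> gen l y) = V (add_mset (n, x) (add_mset (l, y) m))"
      if "x \<in> carrier X" "y \<in> carrier X" for n l x y
      using that m unfolding e_def W_monomial_mult
      by (subst linear_form_monomial) (auto simp: add_mset_commute)
    have e_one: "e \<one>\<^bsub>W\<^esub> = V m"
      using m unfolding e_def W_one W_monomial_mult by (subst linear_form_monomial) auto
    from r show "linear_form (basis_fun S m \<otimes>\<^bsub>W\<^esub> r) = \<zero>\<^bsub>Y\<^esub>"
      unfolding e_def[symmetric] dp_relations_def Let_def
    proof (elim UnE CollectE exE conjE; hypsubst)
      fix x assume "x \<in> carrier X"
      then show "e (gen 0 x \<ominus>\<^bsub>W\<^esub> \<one>\<^bsub>W\<^esub>) = \<zero>\<^bsub>Y\<^esub>"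
        by (intro e_diff) (simp_all add: e_gen e_one value_gamma_0 gen_closed)
    next
      fix n s x assume s: "s \<in> carrier S" and x: "x \<in> carrier X"
      then show "e (gen n (s \<odot>\<^bsub>X\<^esub> x) \<ominus>\<^bsub>W\<^esub> ((s [^] n) \<odot>\<^bsub>W\<^esub> gen n x)) = \<zero>\<^bsub>Y\<^esub>"
        using m by (intro e_diff) (simp_all add: e_gen mod_homD(3)[OF e] value_smult gen_closed)
    next
      fix n :: nat and x y assume x: "x \<in> carrier X" and y: "y \<in> carrier X"
      have c: "(\<lambda>k. gen k x \<otimes>\<^bsub>W\<^esub> gen (n - k) y) \<in> {..n} \<rightarrow> carrier W"
        using x y by (simp add: gen_closed)
      have "e (finsum W (\<lambda>k. gen k x \<otimes>\<^bsub>W\<^esub> gen (n - k) y) {..n}) = e (gen n (x \<oplus>\<^bsub>X\<^esub> y))"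
        using x y m by (simp add: mod_hom_finsum[OF e W.module_axioms Y.module_axioms c] e_gen e_gen2 value_add)
      with x y c show "e (gen n (x \<oplus>\<^bsub>X\<^esub> y) \<ominus>\<^bsub>W\<^esub>
          finsum W (\<lambda>k. gen k x \<otimes>\<^bsub>W\<^esub> gen (n - k) y) {..n}) = \<zero>\<^bsub>Y\<^esub>"
        by (intro e_diff W.finsum_closed) (simp_all add: gen_closed)
    next
      fix k l x assume x: "x \<in> carrier X"
      then show "e (gen k x \<otimes>\<^bsub>W\<^esub> gen l x \<ominus>\<^bsub>W\<^esub> [((k + l) choose k)] \<cdot>\<^bsub>W\<^esub> (gen (k + l) x)) = \<zero>\<^bsub>Y\<^esub>"
        using m by (intro e_diff) (simp_all add: e_gen e_gen2 gen_closed value_mult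
            mod_hom_add_pow[OF e W.module_axioms Y.module_axioms])
    qed
  qed
qed

lemma dp_component_lift:
  obtains h where "h \<in> mod_hom S (dp_component S X 2) Y"
    and "\<And>x. x \<in> carrier X \<Longrightarrow> h (dp_gamma S X 2 x) = q x"
proof -
  \<comment> \<open>Membership in \<open>null_ideal\<close> is applied with the multiplier
    1.\<close>
  have ker: "linear_form p = \<zero>\<^bsub>Y\<^esub>" if "p \<in> dp_ideal S X" for p
  proof -
    have "p \<in> null_ideal"
      using that W.genideal_minimal[OF ideal_null_ideal relations_null] unfolding dp_ideal_def by blast
    then have "p \<in> carrier W" "linear_form (\<one>\<^bsub>W\<^esub> \<otimes>\<^bsub>W\<^esub> p) = \<zero>\<^bsub>Y\<^esub>"
      unfolding null_ideal_def by blast+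
    then show ?thesis by simp
  qed
  obtain h where h: "h \<in> mod_hom S (dp_algebra S X) Y"
    and h_coset: "\<And>p. p \<in> carrier W \<Longrightarrow> h (dp_ideal S X +>\<^bsub>W\<^esub> p) = linear_form p"
    using quotient_module_lift[OF W.module_axioms Y.module_axioms ideal_submodule[OF ideal_dp_ideal]
        linear_form_hom ker] unfolding dp_algebra_def by blast
  \<comment> \<open>The form descends to the whole algebra. The component of degree 2 has the same
    operations on a smaller carrier, so restriction is all that remains.\<close>
  have "carrier (dp_component S X 2) \<subseteq> carrier (dp_algebra S X)"
    by (auto simp: dp_component_def dp_algebra_def quotient_module_carrier dp_homogeneous_def)
  then have "h \<in> mod_hom S (dp_component S X 2) Y"
    using mod_homD[OF h] by (intro mod_homI) (simp_all add: dp_component_def subset_iff)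
  moreover have "h (dp_gamma S X 2 x) = q x" if "x \<in> carrier X" for x
    using that unfolding dp_gamma_def
    by (simp add: h_coset gen_closed linear_form_monomial value_gamma_2)
  ultimately show thesis by (rule that)
qed

end

section \<open>Quotients of groups by central subgroups containing the commutators\<close>

text \<open>Additive notation for groups that need not be commutative, such as those of
  \<open>R\<close> and of the modules over it.\<close>

locale add_group =
  fixes G (structure)
  assumes group_add_monoid: "group (add_monoid G)"

sublocale add_group < add: group "add_monoid G"
  rewrites "carrier (add_monoid G) = carrier G"
    and "mult (add_monoid G) = add G"
    and "one (add_monoid G) = zero G"
    and "m_inv (add_monoid G) = a_inv G"
  by (simp_all add: group_add_monoid a_inv_def)

text \<open>Centrality makes the sum of two cosets a coset; containing the commutators makes the
  quotient abelian.\<close>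

locale central_quotient = add_group G for G (structure) +
  fixes K
  assumes K_subgroup: "subgroup K (add_monoid G)"
    and K_central: "\<lbrakk>k \<in> K; x \<in> carrier G\<rbrakk> \<Longrightarrow> x \<oplus> k = k \<oplus> x"
    and K_commutator: "\<lbrakk>x \<in> carrier G; y \<in> carrier G\<rbrakk> \<Longrightarrow> \<exists>k \<in> K. y \<oplus> x = k \<oplus> (x \<oplus> y)"
begin

lemma K_carrier: "k \<in> K \<Longrightarrow> k \<in> carrier G"
  using subgroup.mem_carrier[OF K_subgroup] by simp

lemma K_zero: "\<zero> \<in> K"
  using subgroup.one_closed[OF K_subgroup] by simp

lemma K_add: "\<lbrakk>k \<in> K; l \<in> K\<rbrakk> \<Longrightarrow> k \<oplus> l \<in> K"
  using subgroup.m_closed[OF K_subgroup] by simp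

lemma K_neg: "k \<in> K \<Longrightarrow> \<ominus> k \<in> K"
  using subgroup.m_inv_closed[OF K_subgroup] by (simp add: a_inv_def)

lemma mem_coset: "c \<in> K +> x \<longleftrightarrow> (\<exists>k \<in> K. c = k \<oplus> x)"
  by (auto simp: a_r_coset_def')

lemma coset_self: "x \<in> carrier G \<Longrightarrow> x \<in> K +> x"
  using K_zero by (force simp: mem_coset)

lemma coset_add_K:
  assumes k: "k \<in> K" and x: "x \<in> carrier G"
  shows "K +> (k \<oplus> x) = K +> x"
proof (intro equalityI subsetI)
  fix c assume "c \<in> K +> (k \<oplus> x)"
  then obtain l where "l \<in> K" "c = l \<oplus> (k \<oplus> x)" by (auto simp: mem_coset)
  then show "c \<in> K +> x"
    using k x by (auto simp: mem_coset K_carrier add.m_assoc[symmetric] intro!: bexI[of _ "l \<oplus> k"] K_add)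
next
  fix c assume "c \<in> K +> x"
  then obtain l where l: "l \<in> K" "c = l \<oplus> x" by (auto simp: mem_coset)
  have "c = (l \<oplus> \<ominus> k) \<oplus> (k \<oplus> x)"
    using l k x by (simp add: K_carrier add.m_assoc[symmetric] add.m_assoc[of l "\<ominus> k" k])
  then show "c \<in> K +> (k \<oplus> x)"
    using K_add[OF l(1) K_neg[OF k]] by (auto simp: mem_coset)
qed

lemma coset_eqD:
  assumes "K +> x = K +> y" "x \<in> carrier G"
  obtains k where "k \<in> K" "x = k \<oplus> y"
  using coset_self[OF assms(2)] assms(1) by (auto simp: mem_coset)

lemma coset_K: "k \<in> K \<Longrightarrow> K +> k = K"
  using coset_add_K[of k \<zero>] K_carrier subgroup.rcos_const[OF K_subgroup group_add_monoid K_zero]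
  by (simp add: a_r_coset_def)

lemma coset_zero: "K +> \<zero> = K"
  using K_zero by (rule coset_K)

lemma coset_sum:
  assumes x: "x \<in> carrier G" and y: "y \<in> carrier G"
  shows "set_add G (K +> x) (K +> y) = K +> (x \<oplus> y)"
proof (intro equalityI subsetI)
  fix c assume "c \<in> set_add G (K +> x) (K +> y)"
  then obtain k l where kl: "k \<in> K" "l \<in> K" "c = (k \<oplus> x) \<oplus> (l \<oplus> y)"
    by (auto simp: set_add_def' mem_coset)
  have "c = k \<oplus> (x \<oplus> l) \<oplus> y" using kl x y by (simp add: K_carrier add.m_assoc)
  also have "\<dots> = (k \<oplus> l) \<oplus> (x \<oplus> y)"
    using kl x y by (simp add: K_carrier K_central[of l x] add.m_assoc)
  finally show "c \<in> K +> (x \<oplus> y)" using kl by (auto simp: mem_coset intro: K_add)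
next
  fix c assume "c \<in> K +> (x \<oplus> y)"
  then obtain k where k: "k \<in> K" "c = k \<oplus> (x \<oplus> y)" by (auto simp: mem_coset)
  then have "c = (k \<oplus> x) \<oplus> y" using x y by (simp add: K_carrier add.m_assoc)
  moreover have "k \<oplus> x \<in> K +> x" using k by (auto simp: mem_coset)
  ultimately show "c \<in> set_add G (K +> x) (K +> y)"
    using coset_self[OF y] by (auto simp: set_add_def')
qed

lemma quotient_abelian_group:
  fixes Q (structure)
  assumes carrier: "carrier Q = a_rcosets K" and add: "add Q = set_add G" and zero: "zero Q = K"
  shows "abelian_group Q"
proof -
  have carr: "carrier Q = {K +> x | x. x \<in> carrier G}"
    by (auto simp: carrier A_RCOSETS_def')
  have sum: "(K +> x) \<oplus>\<^bsub>Q\<^esub> (K +> y) = K +> (x \<oplus> y)" if "x \<in> carrier G" "y \<in> carrier G" for x y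
    using that by (simp add: add coset_sum)
  have comm: "K +> (x \<oplus> y) = K +> (y \<oplus> x)" if xy: "x \<in> carrier G" "y \<in> carrier G" for x y
  proof -
    obtain k where "k \<in> K" "y \<oplus> x = k \<oplus> (x \<oplus> y)" using K_commutator xy by blast
    then show ?thesis using coset_add_K[of k "x \<oplus> y"] xy by simp
  qed
  show ?thesis
  proof (rule abelian_groupI)
    show "\<zero>\<^bsub>Q\<^esub> \<in> carrier Q" using coset_zero by (auto simp: zero carr)
    fix C assume "C \<in> carrier Q"
    then obtain x where x: "x \<in> carrier G" "C = K +> x" by (auto simp: carr)
    then show "\<zero>\<^bsub>Q\<^esub> \<oplus>\<^bsub>Q\<^esub> C = C" using sum[of \<zero> x] by (simp add: zero coset_zero)
    have "(K +> \<ominus> x) \<oplus>\<^bsub>Q\<^esub> C = \<zero>\<^bsub>Q\<^esub>" using x by (simp add: sum zero coset_zero)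
    then show "\<exists>C' \<in> carrier Q. C' \<oplus>\<^bsub>Q\<^esub> C = \<zero>\<^bsub>Q\<^esub>" using x(1) by (auto simp: carr)
  qed (auto simp: carr sum add.m_assoc comm)
qed

end

text \<open>Multiplication by \<open>2 = 1 + 1\<close>, which is not additive, supplies such a \<open>z\<close>: a value of
  \<open>P\<close> in a square ring, of a bracket in a module.\<close>

lemma (in add_group) commutator_double:
  assumes x: "x \<in> carrier G" and y: "y \<in> carrier G" and z: "z \<in> carrier G"
    and zy: "y \<oplus> z = z \<oplus> y"
    and double: "(x \<oplus> y) \<oplus> (x \<oplus> y) = x \<oplus> x \<oplus> (y \<oplus> y) \<oplus> z"
  shows "y \<oplus> x = x \<oplus> y \<oplus> z"
proof -
  \<comment> \<open>Cancelling \<open>x\<close> on the left of the doubled sum, then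
    \<open>y\<close> on the right, isolates the commutator.\<close>
  have "x \<oplus> ((y \<oplus> x) \<oplus> y) = x \<oplus> (x \<oplus> (y \<oplus> (y \<oplus> z)))"
    using double x y z by (simp add: add.m_assoc)
  then have "(y \<oplus> x) \<oplus> y = (x \<oplus> y \<oplus> z) \<oplus> y"
    using x y z by (simp add: zy[symmetric] add.m_assoc)
  then show ?thesis using x y z by simp
qed

section \<open>The ring and the modules attached to a square ring\<close>

context square_ring
begin

sublocale R: add_group R
  by (rule add_group.intro[OF add_group])

abbreviation (input) "D \<equiv> P ` carrier E"

lemma P_closed: "x \<in> carrier E \<Longrightarrow> P x \<in> carrier R"
  using P_hom by (auto simp: hom_def)

lemma P_group_hom: "group_hom (add_monoid E) (add_monoid R) P"
  using P_hom add_group abelian_group.a_group[OF ee_abelian_group]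
  by (intro group_hom.intro group_hom_axioms.intro)

lemma P_zero: "P \<zero>\<^bsub>E\<^esub> = \<zero>"
  using group_hom.hom_one[OF P_group_hom] by simp

lemma D_subgroup: "subgroup D (add_monoid R)"
  using group_hom.img_is_subgroup[OF P_group_hom] by simp

lemma one_R: "\<one> \<in> carrier R" and m_closed: "\<lbrakk>r \<in> carrier R; s \<in> carrier R\<rbrakk> \<Longrightarrow> r \<otimes> s \<in> carrier R"
  using mult_monoid by (simp_all add: monoid.one_closed monoid.m_closed)

lemma two_R: "\<one> \<oplus> \<one> \<in> carrier R"
  using one_R by simp

lemma mult_two: "r \<in> carrier R \<Longrightarrow> r \<otimes> (\<one> \<oplus> \<one>) = r \<oplus> r"
  using r_distr[of r \<one> \<one>] one_R mult_monoid by (simp add: monoid.r_one)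

lemma double_sum:
  assumes "r \<in> carrier R" "s \<in> carrier R"
  shows "(r \<oplus> s) \<oplus> (r \<oplus> s) = r \<oplus> r \<oplus> (s \<oplus> s) \<oplus> P (act r s (H (\<one> \<oplus> \<one>)) \<one>)"
  using l_quad_distr[OF assms two_R] assms by (simp add: mult_two)

text \<open>The correction term of \<open>double_sum\<close> has \<open>P x\<close> as an argument
  of the left action and vanishes, so the commutator is trivial.\<close>

lemma P_central:
  assumes x: "x \<in> carrier E" and r: "r \<in> carrier R"
  shows "r \<oplus> P x = P x \<oplus> r"
  using R.commutator_double[of "P x" r \<zero>] double_sum[of "P x" r] x r
    P_act_left[OF x r H_closed[OF two_R]] by (simp add: P_closed P_zero)

lemma D_central_quotient: "central_quotient R D"
proof (intro central_quotient.intro central_quotient_axioms.intro R.add_group_axioms D_subgroup)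
  show "r \<oplus> k = k \<oplus> r" if "k \<in> D" "r \<in> carrier R" for k r
    using that P_central by auto
next
  fix r s assume rs: "r \<in> carrier R" "s \<in> carrier R"
  \<comment> \<open>The correction term of \<open>double_sum\<close>; its image under
    \<open>P\<close> is the commutator of \<open>r\<close> and \<open>s\<close>.\<close>
  define z where "z = act r s (H (\<one> \<oplus> \<one>)) \<one>"
  have z: "z \<in> carrier E" using rs by (simp add: z_def act_closed H_closed one_R)
  have "s \<oplus> r = r \<oplus> s \<oplus> P z"
    using R.commutator_double[of r s "P z"] double_sum[OF rs] z rs P_central[of z s]
    by (simp add: P_closed z_def)
  then have "s \<oplus> r = P z \<oplus> (r \<oplus> s)" using P_central[of z "r \<oplus> s"] z rs by simp
  with z show "\<exists>k \<in> D. s \<oplus> r = k \<oplus> (r \<oplus> s)" by blast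
qed

sublocale D: central_quotient R D
  by (rule D_central_quotient)

lemma bar_simps:
  "carrier (sq_bar R) = {D +> r | r. r \<in> carrier R}" "\<one>\<^bsub>sq_bar R\<^esub> = D +> \<one>"
  "zero (sq_bar R) = D" "add (sq_bar R) = set_add R"
  by (auto simp: sq_bar_def FactRing_def A_RCOSETS_def' E_def P_def)

lemma bar_add:
  "\<lbrakk>r \<in> carrier R; s \<in> carrier R\<rbrakk> \<Longrightarrow> (D +> r) \<oplus>\<^bsub>sq_bar R\<^esub> (D +> s) = D +> (r \<oplus> s)"
  by (simp add: bar_simps D.coset_sum)

lemma P_mult_right: "\<lbrakk>x \<in> carrier E; s \<in> carrier R\<rbrakk> \<Longrightarrow> P x \<otimes> s = P (act \<one> \<one> x s)"
  using P_act[of \<one> x s] one_R mult_monoid by (simp add: monoid.l_one P_closed)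

lemma P_mult_left: "\<lbrakk>x \<in> carrier E; r \<in> carrier R\<rbrakk> \<Longrightarrow> r \<otimes> P x = P (act r r x \<one>)"
  using P_act[of r x \<one>] one_R mult_monoid m_closed by (simp add: monoid.r_one P_closed)

text \<open>Each product with a factor in Im P is a value of \<open>P\<close> by
  \<open>P_act\<close>, and the correction to left distributivity vanishes because \<open>k\<close>
  is an argument of the left action in it.\<close>

lemma mult_mod_D:
  assumes r: "r \<in> carrier R" and s: "s \<in> carrier R" and k: "k \<in> D" and l: "l \<in> D"
  shows "D +> ((k \<oplus> r) \<otimes> (l \<oplus> s)) = D +> (r \<otimes> s)"
proof -
  from k l obtain x y where x: "x \<in> carrier E" "k = P x" and y: "y \<in> carrier E" "l = P y" by auto
  note c = r s x y P_closed m_closed one_R H_closed act_closed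
  have "(k \<oplus> r) \<otimes> (l \<oplus> s) = (k \<oplus> r) \<otimes> l \<oplus> (k \<otimes> s \<oplus> r \<otimes> s \<oplus> P (act k r (H s) \<one>))"
    using c by (simp add: r_distr l_quad_distr)
  also have "(k \<oplus> r) \<otimes> l = P (act (k \<oplus> r) (k \<oplus> r) y \<one>)" using c by (simp add: P_mult_left)
  also have "k \<otimes> s = P (act \<one> \<one> x s)" using c by (simp add: P_mult_right)
  also have "act k r (H s) \<one> = \<zero>\<^bsub>E\<^esub>" using P_act_left[of x r "H s"] c by simp
  finally have "(k \<oplus> r) \<otimes> (l \<oplus> s) =
      P (act (k \<oplus> r) (k \<oplus> r) y \<one>) \<oplus> (P (act \<one> \<one> x s) \<oplus> r \<otimes> s)"
    using c by (simp add: P_zero)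
  then show ?thesis
    using c by (simp add: D.coset_add_K)
qed

lemma bar_mult:
  assumes r: "r \<in> carrier R" and s: "s \<in> carrier R"
  shows "(D +> r) \<otimes>\<^bsub>sq_bar R\<^esub> (D +> s) = D +> (r \<otimes> s)"
proof -
  have "D +> (r' \<otimes> s') = D +> (r \<otimes> s)" if "r' \<in> D +> r" "s' \<in> D +> s" for r' s'
    using that mult_mod_D[OF r s] by (auto simp: D.mem_coset)
  then have "(\<Union>r' \<in> D +> r. \<Union>s' \<in> D +> s. D +> (r' \<otimes> s')) = D +> (r \<otimes> s)"
    using D.coset_self[OF r] D.coset_self[OF s] by blast
  then show ?thesis by (simp add: sq_bar_def FactRing_def rcoset_mult_def E_def P_def)
qed

lemma bar_abelian_group: "abelian_group (sq_bar R)"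
  by (rule D.quotient_abelian_group) (simp_all add: sq_bar_def FactRing_def E_def P_def)

end

context comm_square_ring
begin

lemma bar_cring: "cring (sq_bar R)"
proof (rule cringI)
  show "abelian_group (sq_bar R)" by (rule bar_abelian_group)
  \<comment> \<open>Left distributivity fails in \<open>R\<close> only by a value of
    \<open>P\<close>, which is invisible in the quotient.\<close>
  have "D +> ((r \<oplus> s) \<otimes> t) = D +> (r \<otimes> t \<oplus> s \<otimes> t)"
    if "r \<in> carrier R" "s \<in> carrier R" "t \<in> carrier R" for r s t
  proof -
    have z: "act r s (H t) \<one> \<in> carrier E" using that by (simp add: act_closed H_closed one_R)
    then have "(r \<oplus> s) \<otimes> t = P (act r s (H t) \<one>) \<oplus> (r \<otimes> t \<oplus> s \<otimes> t)"
      using that by (simp add: l_quad_distr P_central m_closed)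
    then show ?thesis using that z by (simp add: D.coset_add_K m_closed)
  qed
  then show "(\<rho> \<oplus>\<^bsub>sq_bar R\<^esub> \<sigma>) \<otimes>\<^bsub>sq_bar R\<^esub> \<tau> = \<rho> \<otimes>\<^bsub>sq_bar R\<^esub> \<tau> \<oplus>\<^bsub>sq_bar R\<^esub> \<sigma> \<otimes>\<^bsub>sq_bar R\<^esub> \<tau>"
    if "\<rho> \<in> carrier (sq_bar R)" "\<sigma> \<in> carrier (sq_bar R)" "\<tau> \<in> carrier (sq_bar R)" for \<rho> \<sigma> \<tau>
    using that by (auto simp: bar_simps(1) bar_add bar_mult m_closed)
  show "comm_monoid (sq_bar R)"
  proof (rule comm_monoidI)
    show "\<rho> \<otimes>\<^bsub>sq_bar R\<^esub> \<sigma> = \<sigma> \<otimes>\<^bsub>sq_bar R\<^esub> \<rho>"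
      if "\<rho> \<in> carrier (sq_bar R)" "\<sigma> \<in> carrier (sq_bar R)" for \<rho> \<sigma>
      using that by (rule bar_comm)
  qed (auto simp: bar_simps(1,2) bar_mult m_closed one_R mult_monoid monoid.m_assoc[OF mult_monoid]
      monoid.l_one)
qed

lemma mult_comm_mod_D:
  assumes "r \<in> carrier R" "s \<in> carrier R"
  shows "D +> (r \<otimes> s) = D +> (s \<otimes> r)"
  using bar_comm[of "D +> r" "D +> s"] assms by (auto simp: bar_simps(1) bar_mult)

end

section \<open>The central subgroup \<open>A\<close> and the actions induced on it and on its
  quotient\<close>

context cp_module
begin

sublocale G: add_group M
  by (rule add_group.intro[OF M_group])

lemma A_carrier: "a \<in> A \<Longrightarrow> a \<in> carrier M"
  using subgroup.mem_carrier[OF A_subgroup] by simp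

lemma T_closed: "x \<in> carrier E \<Longrightarrow> T x \<in> carrier E"
  using T_hom by (auto simp: hom_def)

text \<open>\<open>T\<close> exchanges the two arguments of the bracket, so vanishing passes from
  the left to the right.\<close>

lemma brk_right_A: "\<lbrakk>m \<in> carrier M; a \<in> A; x \<in> carrier E\<rbrakk> \<Longrightarrow> brk M m a x = \<zero>\<^bsub>M\<^esub>"
  using brk_T[of a m x] brk_A[of a m "T x"] by (simp add: A_carrier T_closed)

lemma ract_double: "m \<in> carrier M \<Longrightarrow> ract M m (\<one> \<oplus> \<one>) = m \<oplus>\<^bsub>M\<^esub> m"
  using ract_add[of m \<one> \<one>] by (simp add: ract_one one_R)

lemma double_sum_M:
  assumes "m \<in> carrier M" "n \<in> carrier M"
  shows "(m \<oplus>\<^bsub>M\<^esub> n) \<oplus>\<^bsub>M\<^esub> (m \<oplus>\<^bsub>M\<^esub> n) =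
    m \<oplus>\<^bsub>M\<^esub> m \<oplus>\<^bsub>M\<^esub> (n \<oplus>\<^bsub>M\<^esub> n) \<oplus>\<^bsub>M\<^esub> brk M m n (H (\<one> \<oplus> \<one>))"
  using add_ract[OF assms two_R] assms by (simp add: ract_double)

text \<open>The bracket that measures the commutator has an argument in \<open>A\<close>, hence is
  zero.\<close>

lemma A_central: "\<lbrakk>a \<in> A; m \<in> carrier M\<rbrakk> \<Longrightarrow> m \<oplus>\<^bsub>M\<^esub> a = a \<oplus>\<^bsub>M\<^esub> m"
  using G.commutator_double[of a m "\<zero>\<^bsub>M\<^esub>"] double_sum_M[of a m] brk_A[OF _ _ H_closed[OF two_R]]
  by (simp add: A_carrier)

lemma A_central_quotient: "central_quotient M A"
proof (intro central_quotient.intro central_quotient_axioms.intro G.add_group_axioms A_subgroup)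
  fix m n assume mn: "m \<in> carrier M" "n \<in> carrier M"
  define a where "a = brk M m n (H (\<one> \<oplus> \<one>))"
  have a: "a \<in> A" unfolding a_def using mn by (intro brk_in_A H_closed two_R)
  have "n \<oplus>\<^bsub>M\<^esub> m = m \<oplus>\<^bsub>M\<^esub> n \<oplus>\<^bsub>M\<^esub> a"
    using G.commutator_double[of m n a] double_sum_M[OF mn] a mn A_central[of a n]
    by (simp add: A_carrier a_def)
  then have "n \<oplus>\<^bsub>M\<^esub> m = a \<oplus>\<^bsub>M\<^esub> (m \<oplus>\<^bsub>M\<^esub> n)" using A_central[OF a] mn by simp
  with a show "\<exists>a \<in> A. n \<oplus>\<^bsub>M\<^esub> m = a \<oplus>\<^bsub>M\<^esub> (m \<oplus>\<^bsub>M\<^esub> n)" by blast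
qed (rule A_central)

sublocale G: central_quotient M A
  by (rule A_central_quotient)

lemma A_comm: "\<lbrakk>a \<in> A; b \<in> A\<rbrakk> \<Longrightarrow> a \<oplus>\<^bsub>M\<^esub> b = b \<oplus>\<^bsub>M\<^esub> a"
  by (simp add: A_central A_carrier)

lemma A_lcomm:
  "\<lbrakk>a \<in> A; b \<in> A; c \<in> A\<rbrakk> \<Longrightarrow> a \<oplus>\<^bsub>M\<^esub> (b \<oplus>\<^bsub>M\<^esub> c) = b \<oplus>\<^bsub>M\<^esub> (a \<oplus>\<^bsub>M\<^esub> c)"
  using A_comm[of a b] by (simp add: A_carrier G.add.m_assoc[symmetric])

lemma A_ract_add:
  "\<lbrakk>a \<in> A; b \<in> A; r \<in> carrier R\<rbrakk> \<Longrightarrow> ract M (a \<oplus>\<^bsub>M\<^esub> b) r = ract M a r \<oplus>\<^bsub>M\<^esub> ract M b r"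
  by (simp add: add_ract A_carrier brk_A H_closed ract_closed)

lemma ract_zero: "r \<in> carrier R \<Longrightarrow> ract M \<zero>\<^bsub>M\<^esub> r = \<zero>\<^bsub>M\<^esub>"
  using A_ract_add[OF G.K_zero G.K_zero, of r] by (simp add: ract_closed)

lemma A_ract_neg:
  assumes "a \<in> A" "r \<in> carrier R"
  shows "ract M (\<ominus>\<^bsub>M\<^esub> a) r = \<ominus>\<^bsub>M\<^esub> ract M a r"
proof -
  have "ract M (\<ominus>\<^bsub>M\<^esub> a) r \<oplus>\<^bsub>M\<^esub> ract M a r = \<zero>\<^bsub>M\<^esub>"
    using assms A_ract_add[OF G.K_neg[OF assms(1)] assms] by (simp add: A_carrier ract_zero)
  then show ?thesis
    using assms by (intro G.add.inv_equality[symmetric]) (simp_all add: A_carrier ract_closed)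
qed

text \<open>As m P(x) = [m, m] x, elements of Im P send \<open>M\<close> into \<open>A\<close> and,
  by the next lemma, \<open>A\<close> to zero; hence the quotient ring acts both on M/A and on
  \<open>A\<close>.\<close>

lemma ract_D: "\<lbrakk>m \<in> carrier M; k \<in> D\<rbrakk> \<Longrightarrow> ract M m k \<in> A"
  by (auto simp: ract_P brk_in_A)

lemma A_ract_D: "\<lbrakk>a \<in> A; k \<in> D\<rbrakk> \<Longrightarrow> ract M a k = \<zero>\<^bsub>M\<^esub>"
  by (auto simp: ract_P brk_A A_carrier)

lemma ract_mod_A:
  assumes m: "m \<in> carrier M" and r: "r \<in> carrier R" and a: "a \<in> A" and k: "k \<in> D"
  shows "A +>\<^bsub>M\<^esub> ract M (a \<oplus>\<^bsub>M\<^esub> m) (k \<oplus> r) = A +>\<^bsub>M\<^esub> ract M m r"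
proof -
  have "ract M (a \<oplus>\<^bsub>M\<^esub> m) (k \<oplus> r) =
      ract M (a \<oplus>\<^bsub>M\<^esub> m) k \<oplus>\<^bsub>M\<^esub> (ract M a r \<oplus>\<^bsub>M\<^esub> ract M m r)"
    using m r k by (simp add: ract_add add_ract brk_A H_closed A_carrier[OF a] a D.K_carrier ract_closed)
  then show ?thesis
    using m r a k by (simp add: G.coset_add_K ract_D A_ract ract_closed A_carrier)
qed

lemma cp_quotient_carrier: "carrier (cp_quotient M A) = {A +>\<^bsub>M\<^esub> m | m. m \<in> carrier M}"
  by (auto simp: cp_quotient_def FactRing_def A_RCOSETS_def')

lemma cp_quotient_add:
  "\<lbrakk>m \<in> carrier M; n \<in> carrier M\<rbrakk> \<Longrightarrow>
    (A +>\<^bsub>M\<^esub> m) \<oplus>\<^bsub>cp_quotient M A\<^esub> (A +>\<^bsub>M\<^esub> n) = A +>\<^bsub>M\<^esub> (m \<oplus>\<^bsub>M\<^esub> n)"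
  by (simp add: cp_quotient_def FactRing_def G.coset_sum)

lemma cp_quotient_smult:
  assumes m: "m \<in> carrier M" and r: "r \<in> carrier R"
  shows "(D +> r) \<odot>\<^bsub>cp_quotient M A\<^esub> (A +>\<^bsub>M\<^esub> m) = A +>\<^bsub>M\<^esub> ract M m r"
proof -
  have "A +>\<^bsub>M\<^esub> ract M m' r' = A +>\<^bsub>M\<^esub> ract M m r" if "m' \<in> A +>\<^bsub>M\<^esub> m" "r' \<in> D +> r" for m' r'
    using that ract_mod_A[OF m r] by (auto simp: D.mem_coset G.mem_coset)
  then have "(\<Union>r' \<in> D +> r. \<Union>m' \<in> A +>\<^bsub>M\<^esub> m. A +>\<^bsub>M\<^esub> ract M m' r') = A +>\<^bsub>M\<^esub> ract M m r"
    using D.coset_self[OF r] G.coset_self[OF m] by blast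
  then show ?thesis by (simp add: cp_quotient_def)
qed

lemma cp_sub_simps:
  "carrier (cp_sub M A) = A" "a \<oplus>\<^bsub>cp_sub M A\<^esub> b = a \<oplus>\<^bsub>M\<^esub> b" "\<zero>\<^bsub>cp_sub M A\<^esub> = \<zero>\<^bsub>M\<^esub>"
  by (simp_all add: cp_sub_def)

lemma cp_sub_smult:
  assumes a: "a \<in> A" and r: "r \<in> carrier R"
  shows "(D +> r) \<odot>\<^bsub>cp_sub M A\<^esub> a = ract M a r"
proof -
  have "ract M a r' = ract M a r" if "r' \<in> D +> r" for r'
    using that a r by (auto simp: D.mem_coset D.K_carrier ract_add A_carrier A_ract_D ract_closed simp del: image_iff)
  then have "ract M a ` (D +> r) = {ract M a r}" using D.coset_self[OF r] by blast
  then show ?thesis by (simp add: cp_sub_def)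
qed

end

section \<open>Module structures over the commutative quotient ring\<close>

locale comm_cp_module = comm_square_ring R E act T H P + cp_module R E act T H P M A
  for R (structure) and E act T H P M A
begin

lemma cp_quotient_module: "module (sq_bar R) (cp_quotient M A)"
proof (rule moduleI[OF bar_cring])
  show "abelian_group (cp_quotient M A)"
    by (rule G.quotient_abelian_group) (simp_all add: cp_quotient_def FactRing_def)
  fix \<rho> \<sigma> C assume "\<rho> \<in> carrier (sq_bar R)" "\<sigma> \<in> carrier (sq_bar R)" "C \<in> carrier (cp_quotient M A)"
  then obtain r s m where r: "r \<in> carrier R" "\<rho> = D +> r" and s: "s \<in> carrier R" "\<sigma> = D +> s"
    and m: "m \<in> carrier M" "C = A +>\<^bsub>M\<^esub> m"
    by (auto simp: bar_simps(1) cp_quotient_carrier)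
  show "(\<rho> \<oplus>\<^bsub>sq_bar R\<^esub> \<sigma>) \<odot>\<^bsub>cp_quotient M A\<^esub> C =
      \<rho> \<odot>\<^bsub>cp_quotient M A\<^esub> C \<oplus>\<^bsub>cp_quotient M A\<^esub> \<sigma> \<odot>\<^bsub>cp_quotient M A\<^esub> C"
    using r s m by (simp add: bar_add cp_quotient_smult cp_quotient_add ract_closed ract_add)
  \<comment> \<open>A right action is written on the left here, so the associativity law exchanges
    \<open>r\<close> and \<open>s\<close>; commutativity of the quotient ring restores the
    order.\<close>
  have "(D +> (r \<otimes> s)) = D +> (s \<otimes> r)" using r s by (simp add: mult_comm_mod_D)
  then show "(\<rho> \<otimes>\<^bsub>sq_bar R\<^esub> \<sigma>) \<odot>\<^bsub>cp_quotient M A\<^esub> C =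
      \<rho> \<odot>\<^bsub>cp_quotient M A\<^esub> (\<sigma> \<odot>\<^bsub>cp_quotient M A\<^esub> C)"
    using r s m by (simp add: bar_mult cp_quotient_smult ract_closed m_closed ract_ract)
next
  fix \<rho> C C' assume "\<rho> \<in> carrier (sq_bar R)" "C \<in> carrier (cp_quotient M A)" "C' \<in> carrier (cp_quotient M A)"
  then obtain r m n where r: "r \<in> carrier R" "\<rho> = D +> r" and n: "n \<in> carrier M" "C' = A +>\<^bsub>M\<^esub> n"
    and m: "m \<in> carrier M" "C = A +>\<^bsub>M\<^esub> m"
    by (auto simp: bar_simps(1) cp_quotient_carrier)
  \<comment> \<open>The failure of additivity of the action is this bracket, and it lies in
    \<open>A\<close>.\<close>
  define a where "a = brk M m n (H r)"
  have a: "a \<in> A" unfolding a_def using r m n by (intro brk_in_A H_closed)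
  have "ract M (m \<oplus>\<^bsub>M\<^esub> n) r = a \<oplus>\<^bsub>M\<^esub> (ract M m r \<oplus>\<^bsub>M\<^esub> ract M n r)"
    using r m n a by (simp add: add_ract ract_closed A_central a_def)
  then have "A +>\<^bsub>M\<^esub> ract M (m \<oplus>\<^bsub>M\<^esub> n) r = A +>\<^bsub>M\<^esub> (ract M m r \<oplus>\<^bsub>M\<^esub> ract M n r)"
    using G.coset_add_K[OF a] r m n by (simp add: ract_closed)
  then show "\<rho> \<odot>\<^bsub>cp_quotient M A\<^esub> (C \<oplus>\<^bsub>cp_quotient M A\<^esub> C') =
      \<rho> \<odot>\<^bsub>cp_quotient M A\<^esub> C \<oplus>\<^bsub>cp_quotient M A\<^esub> \<rho> \<odot>\<^bsub>cp_quotient M A\<^esub> C'"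
    using r m n by (simp add: cp_quotient_smult cp_quotient_add ract_closed)
qed (auto simp: bar_simps(1,2) cp_quotient_carrier cp_quotient_smult ract_closed ract_one one_R)

lemma cp_sub_module: "module (sq_bar R) (cp_sub M A)"
proof (rule moduleI[OF bar_cring])
  show "abelian_group (cp_sub M A)"
  proof (rule abelian_groupI, unfold cp_sub_simps)
    show "\<exists>b \<in> A. b \<oplus>\<^bsub>M\<^esub> a = \<zero>\<^bsub>M\<^esub>" if "a \<in> A" for a
      using that by (intro bexI[of _ "\<ominus>\<^bsub>M\<^esub> a"] G.K_neg) (simp_all add: A_carrier)
    show "a \<oplus>\<^bsub>M\<^esub> b = b \<oplus>\<^bsub>M\<^esub> a" if "a \<in> A" "b \<in> A" for a b
      using that by (rule A_comm)
  qed (simp_all add: G.K_add G.K_zero A_carrier G.add.m_assoc)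
  fix \<rho> \<sigma> a assume "\<rho> \<in> carrier (sq_bar R)" "\<sigma> \<in> carrier (sq_bar R)" "a \<in> carrier (cp_sub M A)"
  then obtain r s where r: "r \<in> carrier R" "\<rho> = D +> r" and s: "s \<in> carrier R" "\<sigma> = D +> s"
    and a: "a \<in> A"
    by (auto simp: bar_simps(1) cp_sub_simps)
  show "(\<rho> \<oplus>\<^bsub>sq_bar R\<^esub> \<sigma>) \<odot>\<^bsub>cp_sub M A\<^esub> a =
      \<rho> \<odot>\<^bsub>cp_sub M A\<^esub> a \<oplus>\<^bsub>cp_sub M A\<^esub> \<sigma> \<odot>\<^bsub>cp_sub M A\<^esub> a"
    using r s a by (simp add: bar_add cp_sub_smult cp_sub_simps A_carrier ract_add)
  have "(D +> (r \<otimes> s)) = D +> (s \<otimes> r)" using r s by (simp add: mult_comm_mod_D)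
  then show "(\<rho> \<otimes>\<^bsub>sq_bar R\<^esub> \<sigma>) \<odot>\<^bsub>cp_sub M A\<^esub> a =
      \<rho> \<odot>\<^bsub>cp_sub M A\<^esub> (\<sigma> \<odot>\<^bsub>cp_sub M A\<^esub> a)"
    using r s a by (simp add: bar_mult cp_sub_smult A_ract A_carrier m_closed ract_ract)
qed (auto simp: bar_simps(1,2) cp_sub_simps cp_sub_smult A_ract A_carrier ract_one one_R add_ract
    brk_A H_closed ract_closed G.K_add)

end

text \<open>On \<open>A\<close> the action factors through the commutative ring
  \<open>sq_bar R\<close>.\<close>

lemma (in comm_cp_module) A_ract_comm:
  assumes a: "a \<in> A" and r: "r \<in> carrier R" and s: "s \<in> carrier R"
  shows "ract M (ract M a r) s = ract M (ract M a s) r"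
  using cp_sub_smult[OF a m_closed[OF r s]] cp_sub_smult[OF a m_closed[OF s r]]
    mult_comm_mod_D[OF r s] a r s
  by (simp add: ract_ract A_carrier)

section \<open>Quadratic maps of CP-modules\<close>

context cp_module
begin

text \<open>A map on \<open>M\<close> that is constant on classes yields a map on the quotient by
  evaluation at this choice.\<close>

definition representative where "representative C = (SOME m. m \<in> carrier M \<and> A +>\<^bsub>M\<^esub> m = C)"

lemma representative:
  assumes "m \<in> carrier M"
  shows "representative (A +>\<^bsub>M\<^esub> m) \<in> carrier M"
    and "A +>\<^bsub>M\<^esub> representative (A +>\<^bsub>M\<^esub> m) = A +>\<^bsub>M\<^esub> m"
  using someI[of "\<lambda>n. n \<in> carrier M \<and> A +>\<^bsub>M\<^esub> n = A +>\<^bsub>M\<^esub> m" m] assms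
  unfolding representative_def by auto

lemma sq_span_superset: "X \<subseteq> sq_span R M X"
  by (auto simp: sq_span_def)

text \<open>\<open>A\<close> is itself stable under both operations, so the span conditions reduce
  to membership of the generators.\<close>

lemma sq_span_subset_A: "X \<subseteq> A \<Longrightarrow> sq_span R M X \<subseteq> A"
  using A_subgroup A_ract brk_in_A A_carrier
  by (auto simp: sq_span_def E_def intro!: Inter_lower)

end

section \<open>Deviations of a map between CP-modules\<close>

locale cp_map = comm_square_ring R E act T H P + M: comm_cp_module R E act T H P M A +
  N: comm_cp_module R E act T H P N B
  for R (structure) and E act T H P M A N B +
  fixes f
  assumes f_closed: "m \<in> carrier M \<Longrightarrow> f m \<in> carrier N"
begin

abbreviation "add_dev \<equiv> dev_add M N f"
abbreviation "ract_dev \<equiv> dev_ract M N f"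
abbreviation "brk_dev \<equiv> dev_brk M N f"

lemma N_minus_solve:
  "\<lbrakk>x \<in> carrier N; y \<in> carrier N\<rbrakk> \<Longrightarrow> (x \<ominus>\<^bsub>N\<^esub> y) \<oplus>\<^bsub>N\<^esub> y = x"
  by (simp add: a_minus_def N.G.add.m_assoc)

lemma N_minus_closed: "\<lbrakk>x \<in> carrier N; y \<in> carrier N\<rbrakk> \<Longrightarrow> x \<ominus>\<^bsub>N\<^esub> y \<in> carrier N"
  by (simp add: a_minus_def)

lemma add_dev_closed: "\<lbrakk>m \<in> carrier M; n \<in> carrier M\<rbrakk> \<Longrightarrow> add_dev m n \<in> carrier N"
  by (simp add: dev_add_def f_closed N_minus_closed)

text \<open>\<open>dev_add\<close> subtracts on the right, \<open>f n\<close> before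
  \<open>f m\<close>, so this order of summands is correct without commutativity.\<close>

lemma f_add:
  assumes "m \<in> carrier M" "n \<in> carrier M"
  shows "f (m \<oplus>\<^bsub>M\<^esub> n) = add_dev m n \<oplus>\<^bsub>N\<^esub> (f m \<oplus>\<^bsub>N\<^esub> f n)"
proof -
  have "add_dev m n \<oplus>\<^bsub>N\<^esub> f m \<oplus>\<^bsub>N\<^esub> f n = f (m \<oplus>\<^bsub>M\<^esub> n)"
    using assms by (simp add: dev_add_def f_closed N_minus_closed N_minus_solve)
  then show ?thesis using assms by (simp add: add_dev_closed f_closed N.G.add.m_assoc)
qed

lemma ract_dev_closed: "\<lbrakk>m \<in> carrier M; r \<in> carrier R\<rbrakk> \<Longrightarrow> ract_dev r m \<in> carrier N"
  by (simp add: dev_ract_def f_closed N_minus_closed N.ract_closed M.ract_closed)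

lemma f_ract:
  "\<lbrakk>m \<in> carrier M; r \<in> carrier R\<rbrakk> \<Longrightarrow> f (ract M m r) = ract_dev r m \<oplus>\<^bsub>N\<^esub> ract N (f m) r"
  by (simp add: dev_ract_def f_closed N_minus_solve N.ract_closed M.ract_closed)

lemma brk_dev_closed:
  "\<lbrakk>m \<in> carrier M; n \<in> carrier M; x \<in> carrier E\<rbrakk> \<Longrightarrow> brk_dev x m n \<in> carrier N"
  by (simp add: dev_brk_def f_closed N_minus_closed N.brk_closed M.brk_closed)

lemma f_brk:
  "\<lbrakk>m \<in> carrier M; n \<in> carrier M; x \<in> carrier E\<rbrakk> \<Longrightarrow>
    f (brk M m n x) = brk_dev x m n \<oplus>\<^bsub>N\<^esub> brk N (f m) (f n) x"
  by (simp add: dev_brk_def f_closed N_minus_solve N.brk_closed M.brk_closed)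

end

section \<open>Factorizations obtained from a quadratic map\<close>

locale quadratic_cp_map = cp_map +
  assumes quadratic: "cp_quadratic R M A N B f"
begin

lemma add_dev_B:
  assumes "m \<in> carrier M" "n \<in> carrier M"
  shows "add_dev m n \<in> B"
proof -
  have "sq_span R N {add_dev m n |m n. m \<in> carrier M \<and> n \<in> carrier M} \<subseteq> B"
    using quadratic by (simp add: cp_quadratic_def)
  from subset_trans[OF N.sq_span_superset this] show ?thesis using assms by blast
qed

lemma ract_dev_B:
  assumes "m \<in> carrier M" "r \<in> carrier R"
  shows "ract_dev r m \<in> B"
proof -
  have "sq_span R N (ract_dev r ` carrier M) \<subseteq> B"
    using quadratic assms by (simp add: cp_quadratic_def)
  from subset_trans[OF N.sq_span_superset this] show ?thesis using assms by blast
qed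

lemma brk_dev_B:
  assumes "m \<in> carrier M" "n \<in> carrier M" "x \<in> carrier E"
  shows "brk_dev x m n \<in> B"
proof -
  have "sq_span R N {brk_dev x m n |m n. m \<in> carrier M \<and> n \<in> carrier M} \<subseteq> B"
    using quadratic assms by (simp add: cp_quadratic_def E_def)
  from subset_trans[OF N.sq_span_superset this] show ?thesis using assms by blast
qed

lemma linearD:
  assumes "sq_linear R M N h"
  shows "\<lbrakk>m \<in> carrier M; n \<in> carrier M\<rbrakk> \<Longrightarrow> h (m \<oplus>\<^bsub>M\<^esub> n) = h m \<oplus>\<^bsub>N\<^esub> h n"
    and "\<lbrakk>m \<in> carrier M; r \<in> carrier R\<rbrakk> \<Longrightarrow> h (ract M m r) = ract N (h m) r"
  using assms by (auto simp: sq_linear_def hom_def)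

lemma add_dev_linear:
  assumes "m \<in> carrier M"
  shows "sq_linear R M N (\<lambda>n. add_dev n m)" "sq_linear R M N (\<lambda>n. add_dev m n)"
  using assms quadratic unfolding cp_quadratic_def sq_bilinear_def by blast+

lemma brk_dev_linear:
  assumes "m \<in> carrier M" "x \<in> carrier E"
  shows "sq_linear R M N (\<lambda>n. brk_dev x n m)" "sq_linear R M N (\<lambda>n. brk_dev x m n)"
  using assms quadratic unfolding cp_quadratic_def sq_bilinear_def E_def by blast+

lemma add_dev_A:
  "\<lbrakk>m \<in> carrier M; a \<in> A\<rbrakk> \<Longrightarrow> add_dev m a = \<zero>\<^bsub>N\<^esub>"
  "\<lbrakk>m \<in> carrier M; a \<in> A\<rbrakk> \<Longrightarrow> add_dev a m = \<zero>\<^bsub>N\<^esub>"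
  using quadratic unfolding cp_quadratic_def by blast+

lemma ract_dev_A: "\<lbrakk>r \<in> carrier R; a \<in> A\<rbrakk> \<Longrightarrow> ract_dev r a = \<zero>\<^bsub>N\<^esub>"
  using quadratic unfolding cp_quadratic_def by blast

lemma brk_dev_A: "\<lbrakk>m \<in> carrier M; a \<in> A; x \<in> carrier E\<rbrakk> \<Longrightarrow> brk_dev x a m = \<zero>\<^bsub>N\<^esub>"
  "\<lbrakk>m \<in> carrier M; a \<in> A; x \<in> carrier E\<rbrakk> \<Longrightarrow> brk_dev x m a = \<zero>\<^bsub>N\<^esub>"
  using quadratic unfolding cp_quadratic_def E_def by blast+

lemma ract_dev_ract:
  assumes "m \<in> carrier M" "r \<in> carrier R" "s \<in> carrier R"
  shows "ract_dev r (ract M m s) = ract N (ract_dev r m) (s \<otimes> s)"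
proof -
  have "s [^] (2::nat) = s \<otimes> s"
    using assms(3) mult_monoid by (simp add: numeral_2_eq_2 nat_pow_def monoid.l_one)
  moreover have "ract_dev r (ract M m s) = ract N (ract_dev r m) (s [^] (2::nat))"
    using assms quadratic unfolding cp_quadratic_def by blast
  ultimately show ?thesis by simp
qed

lemma add_dev_coset:
  assumes "A +>\<^bsub>M\<^esub> m = A +>\<^bsub>M\<^esub> m'" "A +>\<^bsub>M\<^esub> n = A +>\<^bsub>M\<^esub> n'"
    "m \<in> carrier M" "m' \<in> carrier M" "n \<in> carrier M" "n' \<in> carrier M"
  shows "add_dev m n = add_dev m' n'"
proof -
  obtain a where a: "a \<in> A" "m = a \<oplus>\<^bsub>M\<^esub> m'" using assms M.G.coset_eqD by blast
  obtain c where c: "c \<in> A" "n = c \<oplus>\<^bsub>M\<^esub> n'" using assms M.G.coset_eqD by blast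
  have "add_dev m n = add_dev m' n"
    using a assms by (simp add: linearD(1)[OF add_dev_linear(1)] M.A_carrier add_dev_A add_dev_closed)
  also have "\<dots> = add_dev m' n'"
    using c assms by (simp add: linearD(1)[OF add_dev_linear(2)] M.A_carrier add_dev_A add_dev_closed)
  finally show ?thesis .
qed

lemma tensor_factorization:
  obtains h where "h \<in> mod_hom (sq_bar R)
      (tensor_module (sq_bar R) (cp_quotient M A) (cp_quotient M A)) (cp_sub N B)"
    and "\<And>m n. \<lbrakk>m \<in> carrier M; n \<in> carrier M\<rbrakk> \<Longrightarrow> add_dev m n =
      h (pure_tensor (sq_bar R) (cp_quotient M A) (cp_quotient M A) (A +>\<^bsub>M\<^esub> m) (A +>\<^bsub>M\<^esub> n))"
proof -
  define b where "b C C' = add_dev (M.representative C) (M.representative C')" for C C'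
  have b: "b (A +>\<^bsub>M\<^esub> m) (A +>\<^bsub>M\<^esub> n) = add_dev m n" if "m \<in> carrier M" "n \<in> carrier M" for m n
    unfolding b_def using that by (intro add_dev_coset M.representative)
  interpret tensor_modules "sq_bar R" "cp_quotient M A" "cp_quotient M A"
    by (intro tensor_modules.intro M.cp_quotient_module)
  obtain h where h: "h \<in> mod_hom (sq_bar R)
      (tensor_module (sq_bar R) (cp_quotient M A) (cp_quotient M A)) (cp_sub N B)"
    and hb: "\<And>x y. \<lbrakk>x \<in> carrier (cp_quotient M A); y \<in> carrier (cp_quotient M A)\<rbrakk> \<Longrightarrow>
      h (pure_tensor (sq_bar R) (cp_quotient M A) (cp_quotient M A) x y) = b x y"
    by (rule tensor_lift[OF N.cp_sub_module, where b = b])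
      (auto simp: M.cp_quotient_carrier M.cp_quotient_add M.cp_quotient_smult bar_simps(1) b
        N.cp_sub_simps N.cp_sub_smult add_dev_B M.ract_closed linearD[OF add_dev_linear(1)]
        linearD[OF add_dev_linear(2)])
  have c: "A +>\<^bsub>M\<^esub> m \<in> carrier (cp_quotient M A)" if "m \<in> carrier M" for m
    using that by (auto simp: M.cp_quotient_carrier)
  show thesis
  proof (rule that[OF h])
    fix m n assume mn: "m \<in> carrier M" "n \<in> carrier M"
    show "add_dev m n =
      h (pure_tensor (sq_bar R) (cp_quotient M A) (cp_quotient M A) (A +>\<^bsub>M\<^esub> m) (A +>\<^bsub>M\<^esub> n))"
      unfolding hb[OF c[OF mn(1)] c[OF mn(2)]] using b[OF mn] by (rule sym)
  qed
qed

text \<open>The cross effect of \<open>m \<mapsto> f(m \<cdot> r) - f(m) \<cdot> r\<close>.\<close>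

definition cross :: "'a \<Rightarrow> 'd \<Rightarrow> 'd \<Rightarrow> 'f" where
  "cross r m n = ract N (add_dev m n) (r \<otimes> r) \<ominus>\<^bsub>N\<^esub> ract N (add_dev m n) r \<oplus>\<^bsub>N\<^esub> brk_dev (H r) m n"

lemma cross_B:
  assumes "m \<in> carrier M" "n \<in> carrier M" "r \<in> carrier R"
  shows "cross r m n \<in> B"
  using assms
  by (simp add: cross_def a_minus_def N.G.K_add N.G.K_neg N.A_ract add_dev_B brk_dev_B H_closed m_closed)

text \<open>The element (m + n) r differs from m r + n r by a bracket in \<open>A\<close>, where
  \<open>add_dev\<close> vanishes; the square comes from linearity of \<open>add_dev\<close> in both
  arguments at m r and n r.\<close>

lemma f_add_ract:
  assumes m: "m \<in> carrier M" and n: "n \<in> carrier M" and r: "r \<in> carrier R"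
  shows "f (ract M (m \<oplus>\<^bsub>M\<^esub> n) r) =
    ract N (add_dev m n) (r \<otimes> r) \<oplus>\<^bsub>N\<^esub> (f (ract M m r) \<oplus>\<^bsub>N\<^esub> f (ract M n r)) \<oplus>\<^bsub>N\<^esub>
      (brk_dev (H r) m n \<oplus>\<^bsub>N\<^esub> brk N (f m) (f n) (H r))"
proof -
  let ?c = "brk M m n (H r)"
  have c: "?c \<in> A" using m n r by (intro M.brk_in_A H_closed)
  have mr: "ract M m r \<in> carrier M" "ract M n r \<in> carrier M" using m n r by (simp_all add: M.ract_closed)
  have "f (ract M (m \<oplus>\<^bsub>M\<^esub> n) r) = f (ract M m r \<oplus>\<^bsub>M\<^esub> ract M n r) \<oplus>\<^bsub>N\<^esub> f ?c"
    using m n r mr c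
    by (simp add: M.add_ract f_add[of "ract M m r \<oplus>\<^bsub>M\<^esub> ract M n r" ?c] add_dev_A M.A_carrier f_closed)
  also have "f ?c = brk_dev (H r) m n \<oplus>\<^bsub>N\<^esub> brk N (f m) (f n) (H r)"
    using m n r by (intro f_brk H_closed)
  also have "f (ract M m r \<oplus>\<^bsub>M\<^esub> ract M n r) =
      ract N (add_dev m n) (r \<otimes> r) \<oplus>\<^bsub>N\<^esub> (f (ract M m r) \<oplus>\<^bsub>N\<^esub> f (ract M n r))"
    using m n r mr
    by (simp add: f_add linearD(2)[OF add_dev_linear(1)] linearD(2)[OF add_dev_linear(2)]
        N.ract_ract add_dev_closed)
  finally show ?thesis .
qed

text \<open>The deviation \<open>add_dev m n\<close> lies in \<open>B\<close>, so its bracket with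
  the rest vanishes and only the bracket of \<open>f m\<close> and \<open>f n\<close> is
  left.\<close>

lemma ract_f_add:
  assumes m: "m \<in> carrier M" and n: "n \<in> carrier M" and r: "r \<in> carrier R"
  shows "ract N (f (m \<oplus>\<^bsub>M\<^esub> n)) r =
    ract N (add_dev m n) r \<oplus>\<^bsub>N\<^esub> (ract N (f m) r \<oplus>\<^bsub>N\<^esub> ract N (f n) r \<oplus>\<^bsub>N\<^esub> brk N (f m) (f n) (H r))"
  using m n r add_dev_B[OF m n]
  by (simp add: f_add N.add_ract f_closed N.A_carrier N.brk_A H_closed N.ract_closed N.brk_closed)

text \<open>In both expansions every term except \<open>u\<close> and \<open>v\<close> lies in
  \<open>B\<close>. These central terms are moved past \<open>u\<close> and \<open>v\<close>, and
  \<open>\<gamma>\<close>, which occurs on both sides, cancels.\<close>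

lemma ract_dev_add:
  assumes m: "m \<in> carrier M" and n: "n \<in> carrier M" and r: "r \<in> carrier R"
  shows "ract_dev r (m \<oplus>\<^bsub>M\<^esub> n) = ract_dev r m \<oplus>\<^bsub>N\<^esub> ract_dev r n \<oplus>\<^bsub>N\<^esub> cross r m n"
proof -
  define p where "p = ract N (add_dev m n) (r \<otimes> r)"
  define q where "q = ract N (add_dev m n) r"
  define u where "u = ract N (f m) r"
  define v where "v = ract N (f n) r"
  define F where "F = ract_dev r m"
  define G where "G = ract_dev r n"
  define \<beta> where "\<beta> = brk_dev (H r) m n"
  define \<gamma> where "\<gamma> = brk N (f m) (f n) (H r)"
  note defs = p_def q_def u_def v_def F_def G_def \<beta>_def \<gamma>_def
  have B: "p \<in> B" "q \<in> B" "F \<in> B" "G \<in> B" "\<beta> \<in> B" "\<gamma> \<in> B"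
    using m n r unfolding defs
    by (simp_all add: N.A_ract add_dev_B ract_dev_B brk_dev_B N.brk_in_A f_closed H_closed m_closed)
  note BN = B[THEN N.A_carrier]
  have uv: "u \<in> carrier N" "v \<in> carrier N"
    using m n r unfolding defs by (simp_all add: N.ract_closed f_closed)
  note closed = BN uv
  have "f (ract M (m \<oplus>\<^bsub>M\<^esub> n) r) = p \<oplus>\<^bsub>N\<^esub> ((F \<oplus>\<^bsub>N\<^esub> u) \<oplus>\<^bsub>N\<^esub> (G \<oplus>\<^bsub>N\<^esub> v)) \<oplus>\<^bsub>N\<^esub> (\<beta> \<oplus>\<^bsub>N\<^esub> \<gamma>)"
    unfolding f_add_ract[OF m n r] f_ract[OF m r] f_ract[OF n r] defs ..
  also have "(F \<oplus>\<^bsub>N\<^esub> u) \<oplus>\<^bsub>N\<^esub> (G \<oplus>\<^bsub>N\<^esub> v) = (F \<oplus>\<^bsub>N\<^esub> G) \<oplus>\<^bsub>N\<^esub> (u \<oplus>\<^bsub>N\<^esub> v)"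
  proof -
    have "u \<oplus>\<^bsub>N\<^esub> (G \<oplus>\<^bsub>N\<^esub> v) = G \<oplus>\<^bsub>N\<^esub> (u \<oplus>\<^bsub>N\<^esub> v)"
      using closed N.A_central[OF B(4) uv(1)] by (simp add: N.G.add.m_assoc[symmetric])
    then show ?thesis using closed by (simp add: N.G.add.m_assoc)
  qed
  also have "p \<oplus>\<^bsub>N\<^esub> ((F \<oplus>\<^bsub>N\<^esub> G) \<oplus>\<^bsub>N\<^esub> (u \<oplus>\<^bsub>N\<^esub> v)) \<oplus>\<^bsub>N\<^esub> (\<beta> \<oplus>\<^bsub>N\<^esub> \<gamma>) =
      (p \<oplus>\<^bsub>N\<^esub> (F \<oplus>\<^bsub>N\<^esub> G) \<oplus>\<^bsub>N\<^esub> (\<beta> \<oplus>\<^bsub>N\<^esub> \<gamma>)) \<oplus>\<^bsub>N\<^esub> (u \<oplus>\<^bsub>N\<^esub> v)"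
    using closed N.A_central[OF N.G.K_add[OF B(5,6)], of "u \<oplus>\<^bsub>N\<^esub> v"]
    by (simp add: N.G.add.m_assoc)
  finally have lhs: "f (ract M (m \<oplus>\<^bsub>M\<^esub> n) r) = \<dots>" .
  have "ract N (f (m \<oplus>\<^bsub>M\<^esub> n)) r = q \<oplus>\<^bsub>N\<^esub> ((u \<oplus>\<^bsub>N\<^esub> v) \<oplus>\<^bsub>N\<^esub> \<gamma>)"
    using m n r unfolding defs by (simp add: ract_f_add)
  also have "\<dots> = (q \<oplus>\<^bsub>N\<^esub> \<gamma>) \<oplus>\<^bsub>N\<^esub> (u \<oplus>\<^bsub>N\<^esub> v)"
    using closed N.A_central[OF B(6), of "u \<oplus>\<^bsub>N\<^esub> v"] by (simp add: N.G.add.m_assoc)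
  finally have rhs: "ract N (f (m \<oplus>\<^bsub>M\<^esub> n)) r = \<dots>" .
  \<comment> \<open>The claimed value of the deviation. The goal becomes that \<open>t\<close> plus
    the expansion \<open>rhs\<close> is the expansion \<open>lhs\<close>.\<close>
  define t where "t = F \<oplus>\<^bsub>N\<^esub> G \<oplus>\<^bsub>N\<^esub> (p \<ominus>\<^bsub>N\<^esub> q \<oplus>\<^bsub>N\<^esub> \<beta>)"
  have qneg: "\<ominus>\<^bsub>N\<^esub> q \<in> B" using B by (intro N.G.K_neg)
  have t: "t \<in> carrier N" using closed by (simp add: t_def a_minus_def)
  have "t \<oplus>\<^bsub>N\<^esub> (q \<oplus>\<^bsub>N\<^esub> \<gamma>) = p \<oplus>\<^bsub>N\<^esub> (F \<oplus>\<^bsub>N\<^esub> G) \<oplus>\<^bsub>N\<^esub> (\<beta> \<oplus>\<^bsub>N\<^esub> \<gamma>)"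
  proof -
    \<comment> \<open>The pair - q + q is kept on the right, so both sides have the same summands
      and sorting inside \<open>B\<close> proves them equal.\<close>
    have "t \<oplus>\<^bsub>N\<^esub> (q \<oplus>\<^bsub>N\<^esub> \<gamma>) =
        (\<ominus>\<^bsub>N\<^esub> q \<oplus>\<^bsub>N\<^esub> q) \<oplus>\<^bsub>N\<^esub> (p \<oplus>\<^bsub>N\<^esub> (F \<oplus>\<^bsub>N\<^esub> G) \<oplus>\<^bsub>N\<^esub> (\<beta> \<oplus>\<^bsub>N\<^esub> \<gamma>))"
      using B qneg closed
      by (simp del: N.G.add.l_inv add: t_def a_minus_def N.G.K_add N.G.add.m_assoc N.A_comm N.A_lcomm N.A_carrier)
    then show ?thesis using closed by simp
  qed
  then have "f (ract M (m \<oplus>\<^bsub>M\<^esub> n) r) = t \<oplus>\<^bsub>N\<^esub> (q \<oplus>\<^bsub>N\<^esub> \<gamma>) \<oplus>\<^bsub>N\<^esub> (u \<oplus>\<^bsub>N\<^esub> v)"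
    unfolding lhs by simp
  also have "\<dots> = t \<oplus>\<^bsub>N\<^esub> ract N (f (m \<oplus>\<^bsub>M\<^esub> n)) r"
    using closed t unfolding rhs by (simp add: N.G.add.m_assoc)
  finally have "ract_dev r (m \<oplus>\<^bsub>M\<^esub> n) = t"
    using t m n r by (simp add: dev_ract_def a_minus_def N.G.add.m_assoc N.ract_closed f_closed)
  then show ?thesis by (simp add: t_def defs cross_def)
qed

lemma brk_dev_coset:
  assumes "A +>\<^bsub>M\<^esub> m = A +>\<^bsub>M\<^esub> m'" "A +>\<^bsub>M\<^esub> n = A +>\<^bsub>M\<^esub> n'"
    "m \<in> carrier M" "m' \<in> carrier M" "n \<in> carrier M" "n' \<in> carrier M" "x \<in> carrier E"
  shows "brk_dev x m n = brk_dev x m' n'"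
proof -
  obtain a where a: "a \<in> A" "m = a \<oplus>\<^bsub>M\<^esub> m'" using assms M.G.coset_eqD by blast
  obtain c where c: "c \<in> A" "n = c \<oplus>\<^bsub>M\<^esub> n'" using assms M.G.coset_eqD by blast
  have "brk_dev x m n = brk_dev x m' n"
    using a assms by (simp add: linearD(1)[OF brk_dev_linear(1)] M.A_carrier brk_dev_A brk_dev_closed)
  also have "\<dots> = brk_dev x m' n'"
    using c assms by (simp add: linearD(1)[OF brk_dev_linear(2)] M.A_carrier brk_dev_A brk_dev_closed)
  finally show ?thesis .
qed

lemma cross_coset:
  assumes "A +>\<^bsub>M\<^esub> m = A +>\<^bsub>M\<^esub> m'" "A +>\<^bsub>M\<^esub> n = A +>\<^bsub>M\<^esub> n'"
    "m \<in> carrier M" "m' \<in> carrier M" "n \<in> carrier M" "n' \<in> carrier M" "r \<in> carrier R"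
  shows "cross r m n = cross r m' n'"
  unfolding cross_def using add_dev_coset[OF assms(1-6)] brk_dev_coset[OF assms(1-6) H_closed[OF assms(7)]]
  by simp

text \<open>\<open>ract_dev r\<close> is not additive, so its vanishing on \<open>A\<close> does not
  suffice; its cross effect with an element of \<open>A\<close> vanishes as well.\<close>

lemma ract_dev_coset:
  assumes "A +>\<^bsub>M\<^esub> m = A +>\<^bsub>M\<^esub> n" "m \<in> carrier M" "n \<in> carrier M" "r \<in> carrier R"
  shows "ract_dev r m = ract_dev r n"
proof -
  obtain a where a: "a \<in> A" "m = a \<oplus>\<^bsub>M\<^esub> n" using assms M.G.coset_eqD by blast
  have "cross r a n = \<zero>\<^bsub>N\<^esub>"
    using a assms by (simp add: cross_def add_dev_A brk_dev_A H_closed N.ract_zero m_closed a_minus_def)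
  then show ?thesis
    using a assms by (simp add: ract_dev_add M.A_carrier ract_dev_A ract_dev_closed)
qed

lemma cross_add:
  assumes "m \<in> carrier M" "m' \<in> carrier M" "n \<in> carrier M" "r \<in> carrier R"
  shows "cross r (m \<oplus>\<^bsub>M\<^esub> m') n = cross r m n \<oplus>\<^bsub>N\<^esub> cross r m' n"
proof -
  note B = N.A_ract add_dev_B brk_dev_B N.G.K_neg H_closed m_closed
  show ?thesis
    using assms
    by (simp add: cross_def linearD(1)[OF add_dev_linear(1)] linearD(1)[OF brk_dev_linear(1)]
        N.A_ract_add a_minus_def N.G.add.inv_mult_group N.G.add.m_assoc N.A_comm N.A_lcomm
        N.A_carrier N.G.K_add B)
qed

text \<open>The action of \<open>s\<close> has to be moved past those of \<open>r\<close> and of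
  \<open>r \<otimes> r\<close>; on \<open>B\<close> they commute by
  \<open>A_ract_comm\<close>.\<close>

lemma cross_ract:
  assumes "m \<in> carrier M" "n \<in> carrier M" "r \<in> carrier R" "s \<in> carrier R"
  shows "cross r (ract M m s) n = ract N (cross r m n) s"
proof -
  note B = N.A_ract add_dev_B brk_dev_B N.G.K_neg H_closed m_closed N.G.K_add
  show ?thesis
    using assms
    by (simp add: cross_def linearD(2)[OF add_dev_linear(1)] linearD(2)[OF brk_dev_linear(1)]
        N.A_ract_add a_minus_def N.A_ract_neg B N.A_ract_comm[of _ s])
qed

lemma divided_power_factorization:
  assumes r: "r \<in> carrier R"
  obtains h where "h \<in> mod_hom (sq_bar R) (dp_component (sq_bar R) (cp_quotient M A) 2) (cp_sub N B)"
    and "\<And>m. m \<in> carrier M \<Longrightarrow>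
      ract_dev r m = h (dp_gamma (sq_bar R) (cp_quotient M A) 2 (A +>\<^bsub>M\<^esub> m))"
proof -
  define q where "q C = ract_dev r (M.representative C)" for C
  define b where "b C C' = cross r (M.representative C) (M.representative C')" for C C'
  have q: "q (A +>\<^bsub>M\<^esub> m) = ract_dev r m" if "m \<in> carrier M" for m
    unfolding q_def using that r by (intro ract_dev_coset M.representative)
  have b: "b (A +>\<^bsub>M\<^esub> m) (A +>\<^bsub>M\<^esub> n) = cross r m n" if "m \<in> carrier M" "n \<in> carrier M" for m n
    unfolding b_def using that r by (intro cross_coset M.representative)
  interpret quadratic_map "sq_bar R" "cp_quotient M A" "cp_sub N B" q b
    by (intro quadratic_map.intro divided_powers.intro quadratic_map_axioms.intro
        M.cp_quotient_module N.cp_sub_module)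
      (auto simp: M.cp_quotient_carrier M.cp_quotient_add M.cp_quotient_smult bar_simps(1) bar_mult
        b q N.cp_sub_simps N.cp_sub_smult ract_dev_B cross_B ract_dev_add cross_add cross_ract
        ract_dev_ract M.ract_closed m_closed r)
  obtain h where h: "h \<in> mod_hom (sq_bar R) (dp_component (sq_bar R) (cp_quotient M A) 2) (cp_sub N B)"
    and hq: "\<And>x. x \<in> carrier (cp_quotient M A) \<Longrightarrow> h (dp_gamma (sq_bar R) (cp_quotient M A) 2 x) = q x"
    using dp_component_lift by blast
  show thesis
  proof (rule that[OF h])
    fix m assume m: "m \<in> carrier M"
    then have "A +>\<^bsub>M\<^esub> m \<in> carrier (cp_quotient M A)" by (auto simp: M.cp_quotient_carrier)
    from hq[OF this] q[OF m]
    show "ract_dev r m = h (dp_gamma (sq_bar R) (cp_quotient M A) 2 (A +>\<^bsub>M\<^esub> m))" by simp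
  qed
qed

end

text \<open>Commutativity identifies the actions \<open>act r \<one> x \<one>\<close>,
  \<open>act \<one> r x \<one>\<close> and \<open>act \<one> \<one> x r\<close>, so a scalar can
  leave either argument of the bracket.\<close>

lemma (in comm_cp_module) brk_ract:
  assumes m: "m \<in> carrier M" and n: "n \<in> carrier M" and x: "x \<in> carrier E" and r: "r \<in> carrier R"
  shows "brk M (ract M m r) n x = ract M (brk M m n x) r"
    and "brk M m (ract M n r) x = ract M (brk M m n x) r"
proof -
  have "ract M (brk M m n x) r = brk M m n (act \<one> \<one> x r)"
    using brk_act[OF m n one_R one_R x r] m n by (simp add: ract_one)
  moreover have "brk M (ract M m r) n x = brk M m n (act r \<one> x \<one>)"
    using brk_act[OF m n r one_R x one_R] m n r x by (simp add: ract_one brk_closed ract_closed)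
  moreover have "brk M m (ract M n r) x = brk M m n (act \<one> r x \<one>)"
    using brk_act[OF m n one_R r x one_R] m n r x by (simp add: ract_one brk_closed ract_closed)
  ultimately show "brk M (ract M m r) n x = ract M (brk M m n x) r"
    and "brk M m (ract M n r) x = ract M (brk M m n x) r"
    using act_eq[OF r x] by simp_all
qed

lemma (in square_ring) zero_mult_zero: "\<zero> \<otimes> \<zero> = \<zero>"
  using r_distr[of \<zero> \<zero> \<zero>] m_closed[of \<zero> \<zero>] by simp

lemma (in cp_module) ract_R_zero: "m \<in> carrier M \<Longrightarrow> ract M m \<zero> = \<zero>\<^bsub>M\<^esub>"
  using ract_add[of m \<zero> \<zero>] by (simp add: ract_closed)

section \<open>Quadratic maps obtained from factorizations\<close>

locale factored_cp_map = cp_map +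
  fixes h k
  assumes f_A: "a \<in> A \<Longrightarrow> f a \<in> B"
    and h: "h \<in> mod_hom (sq_bar R)
      (tensor_module (sq_bar R) (cp_quotient M A) (cp_quotient M A)) (cp_sub N B)"
    and add_dev_h: "\<lbrakk>m \<in> carrier M; n \<in> carrier M\<rbrakk> \<Longrightarrow> add_dev m n =
      h (pure_tensor (sq_bar R) (cp_quotient M A) (cp_quotient M A) (A +>\<^bsub>M\<^esub> m) (A +>\<^bsub>M\<^esub> n))"
    and k: "r \<in> carrier R \<Longrightarrow>
      k r \<in> mod_hom (sq_bar R) (dp_component (sq_bar R) (cp_quotient M A) 2) (cp_sub N B)"
    and ract_dev_k: "\<lbrakk>m \<in> carrier M; r \<in> carrier R\<rbrakk> \<Longrightarrow>
      ract_dev r m = k r (dp_gamma (sq_bar R) (cp_quotient M A) 2 (A +>\<^bsub>M\<^esub> m))"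
begin

sublocale X: tensor_modules "sq_bar R" "cp_quotient M A" "cp_quotient M A"
  by (intro tensor_modules.intro M.cp_quotient_module)

sublocale Y: divided_powers "sq_bar R" "cp_quotient M A"
  by (intro divided_powers.intro M.cp_quotient_module)

lemma coset_closed: "m \<in> carrier M \<Longrightarrow> A +>\<^bsub>M\<^esub> m \<in> carrier (cp_quotient M A)"
  by (auto simp: M.cp_quotient_carrier)

lemma bar_closed: "r \<in> carrier R \<Longrightarrow> D +> r \<in> carrier (sq_bar R)"
  by (auto simp: bar_simps(1))

lemma add_dev_B: "\<lbrakk>m \<in> carrier M; n \<in> carrier M\<rbrakk> \<Longrightarrow> add_dev m n \<in> B"
  using mod_homD(1)[OF h] X.pure_tensor_closed by (simp add: add_dev_h coset_closed N.cp_sub_simps)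

lemma add_dev_add:
  assumes "m \<in> carrier M" "m' \<in> carrier M" "n \<in> carrier M"
  shows "add_dev (m \<oplus>\<^bsub>M\<^esub> m') n = add_dev m n \<oplus>\<^bsub>N\<^esub> add_dev m' n"
    and "add_dev n (m \<oplus>\<^bsub>M\<^esub> m') = add_dev n m \<oplus>\<^bsub>N\<^esub> add_dev n m'"
  using assms
  by (simp_all add: add_dev_h M.cp_quotient_add[symmetric] X.pure_tensor_add_left
      X.pure_tensor_add_right coset_closed mod_homD(2)[OF h] X.pure_tensor_closed N.cp_sub_simps)

lemma add_dev_ract:
  assumes "m \<in> carrier M" "n \<in> carrier M" "r \<in> carrier R"
  shows "add_dev (ract M m r) n = ract N (add_dev m n) r"
    and "add_dev n (ract M m r) = ract N (add_dev n m) r"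
  using assms add_dev_B[of m n] add_dev_B[of n m]
  by (simp_all add: add_dev_h M.ract_closed M.cp_quotient_smult[symmetric] X.pure_tensor_smult_left
      X.pure_tensor_smult_right coset_closed bar_closed mod_homD(3)[OF h] X.pure_tensor_closed
      N.cp_sub_smult)

lemma coset_A: "a \<in> A \<Longrightarrow> A +>\<^bsub>M\<^esub> a = A +>\<^bsub>M\<^esub> \<zero>\<^bsub>M\<^esub>"
  by (simp add: M.G.coset_K M.G.coset_zero)

lemma add_dev_A:
  assumes m: "m \<in> carrier M" and a: "a \<in> A"
  shows "add_dev m a = \<zero>\<^bsub>N\<^esub>" and "add_dev a m = \<zero>\<^bsub>N\<^esub>"
proof -
  have "add_dev m a = add_dev m \<zero>\<^bsub>M\<^esub>" "add_dev a m = add_dev \<zero>\<^bsub>M\<^esub> m"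
    using m a by (simp_all add: add_dev_h M.A_carrier coset_A[OF a])
  moreover have "add_dev m \<zero>\<^bsub>M\<^esub> = \<zero>\<^bsub>N\<^esub>" "add_dev \<zero>\<^bsub>M\<^esub> m = \<zero>\<^bsub>N\<^esub>"
    using add_dev_add[of "\<zero>\<^bsub>M\<^esub>" "\<zero>\<^bsub>M\<^esub>" m] m by (simp_all add: add_dev_closed)
  ultimately show "add_dev m a = \<zero>\<^bsub>N\<^esub>" and "add_dev a m = \<zero>\<^bsub>N\<^esub>" by simp_all
qed

lemma ract_dev_B: "\<lbrakk>m \<in> carrier M; r \<in> carrier R\<rbrakk> \<Longrightarrow> ract_dev r m \<in> B"
  using mod_homD(1)[OF k] Y.dp_gamma_closed
  by (simp add: ract_dev_k coset_closed N.cp_sub_simps)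

lemma ract_dev_ract:
  assumes "m \<in> carrier M" "r \<in> carrier R" "s \<in> carrier R"
  shows "ract_dev r (ract M m s) = ract N (ract_dev r m) (s \<otimes> s)"
proof -
  have "ract_dev r (ract M m s) = (D +> (s \<otimes> s)) \<odot>\<^bsub>cp_sub N B\<^esub> ract_dev r m"
    using assms
    by (simp add: ract_dev_k M.ract_closed M.cp_quotient_smult[symmetric] Y.dp_gamma_2_smult
        coset_closed bar_closed bar_mult mod_homD(3)[OF k] Y.dp_gamma_closed m_closed)
  then show ?thesis using assms by (simp add: N.cp_sub_smult ract_dev_B m_closed)
qed

lemma ract_dev_A:
  assumes "r \<in> carrier R" "a \<in> A"
  shows "ract_dev r a = \<zero>\<^bsub>N\<^esub>"
proof -
  have "ract_dev r a = ract_dev r \<zero>\<^bsub>M\<^esub>"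
    using assms by (simp add: ract_dev_k M.A_carrier coset_A)
  \<comment> \<open>The zero of \<open>M\<close> is its own multiple by the ring element
    \<open>\<zero>\<close>, so \<open>ract_dev_ract\<close> multiplies its deviation by
    \<open>\<zero> \<otimes> \<zero> = \<zero>\<close>.\<close>
  also have "\<dots> = \<zero>\<^bsub>N\<^esub>"
    using ract_dev_ract[of "\<zero>\<^bsub>M\<^esub>" r \<zero>] assms(1)
    by (simp add: M.ract_zero zero_mult_zero N.ract_R_zero ract_dev_closed)
  finally show ?thesis .
qed

lemma f_zero: "f \<zero>\<^bsub>M\<^esub> = \<zero>\<^bsub>N\<^esub>"
  using f_add[of "\<zero>\<^bsub>M\<^esub>" "\<zero>\<^bsub>M\<^esub>"] add_dev_A[OF _ M.G.K_zero, of "\<zero>\<^bsub>M\<^esub>"]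
  by (simp add: f_closed)

lemma f_add_A: "\<lbrakk>a \<in> A; c \<in> A\<rbrakk> \<Longrightarrow> f (a \<oplus>\<^bsub>M\<^esub> c) = f a \<oplus>\<^bsub>N\<^esub> f c"
  by (simp add: f_add M.A_carrier add_dev_A f_closed)

lemma f_ract_A: "\<lbrakk>a \<in> A; r \<in> carrier R\<rbrakk> \<Longrightarrow> f (ract M a r) = ract N (f a) r"
  by (simp add: f_ract M.A_carrier ract_dev_A f_closed N.ract_closed)

text \<open>Compatibility with brackets is automatic: brackets in \<open>M\<close> lie in
  \<open>A\<close>, which \<open>g\<close> kills, and brackets of values in \<open>B\<close>
  vanish.\<close>

lemma linearI:
  assumes "\<And>m. m \<in> carrier M \<Longrightarrow> g m \<in> B"
    and "\<And>m n. \<lbrakk>m \<in> carrier M; n \<in> carrier M\<rbrakk> \<Longrightarrow> g (m \<oplus>\<^bsub>M\<^esub> n) = g m \<oplus>\<^bsub>N\<^esub> g n"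
    and "\<And>m r. \<lbrakk>m \<in> carrier M; r \<in> carrier R\<rbrakk> \<Longrightarrow> g (ract M m r) = ract N (g m) r"
    and "\<And>a. a \<in> A \<Longrightarrow> g a = \<zero>\<^bsub>N\<^esub>"
  shows "sq_linear R M N g"
  using assms unfolding sq_linear_def E_def[symmetric]
  by (simp add: hom_def Pi_def N.A_carrier M.brk_in_A N.brk_A)

lemma brk_dev_B:
  "\<lbrakk>m \<in> carrier M; n \<in> carrier M; x \<in> carrier E\<rbrakk> \<Longrightarrow> brk_dev x m n \<in> B"
  by (simp add: dev_brk_def a_minus_def N.G.K_add N.G.K_neg N.brk_in_A f_closed f_A M.brk_in_A)

lemma brk_dev_A:
  assumes "m \<in> carrier M" "a \<in> A" "x \<in> carrier E"
  shows "brk_dev x m a = \<zero>\<^bsub>N\<^esub>" and "brk_dev x a m = \<zero>\<^bsub>N\<^esub>"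
  using assms
  by (simp_all add: dev_brk_def M.brk_A M.brk_right_A N.brk_A N.brk_right_A f_zero f_A f_closed a_minus_def)

lemma brk_dev_add:
  assumes "m \<in> carrier M" "m' \<in> carrier M" "n \<in> carrier M" "x \<in> carrier E"
  shows "brk_dev x (m \<oplus>\<^bsub>M\<^esub> m') n = brk_dev x m n \<oplus>\<^bsub>N\<^esub> brk_dev x m' n"
    and "brk_dev x n (m \<oplus>\<^bsub>M\<^esub> m') = brk_dev x n m \<oplus>\<^bsub>N\<^esub> brk_dev x n m'"
proof -
  note B = f_A M.brk_in_A N.brk_in_A N.G.K_neg N.G.K_add f_closed
  \<comment> \<open>\<open>f\<close> is additive up to an element of \<open>B\<close>, which
    brackets ignore.\<close>
  have "brk N (f (m \<oplus>\<^bsub>M\<^esub> m')) (f n) x = brk N (f m) (f n) x \<oplus>\<^bsub>N\<^esub> brk N (f m') (f n) x"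
    "brk N (f n) (f (m \<oplus>\<^bsub>M\<^esub> m')) x = brk N (f n) (f m) x \<oplus>\<^bsub>N\<^esub> brk N (f n) (f m') x"
    using assms add_dev_B[of m m']
    by (simp_all add: f_add N.brk_add1 N.brk_add2 f_closed N.A_carrier N.brk_A N.brk_right_A N.brk_closed)
  then show "brk_dev x (m \<oplus>\<^bsub>M\<^esub> m') n = brk_dev x m n \<oplus>\<^bsub>N\<^esub> brk_dev x m' n"
    and "brk_dev x n (m \<oplus>\<^bsub>M\<^esub> m') = brk_dev x n m \<oplus>\<^bsub>N\<^esub> brk_dev x n m'"
    using assms
    by (simp_all add: dev_brk_def M.brk_add1 M.brk_add2 f_add_A a_minus_def N.G.add.inv_mult_group
        N.G.add.m_assoc N.A_comm N.A_lcomm N.A_carrier B)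
qed

lemma brk_dev_ract:
  assumes "m \<in> carrier M" "n \<in> carrier M" "x \<in> carrier E" "r \<in> carrier R"
  shows "brk_dev x (ract M m r) n = ract N (brk_dev x m n) r"
    and "brk_dev x n (ract M m r) = ract N (brk_dev x n m) r"
proof -
  note B = f_A M.brk_in_A N.brk_in_A N.G.K_neg N.G.K_add f_closed N.ract_closed
  \<comment> \<open>The failure of \<open>f\<close> to commute with \<open>r\<close> lies in
    \<open>B\<close> and disappears in the bracket; \<open>N.brk_ract\<close> then moves
    \<open>r\<close> outside.\<close>
  have "brk N (f (ract M m r)) (f n) x = ract N (brk N (f m) (f n) x) r"
    "brk N (f n) (f (ract M m r)) x = ract N (brk N (f n) (f m) x) r"
    using assms ract_dev_B[of m r]
    by (simp_all add: f_ract N.brk_add1 N.brk_add2 B N.A_carrier N.brk_A N.brk_right_A N.brk_ract N.brk_closed)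
  then show "brk_dev x (ract M m r) n = ract N (brk_dev x m n) r"
    and "brk_dev x n (ract M m r) = ract N (brk_dev x n m) r"
    using assms
    by (simp_all add: dev_brk_def M.brk_ract f_ract_A a_minus_def N.A_ract_add N.A_ract_neg B)
qed

lemma cp_quadratic: "cp_quadratic R M A N B f"
proof -
  have power2: "s [^] (2::nat) = s \<otimes> s" if "s \<in> carrier R" for s
    using that mult_monoid by (simp add: numeral_2_eq_2 nat_pow_def monoid.l_one)
  have "sq_bilinear R M N add_dev"
    unfolding sq_bilinear_def
    by (intro conjI ballI linearI) (simp_all add: add_dev_B add_dev_add add_dev_ract add_dev_A)
  moreover have "sq_bilinear R M N (brk_dev x)" if "x \<in> carrier E" for x
    unfolding sq_bilinear_def using that
    by (intro conjI ballI linearI) (simp_all add: brk_dev_B brk_dev_add brk_dev_ract brk_dev_A)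
  moreover have "sq_span R N {add_dev m n |m n. m \<in> carrier M \<and> n \<in> carrier M} \<subseteq> B"
    by (rule N.sq_span_subset_A) (auto simp: add_dev_B)
  moreover have "sq_span R N (ract_dev r ` carrier M) \<subseteq> B" if "r \<in> carrier R" for r
    using that by (intro N.sq_span_subset_A) (auto simp: ract_dev_B)
  moreover have "sq_span R N {brk_dev x m n |m n. m \<in> carrier M \<and> n \<in> carrier M} \<subseteq> B"
    if "x \<in> carrier E" for x
    using that by (intro N.sq_span_subset_A) (auto simp: brk_dev_B)
  moreover have "f \<in> carrier M \<rightarrow> carrier N" "f ` A \<subseteq> B" by (auto simp: f_closed f_A)
  ultimately show ?thesis
    unfolding cp_quadratic_def E_def[symmetric]
    by (simp add: power2 ract_dev_ract add_dev_A ract_dev_A brk_dev_A)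
qed

end

theorem proposition3p2p20:
  fixes R :: "('r, 'x) square_ring"
    and M :: "('r, 'x, 'm) bhp_module" and A :: "'m set"
    and N :: "('r, 'x, 'n) bhp_module" and B :: "'n set"
    and f :: "'m \<Rightarrow> 'n"
  assumes "comm_square_ring R"
    and "cp_module R M A" and "cp_module R N B"
    and "f \<in> carrier M \<rightarrow> carrier N"
  shows "cp_quadratic R M A N B f \<longleftrightarrow>
    f ` A \<subseteq> B \<and>
    (\<exists>h \<in> mod_hom (sq_bar R)
             (tensor_module (sq_bar R) (cp_quotient M A) (cp_quotient M A)) (cp_sub N B).
       \<forall>m \<in> carrier M. \<forall>m' \<in> carrier M.
         dev_add M N f m m' =
           h (pure_tensor (sq_bar R) (cp_quotient M A) (cp_quotient M A)
                (A +>\<^bsub>M\<^esub> m) (A +>\<^bsub>M\<^esub> m'))) \<and>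
    (\<forall>r \<in> carrier R.
       \<exists>h \<in> mod_hom (sq_bar R)
             (dp_component (sq_bar R) (cp_quotient M A) 2) (cp_sub N B).
       \<forall>m \<in> carrier M.
         dev_ract M N f r m = h (dp_gamma (sq_bar R) (cp_quotient M A) 2 (A +>\<^bsub>M\<^esub> m)))"
  (is "_ \<longleftrightarrow> ?A \<and> ?T \<and> ?G")
proof -
  have map: "cp_map R M A N B f"
    using assms by (intro cp_map.intro comm_cp_module.intro cp_map_axioms.intro) auto
  show ?thesis
  proof
    assume quadratic: "cp_quadratic R M A N B f"
    interpret quadratic_cp_map R "sq_ee R" "sq_act R" "sq_T R" "sq_H R" "sq_P R" M A N B f
      by (intro quadratic_cp_map.intro quadratic_cp_map_axioms.intro map quadratic)
    have ?A using quadratic by (simp add: cp_quadratic_def)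
    moreover have ?T
      by (rule tensor_factorization) blast
    moreover have ?G
    proof
      fix r assume "r \<in> carrier R"
      then show "\<exists>h \<in> mod_hom (sq_bar R) (dp_component (sq_bar R) (cp_quotient M A) 2) (cp_sub N B).
          \<forall>m \<in> carrier M. dev_ract M N f r m = h (dp_gamma (sq_bar R) (cp_quotient M A) 2 (A +>\<^bsub>M\<^esub> m))"
        by (rule divided_power_factorization) blast
    qed
    ultimately show "?A \<and> ?T \<and> ?G" by blast
  next
    assume factored: "?A \<and> ?T \<and> ?G"
    then obtain h where "h \<in> mod_hom (sq_bar R)
        (tensor_module (sq_bar R) (cp_quotient M A) (cp_quotient M A)) (cp_sub N B)"
      "\<forall>m \<in> carrier M. \<forall>m' \<in> carrier M. dev_add M N f m m' =
        h (pure_tensor (sq_bar R) (cp_quotient M A) (cp_quotient M A) (A +>\<^bsub>M\<^esub> m) (A +>\<^bsub>M\<^esub> m'))"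
      by blast
    \<comment> \<open>The morphisms for the various \<open>r\<close> are chosen all at once, as a
      function \<open>k\<close>.\<close>
    moreover from factored obtain k where "\<forall>r \<in> carrier R.
        k r \<in> mod_hom (sq_bar R) (dp_component (sq_bar R) (cp_quotient M A) 2) (cp_sub N B) \<and>
        (\<forall>m \<in> carrier M.
          dev_ract M N f r m = k r (dp_gamma (sq_bar R) (cp_quotient M A) 2 (A +>\<^bsub>M\<^esub> m)))"
      by metis
    ultimately have "factored_cp_map R M A N B f h k"
      using factored by (intro factored_cp_map.intro factored_cp_map_axioms.intro map) auto
    then show "cp_quadratic R M A N B f" by (rule factored_cp_map.cp_quadratic)
  qed
qed

end
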